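(* Let $\pi\in\Pi$ be an arbitrary control plan and let $z_\epsilon^{\pi,y_0}(\cdot)$ be the corresponding solution of the hybrid system. There exists $z_\epsilon(\cdot)$, a solution of the differential inclusion $$\dot z(s)\in V_g(z(s)),\quad z(0)=z_0,$$ such that $$\max_{s\in[0,1]}E\,\|z_\epsilon^{\pi,y_0}(s)-z_\epsilon(s)\|\le\psi_1(\epsilon)$$ for some $\psi_1(\epsilon)$ such that $\lim_{\epsilon\to0}\psi_1(\epsilon)=0$.
   Context: Discrete-time system. $Y\subset\mathbb R^m$ is compact, $\hat U$ and $S$ are compact metric spaces, $f:Y\times\hat U\times S\to\mathbb R^m$ is continuous, and $f(y,u,\sigma)\in Y$ for all $(y,u,\sigma)\in Y\times\hat U\times S$. $\sigma(0),\sigma(1),\dots$ are i.i.d. random elements of $S$ defined on a common probability space; $\sigma$ denotes a random element with their common law, and $E$ is the expectation. The system is $y(t+1)=f(y(t),u(t),\sigma(t))$, $y(0)=y_0\in Y$. For a small parameter $\epsilon>0$, a control plan is $\pi=\{\pi_t\}_{t=0,\dots,\lfloor1/\epsilon\rfloor}$ with $\pi_0\in\hat U$ and $\pi_t:S^t\to\hat U$ Borel measurable for $t\ge1$; the controls are $u(0)=\pi_0$, $u(t)=\pi_t(\sigma(0),\dots,\sigma(t-1))$. $\Pi$ is the set of all such plans and $(y^{\pi,y_0}(\cdot),u^{\pi,y_0}(\cdot))$ is the resulting state-control trajectory. Hybrid system. $z_\epsilon^{\pi,y_0}(\cdot)$ is the solution on $[0,1]$ of $\dot z_\epsilon(s)=g(z_\epsilon(s),y_\epsilon(s),u_\epsilon(s))$,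 $z_\epsilon(0)=z_0\in\mathbb R^n$, where $y_\epsilon(s)=y^{\pi,y_0}(t)$ and $u_\epsilon(s)=u^{\pi,y_0}(t)$ for $s\in[\epsilon t,\epsilon(t+1))$, $t=0,1,\dots,\lfloor1/\epsilon\rfloor$. The function $g:\mathbb R^n\times Y\times\hat U\to\mathbb R^n$ is continuous and satisfies a Lipschitz condition in $z$ on a sufficiently large compact set $Z\subset\mathbb R^n$ that contains all the solutions of the hybrid system in its interior: for some $C>0$, $\|g(z_1,y,u)-g(z_2,y,u)\|\le C\|z_1-z_2\|$ for all $z_1,z_2\in Z$, $y\in Y$, $u\in\hat U$. Stationary measures and $V_g$. $W$ is the set of Borel probability measures $\gamma$ on $Y\times\hat U$ such that $\int_{Y\times\hat U}(E[\varphi(f(y,u,\sigma))]-\varphi(y))\,\gamma(dy,du)=0$ for all $\varphi\in C(Y)$, and $V_g(z)=\bigcup_{\gamma\in W}\big\{\int_{Y\times\hat U}g(z,y,u)\,\gamma(dy,du)\big\}$. A solution of the differential inclusion is an absolutely continuous function on $[0,1]$ with $z(0)=z_0$ satisfying the inclusion for almost all $s\in[0,1]$.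
   Formalization: The solution z_ε(·) of the differential inclusion is allowed to be random (for each outcome a solution, measurable for each s), as the claim fails for a single deterministic solution; ψ_1 is uniform over plans, and the bound is for all small ε. *)

theory Defs
  imports "HOL-Probability.Probability"
begin

(* A plan for parameter eps is pi_0, ..., pi_N with N = floor (1/eps). It is encoded as a function on
   nat whose values beyond N are irrelevant. S^t is the product space PiM {..<t} (%_. borel), whose
   points are the functions restricted to {..<t}; S^0 has exactly one point, so pi 0 is a constant.
   Since S is a compact metric space, this product sigma-algebra is the Borel sigma-algebra of S^t. *)
definition control_plans ::
  "real \<Rightarrow> (nat \<Rightarrow> (nat \<Rightarrow> 's::topological_space) \<Rightarrow> 'u::topological_space) set" where
  "control_plans \<epsilon> =
     {\<pi>. \<forall>t\<le>nat \<lfloor>1 / \<epsilon>\<rfloor>. \<pi> t \<in> (\<Pi>\<^sub>M i\<in>{..<t}. borel) \<rightarrow>\<^sub>M borel}"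

(* xi is a realization of the noise sequence. *)
definition control :: "(nat \<Rightarrow> (nat \<Rightarrow> 's) \<Rightarrow> 'u) \<Rightarrow> (nat \<Rightarrow> 's) \<Rightarrow> nat \<Rightarrow> 'u" where
  "control \<pi> \<xi> t = \<pi> t (restrict \<xi> {..<t})"

primrec state ::
  "('y \<Rightarrow> 'u \<Rightarrow> 's \<Rightarrow> 'y) \<Rightarrow> (nat \<Rightarrow> (nat \<Rightarrow> 's) \<Rightarrow> 'u) \<Rightarrow> 'y \<Rightarrow> (nat \<Rightarrow> 's) \<Rightarrow> nat \<Rightarrow> 'y" where
  "state f \<pi> y0 \<xi> 0 = y0"
| "state f \<pi> y0 \<xi> (Suc t) = f (state f \<pi> y0 \<xi> t) (control \<pi> \<xi> t) (\<xi> t)"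

(* On the sampling interval [eps t, eps (t+1)) the inputs y and u are frozen at y(t) and u(t). The
   derivative is one-sided at the left end of each sampling interval, so z may have corners there.
   Sampling intervals that miss {0..1} impose no condition; so only t <= floor (1/eps) matters. *)
definition hybrid_solution ::
  "('y \<Rightarrow> 'u \<Rightarrow> 's \<Rightarrow> 'y) \<Rightarrow> ('z::real_normed_vector \<Rightarrow> 'y \<Rightarrow> 'u \<Rightarrow> 'z) \<Rightarrow> 'y \<Rightarrow> 'z \<Rightarrow> real \<Rightarrow>
    (nat \<Rightarrow> (nat \<Rightarrow> 's) \<Rightarrow> 'u) \<Rightarrow> (nat \<Rightarrow> 's) \<Rightarrow> (real \<Rightarrow> 'z) \<Rightarrow> bool" where
  "hybrid_solution f g y0 z0 \<epsilon> \<pi> \<xi> z \<longleftrightarrow>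
     continuous_on {0..1} z \<and> z 0 = z0 \<and>
     (\<forall>t. let I = {\<epsilon> * real t..<\<epsilon> * (real t + 1)} \<inter> {0..1} in
       \<forall>s\<in>I. (z has_vector_derivative g (z s) (state f \<pi> y0 \<xi> t) (control \<pi> \<xi> t)) (at s within I))"

(* W, for dynamics f on Y and P the law of one noise element. *)
definition stationary_measures ::
  "('y::topological_space \<Rightarrow> 'u::topological_space \<Rightarrow> 's \<Rightarrow> 'y) \<Rightarrow> 'y set \<Rightarrow> 's measure \<Rightarrow>
    ('y \<times> 'u) measure set" where
  "stationary_measures f Y P =
     {\<gamma>. prob_space \<gamma> \<and> sets \<gamma> = sets (restrict_space borel (Y \<times> UNIV)) \<and>
       (\<forall>\<phi> :: 'y \<Rightarrow> real. continuous_on Y \<phi> \<longrightarrow>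
         (\<integral>(y, u). (\<integral>\<sigma>. \<phi> (f y u \<sigma>) \<partial>P) - \<phi> y \<partial>\<gamma>) = 0)}"

definition averaged_velocities ::
  "('y \<times> 'u) measure set \<Rightarrow>
    ('z::{banach, second_countable_topology} \<Rightarrow> 'y \<Rightarrow> 'u \<Rightarrow> 'z) \<Rightarrow> 'z \<Rightarrow> 'z set" where
  "averaged_velocities W g z = (\<Union>\<gamma>\<in>W. {\<integral>(y, u). g z y u \<partial>\<gamma>})"

(* The usual epsilon-delta notion; a division of T is a finite family of compact intervals with
   pairwise disjoint interiors and union T. *)
definition abs_continuous_on :: "real set \<Rightarrow> (real \<Rightarrow> 'a::real_normed_vector) \<Rightarrow> bool" where
  "abs_continuous_on I f \<longleftrightarrow>
     (\<forall>e>0. \<exists>d>0. \<forall>D T. D division_of T \<and> T \<subseteq> I \<and> (\<Sum>K\<in>D. Sup K - Inf K) < d \<longrightarrow>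
       (\<Sum>K\<in>D. norm (f (Sup K) - f (Inf K))) < e)"

definition inclusion_solution ::
  "('z::real_normed_vector \<Rightarrow> 'z set) \<Rightarrow> 'z \<Rightarrow> (real \<Rightarrow> 'z) \<Rightarrow> bool" where
  "inclusion_solution V z0 z \<longleftrightarrow>
     abs_continuous_on {0..1} z \<and> z 0 = z0 \<and>
     (AE s in lebesgue_on {0..1}. \<exists>v\<in>V (z s). (z has_vector_derivative v) (at s within {0..1}))"

end

(*
Over a window of slow time the fast variables enter only through their occupation measure. Along a path
the accumulated drift of a test function is, up to a telescoping sum, a martingale; over 1/eps steps of
weight eps its variance is of order eps. Hence, with probability close to 1 and uniformly in the plan,
the occupation measures are almost stationary when tested on finitely many monomials.

Consider trajectories whose drifts tend to 0 for every monomial. By Arzela-Ascoli they have a uniform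
limit. At a point where this limit is differentiable its derivative is a limit of window averages of g,
and the occupation measures of shrinking windows converge weakly, along a subsequence, to a member of W;
so the derivative lies in V_g. The limit is Lipschitz and therefore differentiable almost everywhere. By
contradiction, finitely many drift conditions force a trajectory to be uniformly close to a solution of
the inclusion with values in Z. (A Gronwall estimate would not do: g is Lipschitz only on Z, and a
perturbed solution could leave Z.) Selecting from a finite net of solutions makes the choice measurable,
and the exceptional event costs at most the diameter of Z times its small probability.
*)
theory Submission
  imports Defs "HOL-Complex_Analysis.Great_Picard"
begin

text \<open>The bound must hold for all plans at once, and a plan is merely a measurable function of
  the noise history. Compactness is therefore applied to deterministic curves driven by arbitrary
  samples in \<open>X\<close>; randomness enters only through the probability that finitely many
  drift conditions hold. These conditions bound the integral from 0 to every \<open>b\<close>, so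
  that a window is a difference of two such integrals and errors below the square of its length
  survive division by the length. Monomials serve because there are countably many of them, while
  Stone-Weierstrass recovers all continuous test functions. Uniformity in \<open>b\<close> needs
  only second moments: a grid of times fixed before \<open>\<epsilon>\<close> is handled by a union
  bound, and the boundedness of the drift fills the gaps.

  Hybrid solutions are given separately for each realization, so their measurability must be
  derived. A Picard iteration does this, with its arguments moved into \<open>Z\<close>, where the
  velocity is bounded and Lipschitz. Weak compactness is reduced to the line by coding a compact
  metric space in the unit interval.\<close>

section \<open>Almost everywhere differentiability of Lipschitz curves\<close>

text \<open>Vitali selects countably many disjoint intervals that cover almost all of
  \<open>E\<close>, and countable additivity turns the comparison on each interval into one for
  their union. Confinement to \<open>G\<close> and coverage by the interior of \<open>A\<close>
  allow a second application inside the first union.\<close>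

lemma Vitali_covering_comparison:
  fixes \<nu> \<kappa> :: "real measure" and E :: "real set"
  assumes sets_eq: "sets \<nu> = sets borel" "sets \<kappa> = sets borel"
    and "open G" "E \<subseteq> G"
    and fine: "\<And>x d. x \<in> E \<Longrightarrow> d > 0 \<Longrightarrow>
      \<exists>a b. a < b \<and> x \<in> {a..b} \<and> b - a < d \<and> emeasure \<nu> {a..b} \<le> emeasure \<kappa> {a..b}"
  obtains A where "A \<in> sets borel" "A \<subseteq> G" "negligible (E - interior A)"
    "emeasure \<nu> A \<le> emeasure \<kappa> A"
proof -
  \<comment> \<open>The covering theorem concerns balls, so an interval is recorded by its midpoint
    and half its length.\<close>
  define K where "K = {(c, r). 0 < r \<and> cball c r \<subseteq> G \<and> emeasure \<nu> (cball c r) \<le> emeasure \<kappa> (cball c r)}"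
  have "\<exists>i. i \<in> K \<and> x \<in> cball (fst i) (snd i) \<and> snd i < d" if "x \<in> E" "d > 0" for x d
  proof -
    obtain e where e: "e > 0" "ball x e \<subseteq> G"
      using \<open>open G\<close> \<open>E \<subseteq> G\<close> \<open>x \<in> E\<close> openE by blast
    obtain a b where ab: "a < b" "x \<in> {a..b}" "b - a < min d e" "emeasure \<nu> {a..b} \<le> emeasure \<kappa> {a..b}"
      using fine[OF \<open>x \<in> E\<close>, of "min d e"] e \<open>d > 0\<close> by auto
    have cb: "cball ((a + b) / 2) ((b - a) / 2) = {a..b}"
      by (simp add: cball_eq_atLeastAtMost field_simps)
    have "{a..b} \<subseteq> ball x e"
      using ab by (auto simp: dist_real_def)
    then have "((a + b) / 2, (b - a) / 2) \<in> K"
      using ab e by (auto simp: K_def cb)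
    moreover have "(b - a) / 2 < d" "x \<in> cball ((a + b) / 2) ((b - a) / 2)"
      unfolding cb using ab by auto
    ultimately show ?thesis
      by (metis fst_conv snd_conv)
  qed
  moreover have "0 < snd i" if "i \<in> K" for i
    using that by (auto simp: K_def)
  note K = this calculation
  obtain D where D: "countable D" "D \<subseteq> K"
    and pw: "pairwise (\<lambda>i j. disjnt (cball (fst i) (snd i)) (cball (fst j) (snd j))) D"
    and neg: "negligible (E - (\<Union>i\<in>D. cball (fst i) (snd i)))"
    by (rule Vitali_covering_theorem_cballs[of K snd E fst]) (use K in blast)+
  define A where "A = (\<Union>i\<in>D. cball (fst i) (snd i))"
  have disj: "disjoint_family_on (\<lambda>i. cball (fst i) (snd i)) D"
    using pw by (auto simp: disjoint_family_on_def pairwise_def disjnt_def)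
  show thesis
  proof (rule that)
    show "A \<in> sets borel"
      unfolding A_def using D by (intro sets.countable_UN') auto
    show "A \<subseteq> G"
      unfolding A_def by (rule UN_least) (use D(2) in \<open>auto simp: K_def dest!: subsetD\<close>)
    \<comment> \<open>A sphere on the line is a pair of points. Countably many of them are
      negligible, so passing to interiors costs nothing.\<close>
    have "(\<Union>i\<in>D. ball (fst i) (snd i)) \<subseteq> interior A"
      by (rule interior_maximal) (auto simp: A_def intro: less_imp_le)
    moreover have "A \<subseteq> (\<Union>i\<in>D. ball (fst i) (snd i)) \<union> (\<Union>i\<in>D. sphere (fst i) (snd i))"
      unfolding A_def by (force simp: order_le_less)
    ultimately have "E - interior A \<subseteq> (E - A) \<union> (\<Union>i\<in>D. sphere (fst i) (snd i))"
      by blast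
    moreover have "negligible (\<Union>i\<in>D. sphere (fst i) (snd i))"
      using D by (auto intro: negligible_sphere)
    ultimately show "negligible (E - interior A)"
      using neg A_def by (metis negligible_Un negligible_subset)
    have "emeasure \<nu> A = (\<integral>\<^sup>+i. emeasure \<nu> (cball (fst i) (snd i)) \<partial>count_space D)"
      unfolding A_def using D disj by (intro emeasure_UN_countable) (auto simp: sets_eq)
    also have "\<dots> \<le> (\<integral>\<^sup>+i. emeasure \<kappa> (cball (fst i) (snd i)) \<partial>count_space D)"
      using D by (intro nn_integral_mono) (auto simp: K_def)
    also have "\<dots> = emeasure \<kappa> A"
      unfolding A_def using D disj by (intro emeasure_UN_countable[symmetric]) (auto simp: sets_eq)
    finally show "emeasure \<nu> A \<le> emeasure \<kappa> A" .
  qed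
qed

text \<open>Let \<open>m\<close> be the measure of \<open>E\<close>, and let \<open>\<mu>\<close> be
  the Lebesgue-Stieltjes measure of \<open>F\<close>. Intervals of slope at most \<open>p\<close>
  inside a tight open set give \<open>A\<close> of \<open>\<mu>\<close>-measure at most
  \<open>p * (m + e)\<close>. Intervals of slope at least \<open>q\<close> chosen inside
  \<open>A\<close> still cover almost all of \<open>E\<close>, so \<open>q * m\<close> is at most
  the \<open>\<mu>\<close>-measure of \<open>A\<close>. Letting \<open>e\<close> tend to 0 forces
  \<open>m = 0\<close>.\<close>

lemma negligible_oscillating_slopes:
  fixes F :: "real \<Rightarrow> real"
  assumes mono: "\<And>x y. x \<le> y \<Longrightarrow> F x \<le> F y" and cont: "continuous_on UNIV F"
    and "0 \<le> p" "p < q"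
    and E: "E \<in> lmeasurable"
    and lower: "\<And>x d. x \<in> E \<Longrightarrow> d > 0 \<Longrightarrow>
      \<exists>a b. a < b \<and> x \<in> {a..b} \<and> b - a < d \<and> F b - F a \<le> p * (b - a)"
    and upper: "\<And>x d. x \<in> E \<Longrightarrow> d > 0 \<Longrightarrow>
      \<exists>a b. a < b \<and> x \<in> {a..b} \<and> b - a < d \<and> q * (b - a) \<le> F b - F a"
  shows "negligible E"
proof -
  define \<mu> where "\<mu> = interval_measure F"
  have \<mu>: "emeasure \<mu> {a..b} = ennreal (F b - F a)" if "a \<le> b" for a b
    unfolding \<mu>_def by (intro emeasure_interval_measure_Icc that mono cont)
  have lb: "emeasure (density lborel (\<lambda>_. ennreal c)) A = ennreal c * emeasure lborel A"
    if "A \<in> sets borel" for c and A :: "real set"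
    using that by (subst emeasure_density_const) auto
  define m where "m = measure lebesgue E"
  have "q * m \<le> p * (m + e)" if "e > 0" for e
  proof -
    obtain G where G0: "open G" "E \<subseteq> G" "G - E \<in> lmeasurable" "emeasure lebesgue (G - E) < ennreal e"
      using sets_lebesgue_outer_open[OF fmeasurableD[OF E] \<open>e > 0\<close>] by blast
    have "G = E \<union> (G - E)"
      using G0 by auto
    then have "G \<in> lmeasurable"
      using fmeasurable.Un[OF E G0(3)] by simp
    moreover have "measure lebesgue (G - E) < e"
      using G0(3,4) \<open>e > 0\<close> by (simp add: emeasure_eq_measure2 ennreal_less_iff)
    ultimately have G: "open G" "E \<subseteq> G" "G \<in> lmeasurable" "measure lebesgue (G - E) < e"
      using G0 by auto
    have mG: "measure lebesgue G \<le> m + e"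
      using measurable_measure_Diff[OF G(3) fmeasurableD[OF E] G(2)] G(4) by (simp add: m_def)
    have "\<exists>a b. a < b \<and> x \<in> {a..b} \<and> b - a < d \<and>
        emeasure \<mu> {a..b} \<le> emeasure (density lborel (\<lambda>_. ennreal p)) {a..b}"
      if x: "x \<in> E" "d > 0" for x d
    proof -
      obtain a b where ab: "a < b" "x \<in> {a..b}" "b - a < d" "F b - F a \<le> p * (b - a)"
        using lower x by blast
      then have "emeasure \<mu> {a..b} \<le> emeasure (density lborel (\<lambda>_. ennreal p)) {a..b}"
        using \<open>0 \<le> p\<close> by (simp add: \<mu> lb ennreal_leI flip: ennreal_mult)
      with ab show ?thesis by blast
    qed
    then obtain A where A: "A \<in> sets borel" "A \<subseteq> G" "negligible (E - interior A)"
        "emeasure \<mu> A \<le> emeasure (density lborel (\<lambda>_. ennreal p)) A"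
      using Vitali_covering_comparison[of \<mu> "density lborel (\<lambda>_. ennreal p)" G E] G
      by (metis \<mu>_def sets_density sets_interval_measure sets_lborel)
    have "\<exists>a b. a < b \<and> x \<in> {a..b} \<and> b - a < d \<and>
        emeasure (density lborel (\<lambda>_. ennreal q)) {a..b} \<le> emeasure \<mu> {a..b}"
      if x: "x \<in> E \<inter> interior A" "d > 0" for x d
    proof -
      obtain a b where ab: "a < b" "x \<in> {a..b}" "b - a < d" "q * (b - a) \<le> F b - F a"
        using upper x by blast
      then have "emeasure (density lborel (\<lambda>_. ennreal q)) {a..b} \<le> emeasure \<mu> {a..b}"
        using \<open>0 \<le> p\<close> \<open>p < q\<close> by (simp add: \<mu> lb ennreal_leI flip: ennreal_mult)
      with ab show ?thesis by blast
    qed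
    then obtain A' where A': "A' \<in> sets borel" "A' \<subseteq> interior A"
        "negligible (E \<inter> interior A - interior A')"
        "emeasure (density lborel (\<lambda>_. ennreal q)) A' \<le> emeasure \<mu> A'"
      using Vitali_covering_comparison[of "density lborel (\<lambda>_. ennreal q)" \<mu> "interior A" "E \<inter> interior A"]
      by (metis \<mu>_def sets_density sets_interval_measure sets_lborel open_interior inf_le2)
    have "negligible (E - A')"
    proof (rule negligible_subset)
      show "negligible ((E - interior A) \<union> (E \<inter> interior A - interior A'))"
        using A A' by (intro negligible_Un)
      show "E - A' \<subseteq> (E - interior A) \<union> (E \<inter> interior A - interior A')"
        using interior_subset by auto
    qed
    have A'm: "A' \<in> lmeasurable"
      using G(3) A(2) A'(1,2) interior_subset[of A]
      by (intro fmeasurableI2[of G _ A']) auto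
    have Am: "A \<in> lmeasurable"
      using G(3) A(1,2) by (intro fmeasurableI2[of G _ A]) auto
    have "m \<le> measure lebesgue (A' \<union> (E - A'))"
      unfolding m_def using E A'm \<open>negligible (E - A')\<close>
      by (intro measure_mono_fmeasurable) (auto simp: negligible_imp_measurable)
    also have "\<dots> = measure lebesgue A'"
      using \<open>negligible (E - A')\<close> A'm 
      by (intro measure_Un_null_set) (auto simp: negligible_iff_null_sets)
    finally have "m \<le> measure lebesgue A'" .
    moreover have "ennreal (q * measure lebesgue A') \<le> ennreal (p * measure lebesgue A)"
    proof -
      have eA': "emeasure lborel A' = ennreal (measure lebesgue A')"
        using emeasure_eq_measure2[OF A'm] A'(1) by simp
      have eA: "emeasure lborel A = ennreal (measure lebesgue A)"
        using emeasure_eq_measure2[OF Am] A(1) by simp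
      have "ennreal q * emeasure lborel A' \<le> emeasure \<mu> A'"
        using A' lb by auto
      also have "\<dots> \<le> emeasure \<mu> A"
        using A A' interior_subset[of A] by (intro emeasure_mono) (auto simp: \<mu>_def)
      also have "\<dots> \<le> ennreal p * emeasure lborel A"
        using A lb by auto
      finally show ?thesis
        unfolding eA eA' using \<open>0 \<le> p\<close> \<open>p < q\<close> by (simp add: ennreal_mult)
    qed
    then have "q * measure lebesgue A' \<le> p * measure lebesgue A"
      using \<open>0 \<le> p\<close> by (simp add: ennreal_le_iff)
    moreover have "measure lebesgue A \<le> measure lebesgue G"
      using G A Am by (intro measure_mono_fmeasurable) auto
    ultimately show ?thesis
      using mG \<open>0 \<le> p\<close> \<open>p < q\<close>
      by (smt (verit) mult_left_mono)
  qed
  note base = this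
  \<comment> \<open>Taking \<open>e / p\<close> turns \<open>p * (m + e)\<close> into
    \<open>p * m + e\<close>; for \<open>p = 0\<close> the right side already vanishes.\<close>
  have "q * m \<le> p * m + e" if "e > 0" for e
    using base[of 1] base[of "e / p"] that \<open>0 \<le> p\<close> by (cases "p = 0") (auto simp: distrib_left)
  then have "q * m \<le> p * m"
    by (rule field_le_epsilon)
  then have "m \<le> 0"
    using \<open>p < q\<close> by (simp add: mult_le_cancel_right)
  then show ?thesis
    using E by (simp add: m_def negligible_iff_measure measure_le_0_iff)
qed

text \<open>The bounded difference quotients have a limit point \<open>D\<close>. If they fail to
  converge to \<open>D\<close>, they cross a rational gap \<open>p < q\<close> at arbitrarily small
  scales, and the points where a given gap is crossed form a negligible set.\<close>

lemma lipschitz_mono_AE_differentiable: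
  fixes F :: "real \<Rightarrow> real"
  assumes mono: "\<And>x y. x \<le> y \<Longrightarrow> F x \<le> F y"
    and lip: "L-lipschitz_on UNIV F"
  shows "AE x in lebesgue. \<exists>D. (F has_real_derivative D) (at x)"
proof -
  define S where "S x h = (F (x + h) - F x) / h" for x h
  have cont: "continuous_on UNIV F"
    using lip by (rule lipschitz_on_continuous_on)
  have S_nonneg: "0 \<le> S x h" for x h
    using mono[of x "x + h"] mono[of "x + h" x]
    by (cases "0 \<le> h") (auto simp: S_def divide_nonneg_nonneg divide_nonpos_nonpos)
  have S_le: "S x h \<le> L" for x h
  proof -
    have "\<bar>F (x + h) - F x\<bar> \<le> L * \<bar>h\<bar>"
      using lipschitz_onD[OF lip, of "x + h" x] by (simp add: dist_real_def)
    moreover have "0 \<le> L"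
      using lip lipschitz_on_nonneg by blast
    ultimately have "\<bar>S x h\<bar> \<le> L"
      by (cases "h = 0") (auto simp: S_def abs_divide divide_le_eq)
    then show ?thesis by simp
  qed
  define E where "E p q k = {x \<in> {-real k<..<real k}.
      \<forall>n::nat. (\<exists>h. h \<noteq> 0 \<and> \<bar>h\<bar> < 1 / Suc n \<and> S x h < p) \<and> (\<exists>h. h \<noteq> 0 \<and> \<bar>h\<bar> < 1 / Suc n \<and> q < S x h)}" for p q :: real and k
  have ab: "\<exists>a b. a < b \<and> x \<in> {a..b} \<and> b - a = \<bar>h\<bar> \<and> F b - F a = S x h * (b - a)" if "h \<noteq> 0" for x h
  proof (cases "h > 0")
    case True
    then show ?thesis
      by (intro exI[of _ x] exI[of _ "x + h"]) (auto simp: S_def)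
  next
    case False
    with that show ?thesis
      by (intro exI[of _ "x + h"] exI[of _ x]) (auto simp: S_def)
  qed
  have "negligible (E p q k)" if "0 \<le> p" "p < q" for p q k
  proof (rule negligible_oscillating_slopes[OF mono cont that])
    have "E p q k = {-real k<..<real k} \<inter>
        (\<Inter>n::nat. (\<Union>h\<in>{h. h \<noteq> 0 \<and> \<bar>h\<bar> < 1 / Suc n}. {x. S x h < p}) \<inter>
          (\<Union>h\<in>{h. h \<noteq> 0 \<and> \<bar>h\<bar> < 1 / Suc n}. {x. q < S x h}))"
      by (auto simp: E_def)
    moreover have "open {x. S x h < p}" "open {x. q < S x h}" if "h \<noteq> 0" for h
      unfolding S_def using that
      by (intro open_Collect_less continuous_intros continuous_on_compose2[OF cont] subset_UNIV; simp)+
    then have "open (\<Union>h\<in>{h. h \<noteq> 0 \<and> \<bar>h\<bar> < 1 / Suc n}. {x. S x h < p})"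
       "open (\<Union>h\<in>{h. h \<noteq> 0 \<and> \<bar>h\<bar> < 1 / Suc n}. {x. q < S x h})" for n :: nat
      by auto
    ultimately have "E p q k \<in> sets borel"
      by auto
    then have "E p q k \<in> sets lebesgue"
      by simp
    moreover have "E p q k \<subseteq> {-real k..real k}"
      unfolding E_def by (auto simp del: One_nat_def)
    ultimately show "E p q k \<in> lmeasurable"
      using bounded_subset[OF bounded_closed_interval] by (intro bounded_set_imp_lmeasurable)
    fix x d :: real assume x: "x \<in> E p q k" and "d > 0"
    obtain n where n: "1 / real (Suc n) < d"
      using \<open>d > 0\<close> nat_approx_posE by blast
    obtain h where "h \<noteq> 0" "\<bar>h\<bar> < 1 / Suc n" "S x h < p"
      using x by (auto simp: E_def)
    with ab[of h x] n show "\<exists>a b. a < b \<and> x \<in> {a..b} \<and> b - a < d \<and> F b - F a \<le> p * (b - a)"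
      by (smt (verit) mult_right_mono)
    obtain h where "h \<noteq> 0" "\<bar>h\<bar> < 1 / Suc n" "q < S x h"
      using x by (auto simp: E_def)
    with ab[of h x] n show "\<exists>a b. a < b \<and> x \<in> {a..b} \<and> b - a < d \<and> q * (b - a) \<le> F b - F a"
      by (smt (verit) mult_right_mono)
  qed
  define I where "I = {(p, q, k :: nat). p \<in> \<rat> \<and> q \<in> \<rat> \<and> (0::real) \<le> p \<and> p < q}"
  have "countable I"
    by (rule countable_subset[of _ "\<rat> \<times> \<rat> \<times> UNIV"]) (auto simp: I_def countable_rat)
  then have null: "(\<Union>(p, q, k)\<in>I. E p q k) \<in> null_sets lebesgue"
    using \<open>\<And>p q k. 0 \<le> p \<Longrightarrow> p < q \<Longrightarrow> negligible (E p q k)\<close>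
    by (intro null_sets_UN') (auto simp: I_def negligible_iff_null_sets)
  have "\<exists>D. (F has_real_derivative D) (at x)" if x: "x \<notin> (\<Union>(p, q, k)\<in>I. E p q k)" for x
  proof -
    have "bounded (range (\<lambda>n::nat. S x (1 / Suc n)))"
      using S_nonneg S_le by (intro boundedI[of _ L]) auto
    then obtain D r where r: "strict_mono r" "((\<lambda>n. S x (1 / Suc n)) \<circ> r) \<longlonglongrightarrow> D"
      using bounded_imp_convergent_subsequence by blast
    have D0: "0 \<le> D"
      by (rule LIMSEQ_le_const[OF r(2)]) (auto intro: S_nonneg)
    have near: "\<exists>h. h \<noteq> 0 \<and> \<bar>h\<bar> < 1 / Suc n \<and> \<bar>S x h - D\<bar> < e" if "e > 0" for e and n :: nat
    proof -
      obtain N where N: "\<And>i. i \<ge> N \<Longrightarrow> \<bar>S x (1 / Suc (r i)) - D\<bar> < e"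
        using LIMSEQ_D[OF r(2) \<open>e > 0\<close>] by auto
      define i where "i = Suc (max N n)"
      have "n < r i"
        using seq_suble[OF r(1), of i] by (simp add: i_def)
      then have "1 / real (Suc (r i)) < 1 / Suc n"
        by (simp add: frac_less2)
      with N[of i] show ?thesis
        by (intro exI[of _ "1 / Suc (r i)"]) (auto simp: i_def)
    qed
    obtain k :: nat where k: "\<bar>x\<bar> < real k"
      using reals_Archimedean2 by blast
    have "(S x \<longlongrightarrow> D) (at 0)"
    proof (rule ccontr)
      assume "\<not> ?thesis"
      then obtain e where "e > 0" and e: "\<not> (\<forall>\<^sub>F h in at 0. dist (S x h) D < e)"
        by (auto simp: tendsto_iff)
      then have far: "\<exists>h. h \<noteq> 0 \<and> \<bar>h\<bar> < d \<and> e \<le> \<bar>S x h - D\<bar>" if "d > 0" for d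
        using that by (simp add: eventually_at dist_real_def not_less) (metis not_less)
      \<comment> \<open>Quotients at distance at least \<open>e\<close> from \<open>D\<close> occur
        at every scale. Either some exceed \<open>D + e\<close> at every scale, and the gap is
        placed above \<open>D\<close>, or from some scale on the distant ones lie below
        \<open>D - e\<close>, and the gap is placed below \<open>D\<close>.\<close>
      show False
      proof (cases "\<forall>n::nat. \<exists>h. h \<noteq> 0 \<and> \<bar>h\<bar> < 1 / Suc n \<and> D + e \<le> S x h")
        case True
        obtain p where p: "p \<in> \<rat>" "D < p" "p < D + e"
          using Rats_dense_in_real[of D "D + e"] \<open>e > 0\<close> by auto
        obtain q where q: "q \<in> \<rat>" "p < q" "q < D + e"
          using Rats_dense_in_real[of p "D + e"] p by auto
        have "\<exists>h. h \<noteq> 0 \<and> \<bar>h\<bar> < 1 / Suc n \<and> S x h < p" for n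
          using near[of "p - D" n] p by (smt (verit))
        moreover have "\<exists>h. h \<noteq> 0 \<and> \<bar>h\<bar> < 1 / Suc n \<and> q < S x h" for n
          using True[rule_format, of n] q by (smt (verit))
        ultimately have "x \<in> E p q k"
          using k by (auto simp: E_def abs_less_iff)
        moreover have "(p, q, k) \<in> I"
          using p q D0 by (auto simp: I_def)
        ultimately show False
          using x by blast
      next
        case False
        then obtain n :: nat where n: "\<And>h. h \<noteq> 0 \<Longrightarrow> \<bar>h\<bar> < 1 / Suc n \<Longrightarrow> S x h < D + e"
          by (auto simp: not_le)
        have below: "\<exists>h. h \<noteq> 0 \<and> \<bar>h\<bar> < 1 / Suc i \<and> S x h \<le> D - e" for i
        proof -
          obtain h where h: "h \<noteq> 0" "\<bar>h\<bar> < min (1 / Suc i) (1 / Suc n)" "e \<le> \<bar>S x h - D\<bar>"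
            using far[of "min (1 / Suc i) (1 / Suc n)"] by auto
          with n[of h] show ?thesis
            by (intro exI[of _ h]) auto
        qed
        \<comment> \<open>Quotients of a nondecreasing function are nonnegative. Hence
          \<open>D - e\<close> is nonnegative, and so is \<open>p\<close>, as \<open>I\<close>
          demands.\<close>
        have "e \<le> D"
          using below[of 0] S_nonneg by (smt (verit))
        obtain p where p: "p \<in> \<rat>" "D - e < p" "p < D"
          using Rats_dense_in_real[of "D - e" D] \<open>e > 0\<close> by auto
        obtain q where q: "q \<in> \<rat>" "p < q" "q < D"
          using Rats_dense_in_real[of p D] p by auto
        have "\<exists>h. h \<noteq> 0 \<and> \<bar>h\<bar> < 1 / Suc n \<and> S x h < p" for n
          using below[of n] p by (smt (verit))
        moreover have "\<exists>h. h \<noteq> 0 \<and> \<bar>h\<bar> < 1 / Suc n \<and> q < S x h" for n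
          using near[of "D - q" n] q by (smt (verit))
        ultimately have "x \<in> E p q k"
          using k by (auto simp: E_def abs_less_iff)
        moreover have "(p, q, k) \<in> I"
          using p q \<open>e \<le> D\<close> by (auto simp: I_def)
        ultimately show False
          using x by blast
      qed
    qed
    then show ?thesis
      unfolding S_def DERIV_def by blast
  qed
  then show ?thesis
    by (intro AE_I'[OF null]) auto
qed

text \<open>Adding \<open>L * x\<close> makes each component nondecreasing and keeps it Lipschitz,
  so the monotone case applies componentwise.\<close>

lemma lipschitz_AE_differentiable:
  fixes F :: "real \<Rightarrow> real ^ 'n"
  assumes lip: "L-lipschitz_on UNIV F"
  shows "AE x in lebesgue. \<exists>v. (F has_vector_derivative v) (at x)"
proof -
  have L: "0 \<le> L"
    using lip lipschitz_on_nonneg by blast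
  have comp: "\<bar>F x $ i - F y $ i\<bar> \<le> L * \<bar>x - y\<bar>" for x y i
    using component_le_norm_cart[of "F x - F y" i] lipschitz_onD[OF lip, of x y]
    by (simp add: dist_norm)
  have "AE x in lebesgue. \<exists>D. ((\<lambda>x. F x $ i + L * x) has_real_derivative D) (at x)" for i
  proof (rule lipschitz_mono_AE_differentiable)
    show "F x $ i + L * x \<le> F y $ i + L * y" if "x \<le> y" for x y
      using comp[of x i y] that by (simp add: algebra_simps)
    show "(2 * L)-lipschitz_on UNIV (\<lambda>x. F x $ i + L * x)"
    proof (rule lipschitz_onI)
      fix x y :: real
      have "\<bar>L * x - L * y\<bar> = L * \<bar>x - y\<bar>"
        using L by (simp add: abs_mult flip: right_diff_distrib)
      then show "dist (F x $ i + L * x) (F y $ i + L * y) \<le> 2 * L * dist x y"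
        using comp[of x i y] by (simp add: dist_real_def) 
    qed (use L in simp)
  qed
  then have "AE x in lebesgue. \<forall>i. \<exists>D. ((\<lambda>x. F x $ i + L * x) has_real_derivative D) (at x)"
    by (simp add: AE_all_countable)
  then show ?thesis
  proof eventually_elim
    case (elim x)
    then obtain D where D: "\<And>i. ((\<lambda>x. F x $ i + L * x) has_real_derivative D i) (at x)"
      by metis
    have "((\<lambda>x. F x $ i) has_vector_derivative (D i - L)) (at x)" for i
    proof -
      have "((\<lambda>x. F x $ i + L * x - L * x) has_real_derivative D i - L) (at x)"
        by (rule DERIV_diff[OF D]) (auto intro!: derivative_eq_intros)
      then show ?thesis
        by (simp add: has_real_derivative_iff_has_vector_derivative)
    qed
    then have "(F has_vector_derivative (\<chi> i. D i - L)) (at x)"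
      unfolding has_vector_derivative_def
      by (subst has_derivative_componentwise_within) (auto simp: Basis_vec_def inner_axis)
    then show ?case by blast
  qed
qed

section \<open>Weak compactness of probability measures on a compact metric space\<close>

text \<open>The first differing digit separates the numbers by \<open>2 / 3 ^ Suc m\<close>, and all
  later digits together can undo at most half of that. In base two they could undo all of it, and
  close numbers need not share digits.\<close>

lemma ternary_digits_eq:
  fixes d d' :: "nat \<Rightarrow> real"
  assumes digits: "\<And>i. d i \<in> {0, 1}" "\<And>i. d' i \<in> {0, 1}"
    and close: "\<bar>(\<Sum>i. d i * (2 / 3 ^ Suc i)) - (\<Sum>i. d' i * (2 / 3 ^ Suc i))\<bar> < 1 / 3 ^ n"
    and "i < n"
  shows "d i = d' i"
proof (rule ccontr)
  assume "d i \<noteq> d' i"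
  define m where "m = (LEAST i. d i \<noteq> d' i)"
  have m: "d m \<noteq> d' m" "m \<le> i"
    unfolding m_def using \<open>d i \<noteq> d' i\<close> by (rule LeastI, rule Least_le)
  have below: "d j = d' j" if "j < m" for j
    using that not_less_Least unfolding m_def by blast
  have geom: "(\<lambda>j. 2 / 3 ^ Suc (j + Suc m)) sums (1 / 3 ^ Suc m :: real)"
    using sums_mult[OF geometric_sums[of "1 / 3 :: real"], of "2 / 3 ^ Suc (Suc m)"]
    by (simp add: power_add field_simps)
  have geom0: "summable (\<lambda>j. 2 / 3 ^ Suc j :: real)"
    using summable_mult[OF summable_geometric[of "1 / 3 :: real"], of "2 / 3"]
    by (simp add: field_simps)
  have "summable (\<lambda>i. b i * (2 / 3 ^ Suc i))" if "\<And>i. b i \<in> {0, 1}" for b :: "nat \<Rightarrow> real"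
  proof (rule summable_comparison_test'[OF geom0, of 0])
    show "norm (b i * (2 / 3 ^ Suc i)) \<le> 2 / 3 ^ Suc i" for i
      using that[of i] by auto
  qed
  then have sd: "summable (\<lambda>i. d i * (2 / 3 ^ Suc i))" "summable (\<lambda>i. d' i * (2 / 3 ^ Suc i))"
    using digits by blast+
  define c where "c i = (d i - d' i) * (2 / 3 ^ Suc i)" for i
  have sc: "summable c"
    unfolding c_def left_diff_distrib by (intro summable_diff sd)
  have sum_c: "suminf c = (\<Sum>i. d i * (2 / 3 ^ Suc i)) - (\<Sum>i. d' i * (2 / 3 ^ Suc i))"
    unfolding c_def left_diff_distrib by (rule suminf_diff[OF sd, symmetric])
  have "norm (\<Sum>j. c (j + Suc m)) \<le> (\<Sum>j. 2 / 3 ^ Suc (j + Suc m))"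
  proof (rule norm_suminf_le)
    show "norm (c (j + Suc m)) \<le> 2 / 3 ^ Suc (j + Suc m)" for j
      using digits(1)[of "j + Suc m"] digits(2)[of "j + Suc m"] by (auto simp: c_def)
  qed (rule sums_summable[OF geom])
  then have tail: "\<bar>\<Sum>j. c (j + Suc m)\<bar> \<le> 1 / 3 ^ Suc m"
    using sums_unique[OF geom] by simp
  have "sum c {..<Suc m} = c m"
    using below by (simp add: c_def)
  then have "suminf c = (\<Sum>j. c (j + Suc m)) + c m"
    using suminf_split_initial_segment[OF sc, of "Suc m"] by simp
  moreover have "\<bar>c m\<bar> = 2 / 3 ^ Suc m"
    using m(1) digits(1)[of m] digits(2)[of m] by (auto simp: c_def)
  ultimately have "1 / 3 ^ Suc m \<le> \<bar>suminf c\<bar>"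
    using tail by (simp add: abs_if split: if_splits)
  moreover have "1 / 3 ^ n \<le> 1 / (3::real) ^ Suc m"
    using m(2) \<open>i < n\<close> by (intro divide_left_mono power_increasing) auto
  ultimately show False
    using close by (simp add: sum_c)
qed

text \<open>The code of a point is the ternary number whose digits record the basic open sets that contain it.\<close>

lemma compact_metric_real_code:
  fixes X :: "'a::{metric_space, second_countable_topology} set"
  assumes "compact X" "X \<noteq> {}"
  obtains e :: "'a \<Rightarrow> real" and F where
    "e \<in> borel_measurable borel" "\<And>x. e x \<in> {0..1}"
    "continuous_on (closure (e ` X)) F" "F ` closure (e ` X) \<subseteq> X" "\<And>x. x \<in> X \<Longrightarrow> F (e x) = x"
proof -
  obtain \<B> :: "'a set set" where \<B>: "countable \<B>" "topological_basis \<B>"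
    using ex_countable_basis by blast
  have "\<B> \<noteq> {}"
    using topological_basisE[OF \<B>(2), of UNIV] by (metis UNIV_I empty_iff open_UNIV)
  define B where "B = from_nat_into \<B>"
  have range_B: "range B = \<B>"
    unfolding B_def using \<open>\<B> \<noteq> {}\<close> \<B>(1) by (rule range_from_nat_into)
  have open_B: "open (B i)" for i
    using topological_basis_open[OF \<B>(2)] range_B by blast
  define e :: "'a \<Rightarrow> real" where "e x = (\<Sum>i. indicator (B i) x * (2 / 3 ^ Suc i))" for x
  have geom: "(\<lambda>j. 2 / 3 ^ Suc j) sums (1 :: real)"
    using sums_mult[OF geometric_sums[of "1 / 3 :: real"], of "2 / 3"]
    by (simp add: power_add field_simps)
  have summ: "summable (\<lambda>i. indicator (B i) x * (2 / 3 ^ Suc i) :: real)" for x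
    by (rule summable_comparison_test'[OF sums_summable[OF geom], of 0]) (auto split: split_indicator)
  have e_meas: "e \<in> borel_measurable borel"
    unfolding e_def using open_B by (auto intro!: borel_measurable_suminf borel_measurable_times)
  have e_le: "e x \<le> 1" for x
    unfolding e_def sums_unique[OF geom]
    by (intro suminf_le summ sums_summable[OF geom]) (auto split: split_indicator)
  have e_nonneg: "0 \<le> e x" for x
    unfolding e_def by (intro suminf_nonneg summ) auto
  \<comment> \<open>The code need not be continuous, but its inverse is uniformly continuous:
    finitely many basic sets inside balls of radius \<open>\<delta> / 2\<close> cover
    \<open>X\<close>, and sufficiently close codes agree on the digits that record these
    sets.\<close>
  have unif: "\<exists>\<eta>>0. \<forall>x\<in>X. \<forall>x'\<in>X. \<bar>e x - e x'\<bar> < \<eta> \<longrightarrow> dist x x' < \<delta>" if "\<delta> > 0" for \<delta>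
  proof -
    have "\<exists>i. x \<in> B i \<and> B i \<subseteq> ball x (\<delta> / 2)" for x
      using topological_basisE[OF \<B>(2), of "ball x (\<delta> / 2)" x] \<open>\<delta> > 0\<close> range_B
      by (metis centre_in_ball half_gt_zero open_ball rangeE)
    then obtain i where i: "\<And>x. x \<in> B (i x)" "\<And>x. B (i x) \<subseteq> ball x (\<delta> / 2)"
      by metis
    obtain D where D: "D \<subseteq> X" "finite D" "X \<subseteq> (\<Union>x\<in>D. B (i x))"
      using compactE_image[OF \<open>compact X\<close>, of X "\<lambda>x. B (i x)"] open_B i(1) by blast
    obtain n where n: "\<And>x. x \<in> D \<Longrightarrow> i x < n"
      using finite_nat_set_iff_bounded[of "i ` D"] D(2) by auto
    have "dist x x' < \<delta>" if x: "x \<in> X" "x' \<in> X" "\<bar>e x - e x'\<bar> < 1 / 3 ^ n" for x x'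
    proof -
      obtain c where c: "c \<in> D" "x \<in> B (i c)"
        using D x by blast
      have "(indicator (B (i c)) x :: real) = indicator (B (i c)) x'"
        using n[OF c(1)] x(3) unfolding e_def
        by (intro ternary_digits_eq[of "\<lambda>j. indicator (B j) x" "\<lambda>j. indicator (B j) x'" n "i c"])
          (auto simp: indicator_def)
      then have "x' \<in> B (i c)"
        using c by (auto simp: indicator_def split: if_splits)
      then have "dist c x < \<delta> / 2" "dist c x' < \<delta> / 2"
        using c i(2)[of c] by auto
      then show ?thesis
        using dist_triangle_half_r by blast
    qed
    then show ?thesis
      by (intro exI[of _ "1 / 3 ^ n"]) auto
  qed
  \<comment> \<open>The set of codes need not be closed. Uniform continuity extends the inverse to
    its closure: \<open>limpt r x\<close> says that points with codes near \<open>r\<close> are near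
    \<open>x\<close>.\<close>
  define K where "K = closure (e ` X)"
  have near: "\<exists>x\<in>X. \<bar>e x - r\<bar> < \<eta>" if "r \<in> K" "\<eta> > 0" for r \<eta>
    using that by (auto simp: K_def closure_approachable dist_real_def)
  define limpt where "limpt r x \<longleftrightarrow> x \<in> X \<and> (\<forall>\<delta>>0. \<exists>\<eta>>0. \<forall>x'\<in>X. \<bar>e x' - r\<bar> < \<eta> \<longrightarrow> dist x' x < \<delta>)" for r x
  have ex: "\<exists>x. limpt r x" if "r \<in> K" for r
  proof -
    have "\<exists>x\<in>X. \<bar>e x - r\<bar> < 1 / Suc n" for n
      by (rule near[OF that]) simp
    then obtain s where s: "\<And>n. s n \<in> X" "\<And>n. \<bar>e (s n) - r\<bar> < 1 / Suc n"
      by metis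
    obtain x t where x: "x \<in> X" "strict_mono t" "(s \<circ> t) \<longlonglongrightarrow> x"
      using s(1) \<open>compact X\<close> unfolding compact_def by metis
    have "\<exists>\<eta>>0. \<forall>x'\<in>X. \<bar>e x' - r\<bar> < \<eta> \<longrightarrow> dist x' x < \<delta>" if "\<delta> > 0" for \<delta>
    proof -
      obtain \<eta> where \<eta>: "\<eta> > 0" "\<And>x x'. x \<in> X \<Longrightarrow> x' \<in> X \<Longrightarrow> \<bar>e x - e x'\<bar> < \<eta> \<Longrightarrow> dist x x' < \<delta> / 2"
        using unif[of "\<delta> / 2"] \<open>\<delta> > 0\<close> by auto
      obtain N where N: "1 / real (Suc N) < \<eta> / 2"
        using nat_approx_posE[of "\<eta> / 2"] \<open>\<eta> > 0\<close> by auto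
      obtain N' where N': "\<And>n. n \<ge> N' \<Longrightarrow> dist (s (t n)) x < \<delta> / 2"
        using metric_LIMSEQ_D[OF x(3), of "\<delta> / 2"] \<open>\<delta> > 0\<close> by auto
      define n where "n = max N N'"
      have "N \<le> t n"
        using seq_suble[OF x(2), of n] by (simp add: n_def)
      then have "1 / real (Suc (t n)) \<le> 1 / real (Suc N)"
        by (intro divide_left_mono) auto
      with s(2)[of "t n"] N have close: "\<bar>e (s (t n)) - r\<bar> < \<eta> / 2"
        by linarith
      have "dist x' x < \<delta>" if "x' \<in> X" "\<bar>e x' - r\<bar> < \<eta> / 2" for x'
      proof -
        have "dist x' (s (t n)) < \<delta> / 2"
        proof (rule \<eta>(2))
          show "\<bar>e x' - e (s (t n))\<bar> < \<eta>"
            using that(2) close by linarith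
        qed (use that s in auto)
        moreover have "dist (s (t n)) x < \<delta> / 2"
          by (rule N') (simp add: n_def)
        ultimately show ?thesis
          by (metis dist_commute dist_triangle_half_l)
      qed
      then show ?thesis
        using \<open>\<eta> > 0\<close> by (intro exI[of _ "\<eta> / 2"]) auto
    qed
    with x(1) show ?thesis
      by (auto simp: limpt_def)
  qed
  define F where "F r = (SOME x. limpt r x)" for r
  have F: "limpt r (F r)" if "r \<in> K" for r
    unfolding F_def using ex[OF that] by (rule someI_ex)
  show thesis
  proof (rule that[of e F])
    show "e x \<in> {0..1}" for x
      using e_nonneg e_le by simp
    show "F ` closure (e ` X) \<subseteq> X"
      using F by (auto simp: limpt_def K_def)
    show "F (e x) = x" if "x \<in> X" for x
    proof -
      have eK: "e x \<in> K"
        using that closure_subset[of "e ` X"] by (auto simp: K_def)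
      have "dist x (F (e x)) \<le> 0 + \<delta>" if "\<delta> > 0" for \<delta>
      proof -
        obtain \<eta> where "\<eta> > 0" "\<forall>x'\<in>X. \<bar>e x' - e x\<bar> < \<eta> \<longrightarrow> dist x' (F (e x)) < \<delta>"
          using F[OF eK] \<open>\<delta> > 0\<close> unfolding limpt_def by blast
        with \<open>x \<in> X\<close> show ?thesis
          by force
      qed
      then have "dist x (F (e x)) \<le> 0"
        by (rule field_le_epsilon)
      then show ?thesis by simp
    qed
    show "continuous_on (closure (e ` X)) F"
      unfolding K_def[symmetric] continuous_on_iff
    proof (intro ballI allI impI)
      fix r and \<delta> :: real assume r: "r \<in> K" and "\<delta> > 0"
      obtain \<eta> where \<eta>: "\<eta> > 0" "\<And>x'. x' \<in> X \<Longrightarrow> \<bar>e x' - r\<bar> < \<eta> \<Longrightarrow> dist x' (F r) < \<delta> / 2"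
        using F[OF r] \<open>\<delta> > 0\<close> unfolding limpt_def by (meson half_gt_zero)
      have "dist (F r') (F r) < \<delta>" if r': "r' \<in> K" "dist r' r < \<eta> / 2" for r'
      proof -
        obtain \<eta>' where \<eta>': "\<eta>' > 0" "\<And>x'. x' \<in> X \<Longrightarrow> \<bar>e x' - r'\<bar> < \<eta>' \<Longrightarrow> dist x' (F r') < \<delta> / 2"
          using F[OF r'(1)] \<open>\<delta> > 0\<close> unfolding limpt_def by (meson half_gt_zero)
        obtain x' where x': "x' \<in> X" "\<bar>e x' - r'\<bar> < min \<eta>' (\<eta> / 2)"
          using near[OF r'(1), of "min \<eta>' (\<eta> / 2)"] \<eta> \<eta>' by auto
        have "\<bar>e x' - r\<bar> < \<eta>"
          using x'(2) r'(2) unfolding dist_real_def by linarith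
        with \<eta>(2) \<eta>'(2) x' show ?thesis
          by (metis dist_commute dist_triangle_half_r min_less_iff_conj)
      qed
      then show "\<exists>d>0. \<forall>x'\<in>K. dist x' r < d \<longrightarrow> dist (F x') (F r) < \<delta>"
        using \<open>\<eta> > 0\<close> by (intro exI[of _ "\<eta> / 2"]) auto
    qed
  qed (rule e_meas)
qed

text \<open>The measures are pushed to the unit interval by the code, a weakly convergent
  subsequence is extracted there by tightness, and the limit is pulled back along the continuous
  left inverse \<open>F\<close>. A test function \<open>\<phi>\<close> becomes
  \<open>\<phi> \<circ> F\<close>, which Tietze extends from the closed set of codes to the
  line.\<close>

lemma compact_prob_measures_convergent_subsequence:
  fixes X :: "'a::{metric_space, second_countable_topology} set" and \<mu> :: "nat \<Rightarrow> 'a measure"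
  assumes "compact X" and prob: "\<And>n. prob_space (\<mu> n)"
    and sets_\<mu>: "\<And>n. sets (\<mu> n) = sets (restrict_space borel X)"
  obtains r :: "nat \<Rightarrow> nat" and \<gamma> where "strict_mono r" "prob_space \<gamma>"
    "sets \<gamma> = sets (restrict_space borel X)"
    "\<And>\<phi> :: 'a \<Rightarrow> real. continuous_on X \<phi> \<Longrightarrow> (\<lambda>n. \<integral>x. \<phi> x \<partial>\<mu> (r n)) \<longlonglongrightarrow> (\<integral>x. \<phi> x \<partial>\<gamma>)"
proof -
  have space_\<mu>: "space (\<mu> n) = X" for n
    using sets_eq_imp_space_eq[OF sets_\<mu>] by (simp add: space_restrict_space)
  have "X \<noteq> {}"
    using prob_space.not_empty[OF prob] space_\<mu> by auto
  then obtain x0 where "x0 \<in> X"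
    by blast
  obtain e :: "'a \<Rightarrow> real" and F where
    e: "e \<in> borel_measurable borel" "\<And>x. e x \<in> {0..1}" and
    F: "continuous_on (closure (e ` X)) F" "F ` closure (e ` X) \<subseteq> X" "\<And>x. x \<in> X \<Longrightarrow> F (e x) = x"
    using compact_metric_real_code[OF \<open>compact X\<close> \<open>X \<noteq> {}\<close>] by blast
  define K where "K = closure (e ` X)"
  have "closed K"
    by (simp add: K_def)
  have eK: "e x \<in> K" if "x \<in> X" for x
    using that closure_subset[of "e ` X"] by (auto simp: K_def)
  have e_\<mu>[measurable]: "e \<in> borel_measurable (\<mu> n)" for n
    using measurable_restrict_space1[OF e(1), of X] by (simp cong: measurable_cong_sets add: sets_\<mu>)
  define \<nu> where "\<nu> n = distr (\<mu> n) borel e" for n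
  have rd: "real_distribution (\<nu> n)" for n
    unfolding \<nu>_def real_distribution_def real_distribution_axioms_def
    using prob_space.prob_space_distr[OF prob e_\<mu>] by auto
  have "tight \<nu>"
    unfolding tight_def
  proof (intro conjI allI impI rd)
    fix \<epsilon> :: real assume "\<epsilon> > 0"
    \<comment> \<open>Tightness is stated with intervals open on the left, so the left end must lie
      below the possible code 0.\<close>
    have "measure (\<nu> n) {-1<..1} = 1" for n
    proof -
      have "-1 < e x \<and> e x \<le> 1" for x
        using e(2)[of x] by simp
      then have "e -` {-1<..1} \<inter> space (\<mu> n) = space (\<mu> n)"
        by auto
      then show ?thesis
        unfolding \<nu>_def using prob_space.prob_space[OF prob]
        by (subst measure_distr) auto
    qed
    with \<open>\<epsilon> > 0\<close> show "\<exists>a b. a < b \<and> (\<forall>n. 1 - \<epsilon> < measure (\<nu> n) {a<..b})"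
      by (intro exI[of _ "-1"] exI[of _ 1]) auto
  qed
  from tight_imp_convergent_subsubsequence[OF this strict_mono_id]
  obtain r N where r: "strict_mono r" and "real_distribution N" and wc: "weak_conv_m (\<nu> \<circ> r) N"
    by (auto simp: id_def comp_def)
  interpret N: real_distribution N by fact
  have conv: "(\<lambda>n. integral\<^sup>L (\<nu> (r n)) h) \<longlonglongrightarrow> integral\<^sup>L N h"
    if "continuous_on UNIV h" "\<And>x. norm (h x) \<le> B" for h :: "real \<Rightarrow> real" and B
    using weak_conv_imp_integral_bdd_continuous_conv[of "\<nu> \<circ> r" N h B] that rd wc N.real_distribution_axioms
    by (simp add: continuous_on_eq_continuous_at)
  have int_\<nu>: "integral\<^sup>L (\<nu> n) h = (\<integral>x. h (e x) \<partial>\<mu> n)" if "h \<in> borel_measurable borel" for h :: "real \<Rightarrow> real" and n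
    unfolding \<nu>_def using that by (intro integral_distr) auto
  \<comment> \<open>The truncated distance to \<open>K\<close> is a bounded continuous test function
    that vanishes on all codes. Its integrals are 0 along the sequence, hence in the limit.\<close>
  have AE_K: "AE x in N. x \<in> K"
  proof -
    define h where "h x = min 1 (infdist x K)" for x :: real
    have h: "continuous_on UNIV h" "norm (h x) \<le> 1" for x
      using infdist_nonneg[of x K] unfolding h_def by (auto intro!: continuous_intros simp: abs_if)
    have hm[measurable]: "h \<in> borel_measurable borel"
      using h(1) by (rule borel_measurable_continuous_onI)
    have "integral\<^sup>L (\<nu> n) h = (\<integral>x. 0 \<partial>\<mu> n)" for n
      unfolding int_\<nu>[OF hm] using eK space_\<mu>
      by (intro Bochner_Integration.integral_cong) (auto simp: h_def)
    then have "integral\<^sup>L N h = 0"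
      using conv[OF h] by (simp add: LIMSEQ_const_iff)
    moreover have "integrable N h"
      using h(2) by (intro N.integrable_const_bound[of _ 1]) auto
    moreover have "0 \<le> h x" for x
      by (simp add: h_def infdist_nonneg)
    ultimately have "AE x in N. h x = 0"
      using integral_nonneg_eq_0_iff_AE by blast
    then show ?thesis
    proof eventually_elim
      case (elim x)
      then have "infdist x K = 0"
        by (simp add: h_def min_def split: if_splits)
      then show ?case
        using \<open>X \<noteq> {}\<close> \<open>closed K\<close> by (subst in_closed_iff_infdist_zero) (auto simp: K_def)
    qed
  qed
  \<comment> \<open>The default \<open>x0\<close> is taken with probability zero; it makes the
    pull-back a total map into \<open>X\<close>.\<close>
  define F' where "F' x = (if x \<in> K then F x else x0)" for x
  have F'X: "F' x \<in> X" for x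
    using F(2) \<open>x0 \<in> X\<close> by (auto simp: F'_def K_def)
  have F'_borel: "F' \<in> borel_measurable borel"
    unfolding F'_def using F(1) \<open>closed K\<close> unfolding K_def[symmetric]
    by (intro borel_measurable_continuous_on_if) auto
  then have F'_meas[measurable]: "F' \<in> N \<rightarrow>\<^sub>M restrict_space borel X"
    using F'X by (intro measurable_restrict_space2) (auto cong: measurable_cong_sets)
  define \<gamma> where "\<gamma> = distr N (restrict_space borel X) F'"
  have lim: "(\<lambda>n. \<integral>x. \<phi> x \<partial>\<mu> (r n)) \<longlonglongrightarrow> (\<integral>x. \<phi> x \<partial>\<gamma>)" if \<phi>: "continuous_on X \<phi>" for \<phi> :: "'a \<Rightarrow> real"
  proof -
    have \<phi>m[measurable]: "\<phi> \<in> borel_measurable (restrict_space borel X)"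
      by (rule borel_measurable_continuous_on_restrict[OF \<phi>])
    obtain B where B: "\<And>x. x \<in> X \<Longrightarrow> norm (\<phi> x) \<le> B"
      using compact_imp_bounded[OF compact_continuous_image[OF \<phi> \<open>compact X\<close>]] unfolding bounded_iff by blast
    have "0 \<le> B"
      using B[OF \<open>x0 \<in> X\<close>] norm_ge_zero order_trans by blast
    have "continuous_on K (\<phi> \<circ> F)"
      using F(1,2) \<phi> unfolding K_def by (intro continuous_on_compose) (auto intro: continuous_on_subset)
    moreover have "norm ((\<phi> \<circ> F) x) \<le> B" if "x \<in> K" for x
      using that F(2) B by (auto simp: K_def)
    ultimately obtain h where h: "continuous_on UNIV h" "\<And>x. x \<in> K \<Longrightarrow> h x = (\<phi> \<circ> F) x" "\<And>x. norm (h x) \<le> B"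
      using Tietze[of K "\<phi> \<circ> F" UNIV B] \<open>closed K\<close> \<open>0 \<le> B\<close> by (metis UNIV_I closed_closedin subtopology_UNIV)
    have hm[measurable]: "h \<in> borel_measurable borel"
      using h(1) by (rule borel_measurable_continuous_onI)
    have "(\<integral>x. \<phi> x \<partial>\<mu> n) = integral\<^sup>L (\<nu> n) h" for n
      unfolding int_\<nu>[OF hm] using h(2) eK F(3) space_\<mu>
      by (intro Bochner_Integration.integral_cong) auto
    moreover have "(\<integral>x. \<phi> x \<partial>\<gamma>) = integral\<^sup>L N h"
    proof -
      have "(\<integral>x. \<phi> x \<partial>\<gamma>) = (\<integral>x. \<phi> (F' x) \<partial>N)"
        unfolding \<gamma>_def by (rule integral_distr) auto
      also have "\<dots> = integral\<^sup>L N h"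
      proof (rule integral_cong_AE)
        show "(\<lambda>x. \<phi> (F' x)) \<in> borel_measurable N"
          by (rule measurable_compose[OF F'_meas \<phi>m])
        show "AE x in N. \<phi> (F' x) = h x"
          using AE_K by eventually_elim (simp add: F'_def h(2))
      qed simp
      finally show ?thesis .
    qed
    ultimately show ?thesis
      using conv[OF h(1,3)] by simp
  qed
  show thesis
  proof (rule that[of r \<gamma>])
    show "prob_space \<gamma>"
      unfolding \<gamma>_def by (rule N.prob_space_distr) simp
  qed (use r lim in \<open>simp_all add: \<gamma>_def\<close>)
qed

section \<open>Stationary measures\<close>

text \<open>A multi-index is a function from a finite type to \<open>nat\<close>. Such functions
  form a countable type, which lets \<open>from_nat\<close> enumerate all monomials.\<close>

definition monomial :: "('m::finite \<Rightarrow> nat) \<Rightarrow> real ^ 'm \<Rightarrow> real" where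
  "monomial \<alpha> y = (\<Prod>i\<in>UNIV. (y $ i) ^ \<alpha> i)"

lemma continuous_on_monomial [continuous_intros]: "continuous_on S (monomial \<alpha>)"
  unfolding monomial_def by (intro continuous_intros)

lemma monomial_Suc: "monomial (\<alpha>(i := Suc (\<alpha> i))) y = y $ i * monomial \<alpha> y"
proof -
  have "monomial (\<alpha>(i := Suc (\<alpha> i))) y = y $ i * y $ i ^ \<alpha> i * (\<Prod>j\<in>UNIV - {i}. (y $ j) ^ \<alpha> j)"
    unfolding monomial_def by (subst prod.remove[of _ i]) (auto intro!: prod.cong)
  also have "\<dots> = y $ i * monomial \<alpha> y"
    unfolding monomial_def by (subst (2) prod.remove[of _ i]) auto
  finally show ?thesis .
qed

text \<open>The generator of the controlled chain: the expected one-step change of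
  \<open>\<phi>\<close> from a state-control pair. The measures in W are those that annihilate it
  for every continuous \<open>\<phi>\<close>.\<close>

definition drift :: "('y \<Rightarrow> 'u \<Rightarrow> 's \<Rightarrow> 'y) \<Rightarrow> 's measure \<Rightarrow> ('y \<Rightarrow> real) \<Rightarrow> 'y \<times> 'u \<Rightarrow> real" where
  "drift f P \<phi> = (\<lambda>(y, u). (\<integral>\<sigma>. \<phi> (f y u \<sigma>) \<partial>P) - \<phi> y)"

locale controlled_system =
  fixes f :: "real ^ 'm \<Rightarrow> 'u::{metric_space, second_countable_topology} \<Rightarrow>
              's::{metric_space, second_countable_topology} \<Rightarrow> real ^ 'm"
    and Y :: "(real ^ 'm) set" and P :: "'s measure"
  assumes compact_Y: "compact Y" and compact_U: "compact (UNIV :: 'u set)"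
    and cont_f: "continuous_on (Y \<times> UNIV \<times> UNIV) (\<lambda>(y, u, \<sigma>). f y u \<sigma>)"
    and f_in_Y: "\<And>y u \<sigma>. y \<in> Y \<Longrightarrow> f y u \<sigma> \<in> Y"
    and prob_P: "prob_space P" and sets_P: "sets P = sets borel"
begin

abbreviation X :: "((real ^ 'm) \<times> 'u) set" where "X \<equiv> Y \<times> UNIV"

sublocale P: prob_space P by (rule prob_P)

lemma compact_X: "compact X"
  by (intro compact_Times compact_Y compact_U)

lemma noise_integrable:
  assumes "continuous_on Y \<phi>" "y \<in> Y"
  shows "integrable P (\<lambda>\<sigma>. \<phi> (f y u \<sigma>) :: real)"
proof -
  obtain B where B: "\<And>y. y \<in> Y \<Longrightarrow> norm (\<phi> y) \<le> B"
    using compact_imp_bounded[OF compact_continuous_image[OF assms(1) compact_Y]] unfolding bounded_iff by blast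
  have "continuous_on UNIV (\<lambda>\<sigma>. \<phi> ((\<lambda>(y, u, \<sigma>). f y u \<sigma>) (y, u, \<sigma>)))"
    using assms(2) f_in_Y
    by (intro continuous_on_compose2[OF assms(1)] continuous_on_compose2[OF cont_f] continuous_intros) auto
  then have "(\<lambda>\<sigma>. \<phi> (f y u \<sigma>)) \<in> borel_measurable P"
    using borel_measurable_continuous_onI by (simp add: measurable_cong_sets[OF sets_P refl])
  then show ?thesis
    using B f_in_Y[OF assms(2)] by (intro P.integrable_const_bound[of _ B]) auto
qed

lemma drift_bound:
  assumes "continuous_on Y \<phi>" "\<And>y. y \<in> Y \<Longrightarrow> \<bar>\<phi> y\<bar> \<le> B" "p \<in> X"
  shows "\<bar>drift f P \<phi> p\<bar> \<le> 2 * B"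
proof -
  obtain y u where p: "p = (y, u)" "y \<in> Y"
    using assms(3) by auto
  have "\<bar>\<integral>\<sigma>. \<phi> (f y u \<sigma>) \<partial>P\<bar> \<le> (\<integral>\<sigma>. B \<partial>P)"
    using noise_integrable[OF assms(1) p(2)] assms(2) f_in_Y[OF p(2)]
    by (intro order_trans[OF integral_abs_bound] integral_mono) auto
  then show ?thesis
    using assms(2)[OF p(2)] P.prob_space by (simp add: p drift_def)
qed

lemma drift_add:
  assumes "continuous_on Y \<phi>" "continuous_on Y \<phi>'" "p \<in> X"
  shows "drift f P (\<lambda>y. \<phi> y + \<phi>' y) p = drift f P \<phi> p + drift f P \<phi>' p"
  using assms by (cases p) (simp add: drift_def noise_integrable)

lemma drift_scale: "drift f P (\<lambda>y. c * \<phi> y) p = c * drift f P \<phi> p"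
  by (cases p) (simp add: drift_def right_diff_distrib)

lemma drift_cong:
  assumes "\<And>y. y \<in> Y \<Longrightarrow> \<phi> y = \<phi>' y" "p \<in> X"
  shows "drift f P \<phi> p = drift f P \<phi>' p"
  using assms f_in_Y by (cases p) (simp add: drift_def)

text \<open>\<open>\<phi>\<close> is bounded on the compact invariant set \<open>Y\<close>, so
  dominated convergence carries a convergent sequence of state-control pairs through the noise
  integral.\<close>

lemma continuous_on_drift:
  assumes "continuous_on Y \<phi>"
  shows "continuous_on X (drift f P \<phi>)"
proof (rule continuous_on_sequentiallyI)
  fix w :: "nat \<Rightarrow> (real ^ 'm) \<times> 'u" and a
  assume w: "\<forall>n. w n \<in> X" and a: "a \<in> X" and lim: "w \<longlonglongrightarrow> a"
  have fst_lim: "(\<lambda>n. fst (w n)) \<longlonglongrightarrow> fst a" and snd_lim: "(\<lambda>n. snd (w n)) \<longlonglongrightarrow> snd a"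
    using lim by (auto intro: tendsto_intros)
  have wY: "fst (w n) \<in> Y" "fst a \<in> Y" for n
    using w a by (auto simp: mem_Times_iff)
  obtain B where B: "\<And>y. y \<in> Y \<Longrightarrow> norm (\<phi> y) \<le> B"
    using compact_imp_bounded[OF compact_continuous_image[OF assms compact_Y]] unfolding bounded_iff by blast
  have "(\<lambda>n. \<phi> (f (fst (w n)) (snd (w n)) \<sigma>)) \<longlonglongrightarrow> \<phi> (f (fst a) (snd a) \<sigma>)" for \<sigma>
  proof -
    have "(\<lambda>n. (\<lambda>(y, u, \<sigma>). f y u \<sigma>) (fst (w n), snd (w n), \<sigma>)) \<longlonglongrightarrow> (\<lambda>(y, u, \<sigma>). f y u \<sigma>) (fst a, snd a, \<sigma>)"
      using wY by (intro continuous_on_tendsto_compose[OF cont_f] tendsto_Pair fst_lim snd_lim tendsto_const) auto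
    then show ?thesis
      using wY f_in_Y by (intro continuous_on_tendsto_compose[OF assms]) auto
  qed
  then have "(\<lambda>n. \<integral>\<sigma>. \<phi> (f (fst (w n)) (snd (w n)) \<sigma>) \<partial>P) \<longlonglongrightarrow> (\<integral>\<sigma>. \<phi> (f (fst a) (snd a) \<sigma>) \<partial>P)"
    using noise_integrable[OF assms] wY B f_in_Y
    by (intro integral_dominated_convergence[where w="\<lambda>_. B"]) auto
  moreover have "(\<lambda>n. \<phi> (fst (w n))) \<longlonglongrightarrow> \<phi> (fst a)"
    using wY fst_lim by (intro continuous_on_tendsto_compose[OF assms]) auto
  ultimately show "(\<lambda>n. drift f P \<phi> (w n)) \<longlonglongrightarrow> drift f P \<phi> a"
    unfolding drift_def split_beta by (rule tendsto_diff)
qed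

lemma continuous_integrable:
  fixes h :: "(real ^ 'm) \<times> 'u \<Rightarrow> 'b::euclidean_space"
  assumes "prob_space \<gamma>" "sets \<gamma> = sets (restrict_space borel X)" "continuous_on X h"
  shows "integrable \<gamma> h"
proof -
  interpret prob_space \<gamma> by fact
  have "space \<gamma> = X"
    using sets_eq_imp_space_eq[OF assms(2)] by (simp add: space_restrict_space)
  moreover obtain B where "\<And>p. p \<in> X \<Longrightarrow> norm (h p) \<le> B"
    using compact_imp_bounded[OF compact_continuous_image[OF assms(3) compact_X]] unfolding bounded_iff by blast
  moreover have "h \<in> borel_measurable \<gamma>"
    using borel_measurable_continuous_on_restrict[OF assms(3)] by (simp add: measurable_cong_sets[OF assms(2) refl])
  ultimately show ?thesis
    by (intro integrable_const_bound[of _ B]) auto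
qed

text \<open>By Stone--Weierstrass it suffices to test stationarity on the countably many monomials.\<close>

lemma stationary_measuresI_monomial:
  assumes \<gamma>: "prob_space \<gamma>" "sets \<gamma> = sets (restrict_space borel X)"
    and mono: "\<And>\<alpha>. (\<integral>p. drift f P (monomial \<alpha>) p \<partial>\<gamma>) = 0"
  shows "\<gamma> \<in> stationary_measures f Y P"
proof -
  interpret \<gamma>: prob_space \<gamma> by fact
  have space_\<gamma>: "space \<gamma> = X"
    using sets_eq_imp_space_eq[OF \<gamma>(2)] by (simp add: space_restrict_space)
  define L where "L \<phi> = (\<integral>p. drift f P \<phi> p \<partial>\<gamma>)" for \<phi>
  have int: "integrable \<gamma> (drift f P \<phi>)" if "continuous_on Y \<phi>" for \<phi>
    using continuous_integrable[OF \<gamma> continuous_on_drift[OF that]] .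
  have L_add: "L (\<lambda>y. \<phi> y + \<phi>' y) = L \<phi> + L \<phi>'" if "continuous_on Y \<phi>" "continuous_on Y \<phi>'" for \<phi> \<phi>'
  proof -
    have "L (\<lambda>y. \<phi> y + \<phi>' y) = (\<integral>p. drift f P \<phi> p + drift f P \<phi>' p \<partial>\<gamma>)"
      unfolding L_def by (intro Bochner_Integration.integral_cong refl drift_add that) (simp add: space_\<gamma>)
    then show ?thesis
      using int that by (simp add: L_def)
  qed
  have L_scale: "L (\<lambda>y. c * \<phi> y) = c * L \<phi>" for c \<phi>
    by (simp add: L_def drift_scale)
  have L_cong: "L \<phi> = L \<phi>'" if "\<And>y. y \<in> Y \<Longrightarrow> \<phi> y = \<phi>' y" for \<phi> \<phi>'
    unfolding L_def by (intro Bochner_Integration.integral_cong refl drift_cong that) (auto simp: space_\<gamma>)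
  have L_sum: "L (\<lambda>y. \<Sum>i\<in>I. \<phi> i y) = (\<Sum>i\<in>I. L (\<phi> i))"
    if "finite I" "\<And>i. continuous_on Y (\<phi> i)" for I :: "'m set" and \<phi>
    using that(1)
  proof induction
    case empty
    show ?case
      using L_scale[of 0 "\<lambda>_. 0"] by simp
  next
    case (insert i I)
    then show ?case
      using that(2) by (simp add: L_add continuous_intros)
  qed
  \<comment> \<open>The extra factor \<open>q\<close> makes the induction pass through products: for
    a product of \<open>p\<close> and \<open>p'\<close>, the function \<open>p' * q\<close> is again
    an admissible factor. A linear \<open>p\<close> is absorbed by raising exponents of the
    monomial.\<close>
  have poly: "\<forall>q. continuous_on Y q \<longrightarrow> (\<forall>\<alpha>. L (\<lambda>y. q y * monomial \<alpha> y) = 0) \<longrightarrow>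
      (\<forall>\<alpha>. L (\<lambda>y. p y * q y * monomial \<alpha> y) = 0)"
    if "real_polynomial_function p" for p
    using that
  proof induction
    case (linear p)
    show ?case
    proof (intro allI impI)
      fix q \<alpha> assume q: "continuous_on Y q" "\<forall>\<alpha>. L (\<lambda>y. q y * monomial \<alpha> y) = 0"
      have p: "p y = (\<Sum>i\<in>UNIV. p (axis i 1) * y $ i)" for y
      proof -
        have "p y = p (\<Sum>i\<in>UNIV. y $ i *\<^sub>R axis i 1)"
          by (simp add: basis_expansion flip: scalar_mult_eq_scaleR)
        also have "\<dots> = (\<Sum>i\<in>UNIV. y $ i *\<^sub>R p (axis i 1))"
          by (simp add: linear_sum[OF bounded_linear.linear[OF linear]] linear_scale[OF bounded_linear.linear[OF linear]])
        finally show ?thesis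
          by (simp add: mult.commute)
      qed
      have "L (\<lambda>y. p y * q y * monomial \<alpha> y) =
          L (\<lambda>y. \<Sum>i\<in>UNIV. p (axis i 1) * (q y * monomial (\<alpha>(i := Suc (\<alpha> i))) y))"
        by (rule L_cong) (subst p, simp add: monomial_Suc sum_distrib_left sum_distrib_right mult_ac)
      also have "\<dots> = (\<Sum>i\<in>UNIV. L (\<lambda>y. p (axis i 1) * (q y * monomial (\<alpha>(i := Suc (\<alpha> i))) y)))"
        using q(1) by (intro L_sum) (auto intro!: continuous_intros)
      also have "\<dots> = 0"
        unfolding L_scale using q(2) by simp
      finally show "L (\<lambda>y. p y * q y * monomial \<alpha> y) = 0" .
    qed
  next
    case (const c)
    then show ?case
      by (simp add: L_scale mult.assoc)
  next
    case (add p p')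
    show ?case
    proof (intro allI impI)
      fix q \<alpha> assume q: "continuous_on Y q" "\<forall>\<alpha>. L (\<lambda>y. q y * monomial \<alpha> y) = 0"
      have cont: "continuous_on Y p" "continuous_on Y p'"
        using add by (auto intro: continuous_on_polymonial_function simp: real_polynomial_function_eq)
      have "L (\<lambda>y. (p y + p' y) * q y * monomial \<alpha> y) =
          L (\<lambda>y. p y * q y * monomial \<alpha> y) + L (\<lambda>y. p' y * q y * monomial \<alpha> y)"
        unfolding distrib_right using q(1) cont by (intro L_add continuous_intros)
      then show "L (\<lambda>y. (p y + p' y) * q y * monomial \<alpha> y) = 0"
        using add.IH q by simp
    qed
  next
    case (mult p p')
    show ?case
    proof (intro allI impI)
      fix q \<alpha> assume q: "continuous_on Y q" "\<forall>\<alpha>. L (\<lambda>y. q y * monomial \<alpha> y) = 0"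
      have "continuous_on Y p'"
        using mult by (auto intro: continuous_on_polymonial_function simp: real_polynomial_function_eq)
      with q(1) have cont: "continuous_on Y (\<lambda>y. p' y * q y)"
        by (intro continuous_intros)
      have "\<forall>\<alpha>. L (\<lambda>y. p' y * q y * monomial \<alpha> y) = 0"
        by (rule mult.IH(2)[THEN spec, THEN mp, OF q(1), THEN mp, OF q(2)])
      then have "L (\<lambda>y. p y * (p' y * q y) * monomial \<alpha> y) = 0"
        using mult.IH(1)[THEN spec, THEN mp, OF cont] by (simp only: simp_thms)
      then show "L (\<lambda>y. p y * p' y * q y * monomial \<alpha> y) = 0"
        by (simp add: mult.assoc)
    qed
  qed
  have poly0: "L p = 0" if "real_polynomial_function p" for p
  proof -
    have "L (\<lambda>y. p y * 1 * monomial (\<lambda>_. 0) y) = 0"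
      using poly[OF that, THEN spec, of "\<lambda>_. 1"] mono by (simp add: L_def)
    then show ?thesis
      by (simp add: monomial_def)
  qed
  have "L \<phi> = 0" if \<phi>: "continuous_on Y \<phi>" for \<phi>
  proof -
    have "\<bar>L \<phi>\<bar> \<le> 0 + e" if "e > 0" for e
    proof -
      \<comment> \<open>The generator at most doubles a uniform bound, hence half of the
        tolerance.\<close>
      obtain p where p: "real_polynomial_function p" "\<And>y. y \<in> Y \<Longrightarrow> \<bar>\<phi> y - p y\<bar> < e / 2"
        using Stone_Weierstrass_real_polynomial_function[OF compact_Y \<phi>, of "e / 2"] \<open>e > 0\<close> by auto
      have cont: "continuous_on Y p"
        using p(1) by (auto intro: continuous_on_polymonial_function simp: real_polynomial_function_eq)
      have cont': "continuous_on Y (\<lambda>y. \<phi> y - p y)"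
        using cont \<phi> by (intro continuous_intros)
      have "L \<phi> = L (\<lambda>y. (\<phi> y - p y) + p y)"
        by simp
      also have "\<dots> = L (\<lambda>y. \<phi> y - p y)"
        using L_add[OF cont' cont] poly0[OF p(1)] by simp
      also have "\<bar>\<dots>\<bar> \<le> (\<integral>q. e \<partial>\<gamma>)"
        unfolding L_def
        using drift_bound[OF cont', of "e / 2"] p(2) int[OF cont']
        by (intro order_trans[OF integral_abs_bound] integral_mono) (auto simp: space_\<gamma> less_imp_le)
      finally show ?thesis
        using \<gamma>.prob_space by simp
    qed
    then have "\<bar>L \<phi>\<bar> \<le> 0"
      by (rule field_le_epsilon)
    then show ?thesis by simp
  qed
  then show ?thesis
    using \<gamma> by (auto simp: stationary_measures_def L_def drift_def)
qed

text \<open>The generator maps monomials to continuous functions, so along a weakly convergent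
  subsequence the vanishing drifts make the limit measure stationary. The average of
  \<open>h\<close> is treated by components because weak convergence is tested with real
  functions.\<close>

lemma stationary_limit:
  fixes \<mu> :: "nat \<Rightarrow> ((real ^ 'm) \<times> 'u) measure" and h :: "(real ^ 'm) \<times> 'u \<Rightarrow> real ^ 'n"
  assumes prob: "\<And>n. prob_space (\<mu> n)" and sets_\<mu>: "\<And>n. sets (\<mu> n) = sets (restrict_space borel X)"
    and drift: "\<And>\<alpha>. (\<lambda>n. \<integral>p. drift f P (monomial \<alpha>) p \<partial>\<mu> n) \<longlonglongrightarrow> 0"
    and h: "continuous_on X h" and lim: "(\<lambda>n. \<integral>p. h p \<partial>\<mu> n) \<longlonglongrightarrow> v"
  shows "\<exists>\<gamma>\<in>stationary_measures f Y P. v = (\<integral>p. h p \<partial>\<gamma>)"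
proof -
  obtain r \<gamma> where r: "strict_mono r" and \<gamma>: "prob_space \<gamma>" "sets \<gamma> = sets (restrict_space borel X)"
    and conv: "\<And>\<phi> :: _ \<Rightarrow> real. continuous_on X \<phi> \<Longrightarrow> (\<lambda>n. \<integral>x. \<phi> x \<partial>\<mu> (r n)) \<longlonglongrightarrow> (\<integral>x. \<phi> x \<partial>\<gamma>)"
    by (rule compact_prob_measures_convergent_subsequence[of X \<mu>, OF compact_X prob sets_\<mu>]) (rule that)
  have "(\<integral>p. drift f P (monomial \<alpha>) p \<partial>\<gamma>) = 0" for \<alpha>
  proof (rule LIMSEQ_unique)
    show "(\<lambda>n. \<integral>p. drift f P (monomial \<alpha>) p \<partial>\<mu> (r n)) \<longlonglongrightarrow> (\<integral>p. drift f P (monomial \<alpha>) p \<partial>\<gamma>)"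
      by (rule conv[OF continuous_on_drift[OF continuous_on_monomial]])
    show "(\<lambda>n. \<integral>p. drift f P (monomial \<alpha>) p \<partial>\<mu> (r n)) \<longlonglongrightarrow> 0"
      using LIMSEQ_subseq_LIMSEQ[OF drift r] by (simp add: comp_def)
  qed
  then have "\<gamma> \<in> stationary_measures f Y P"
    using \<gamma> by (intro stationary_measuresI_monomial)
  moreover have "(\<lambda>n. \<integral>p. h p \<partial>\<mu> (r n)) \<longlonglongrightarrow> (\<integral>p. h p \<partial>\<gamma>)"
  proof (rule vec_tendstoI)
    fix i
    have comp: "(\<integral>p. h p $ i \<partial>\<kappa>) = (\<integral>p. h p \<partial>\<kappa>) $ i"
      if "prob_space \<kappa>" "sets \<kappa> = sets (restrict_space borel X)" for \<kappa>
      using integral_bounded_linear[OF bounded_linear_vec_nth continuous_integrable[OF that h]] .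
    have "continuous_on X (\<lambda>p. h p $ i)"
      using h by (intro continuous_intros)
    from conv[OF this] show "(\<lambda>n. (\<integral>p. h p \<partial>\<mu> (r n)) $ i) \<longlonglongrightarrow> (\<integral>p. h p \<partial>\<gamma>) $ i"
      by (simp add: comp prob sets_\<mu> \<gamma>)
  qed
  then have "v = (\<integral>p. h p \<partial>\<gamma>)"
    using LIMSEQ_unique[OF LIMSEQ_subseq_LIMSEQ[OF lim r, unfolded comp_def]] by simp
  ultimately show ?thesis by blast
qed

end

section \<open>Trajectories and occupation measures\<close>

lemma lipschitz_abs_continuous_on:
  assumes "B-lipschitz_on I f"
  shows "abs_continuous_on I f"
  unfolding abs_continuous_on_def
proof (intro allI impI)
  fix e :: real assume "e > 0"
  have "0 \<le> B"
    using assms lipschitz_on_nonneg by blast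
  have "(\<Sum>K\<in>D. norm (f (Sup K) - f (Inf K))) < e"
    if D: "D division_of T" "T \<subseteq> I" "(\<Sum>K\<in>D. Sup K - Inf K) < e / (B + 1)" for D T
  proof -
    have "(\<Sum>K\<in>D. norm (f (Sup K) - f (Inf K))) \<le> (\<Sum>K\<in>D. B * (Sup K - Inf K))"
    proof (rule sum_mono)
      fix K assume K: "K \<in> D"
      obtain a b where ab: "K = {a..b}"
        using division_ofD(4)[OF D(1) K] by (auto simp: cbox_interval)
      moreover have "K \<noteq> {}" "K \<subseteq> I"
        using division_ofD(2,3)[OF D(1) K] D(2) by auto
      ultimately show "norm (f (Sup K) - f (Inf K)) \<le> B * (Sup K - Inf K)"
        using lipschitz_onD[OF assms, of b a] by (auto simp: dist_norm subset_iff)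
    qed
    also have "\<dots> = B * (\<Sum>K\<in>D. Sup K - Inf K)"
      by (simp add: sum_distrib_left)
    also have "\<dots> \<le> B * (e / (B + 1))"
      using D(3) \<open>0 \<le> B\<close> by (intro mult_left_mono) auto
    also have "\<dots> < e"
      using \<open>0 \<le> B\<close> \<open>e > 0\<close> by (simp add: field_simps)
    finally show ?thesis .
  qed
  then show "\<exists>d>0. \<forall>D T. D division_of T \<and> T \<subseteq> I \<and> (\<Sum>K\<in>D. Sup K - Inf K) < d \<longrightarrow>
       (\<Sum>K\<in>D. norm (f (Sup K) - f (Inf K))) < e"
    using \<open>0 \<le> B\<close> \<open>e > 0\<close> by (intro exI[of _ "e / (B + 1)"]) auto
qed

text \<open>Clamping the argument extends the curve to the line with the same Lipschitz constant.
  The end points are discarded as a null set; \<open>s < b\<close> leaves room for windows to the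
  right of \<open>s\<close>.\<close>

lemma lipschitz_on_interval_AE_differentiable:
  fixes F :: "real \<Rightarrow> real ^ 'n"
  assumes lip: "L-lipschitz_on {a..b} F" and "a \<le> b"
  shows "AE s in lebesgue_on {a..b}. s < b \<and> (\<exists>v. (F has_vector_derivative v) (at s within {a..b}))"
proof -
  define F' where "F' x = F (min b (max a x))" for x
  have "L-lipschitz_on UNIV F'"
  proof (rule lipschitz_onI)
    fix x y
    have "dist (F' x) (F' y) \<le> L * dist (min b (max a x)) (min b (max a y))"
      unfolding F'_def using \<open>a \<le> b\<close> by (intro lipschitz_onD[OF lip]) auto
    also have "\<dots> \<le> L * dist x y"
      using lipschitz_on_nonneg[OF lip] by (intro mult_left_mono) (auto simp: dist_real_def)
    finally show "dist (F' x) (F' y) \<le> L * dist x y" .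
  qed (use lip lipschitz_on_nonneg in blast)
  then have "AE s in lebesgue. \<exists>v. (F' has_vector_derivative v) (at s)"
    by (rule lipschitz_AE_differentiable)
  moreover have "AE s in lebesgue. s \<notin> {a, b}"
    by (rule AE_not_in) (simp add: negligible_iff_null_sets[symmetric] negligible_finite)
  ultimately have "AE s in lebesgue. s \<in> {a..b} \<longrightarrow> s < b \<and> (\<exists>v. (F has_vector_derivative v) (at s within {a..b}))"
  proof eventually_elim
    case (elim s)
    show ?case
    proof
      assume "s \<in> {a..b}"
      with elim have s: "s \<in> {a<..<b}"
        by auto
      obtain v where "(F' has_vector_derivative v) (at s)"
        using elim by blast
      then have "(F has_vector_derivative v) (at s)"
        by (rule has_vector_derivative_transform_within_open[where S="{a<..<b}"]) (use s in \<open>auto simp: F'_def\<close>)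
      then show "s < b \<and> (\<exists>v. (F has_vector_derivative v) (at s within {a..b}))"
        using s has_vector_derivative_at_within[of F v s "{a..b}"] by auto
    qed
  qed
  then show ?thesis
    by (subst AE_restrict_space_iff) auto
qed

definition step_index :: "real \<Rightarrow> real \<Rightarrow> nat" where
  "step_index \<epsilon> s = nat \<lfloor>s / \<epsilon>\<rfloor>"

lemma measurable_step_index [measurable]: "step_index \<epsilon> \<in> borel \<rightarrow>\<^sub>M count_space UNIV"
  unfolding step_index_def by measurable

section \<open>Occupation measures of time windows\<close>

context controlled_system
begin

text \<open>The law of the sampled point at a uniformly distributed time in \<open>{s..s + h}\<close>.\<close>

definition window_measure :: "(nat \<Rightarrow> (real ^ 'm) \<times> 'u) \<Rightarrow> real \<Rightarrow> real \<Rightarrow> real \<Rightarrow> ((real ^ 'm) \<times> 'u) measure" where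
  "window_measure x \<epsilon> s h = distr (density lborel (\<lambda>r. ennreal (indicator {s..s + h} r / h)))
     (restrict_space borel X) (\<lambda>r. x (step_index \<epsilon> r))"

lemma measurable_step_sampling:
  assumes "\<And>t. x t \<in> space N"
  shows "(\<lambda>r. x (step_index \<epsilon> r)) \<in> borel \<rightarrow>\<^sub>M N"
  using assms by (intro measurable_compose[OF measurable_step_index]) (auto simp: measurable_count_space_eq1)

lemma prob_space_window:
  assumes "\<And>t. x t \<in> X" "h > 0"
  shows "prob_space (window_measure x \<epsilon> s h)"
  unfolding window_measure_def
proof (rule prob_space.prob_space_distr)
  show "prob_space (density lborel (\<lambda>r. ennreal (indicator {s..s + h} r / h)))"
  proof (rule prob_spaceI)
    have "(\<integral>\<^sup>+ r. ennreal (indicator {s..s + h} r / h) * indicator UNIV r \<partial>lborel) =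
        (\<integral>\<^sup>+ r. ennreal (1 / h) * indicator {s..s + h} r \<partial>lborel)"
      by (intro nn_integral_cong) (auto split: split_indicator)
    also have "\<dots> = 1"
      using assms by (simp add: nn_integral_cmult_indicator flip: ennreal_mult)
    finally show "emeasure (density lborel (\<lambda>r. ennreal (indicator {s..s + h} r / h)))
      (space (density lborel (\<lambda>r. ennreal (indicator {s..s + h} r / h)))) = 1"
      by (simp add: emeasure_density)
  qed
  show "(\<lambda>r. x (step_index \<epsilon> r)) \<in> density lborel (\<lambda>r. ennreal (indicator {s..s + h} r / h))
      \<rightarrow>\<^sub>M restrict_space borel X"
    using measurable_step_sampling[of x "restrict_space borel X" \<epsilon>] assms(1)
    by (simp add: space_restrict_space)
qed

lemma sets_window: "sets (window_measure x \<epsilon> s h) = sets (restrict_space borel X)"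
  by (simp add: window_measure_def)

text \<open>This links the Lebesgue integral against an occupation measure to the gauge integral in
  which trajectories are expressed. The factor \<open>h\<close> undoes the normalisation of the
  window.\<close>

lemma window_has_integral:
  fixes \<phi> :: "(real ^ 'm) \<times> 'u \<Rightarrow> 'b::euclidean_space"
  assumes x: "\<And>t. x t \<in> X" and "h > 0" and \<phi>: "continuous_on X \<phi>"
  shows "((\<lambda>r. \<phi> (x (step_index \<epsilon> r))) has_integral h *\<^sub>R (\<integral>p. \<phi> p \<partial>window_measure x \<epsilon> s h)) {s..s + h}"
proof -
  define F where "F r = \<phi> (x (step_index \<epsilon> r))" for r
  have F_meas: "F \<in> borel_measurable borel"
    unfolding F_def using measurable_step_sampling[of "\<lambda>t. \<phi> (x t)" borel] by simp
  obtain B where B: "\<And>p. p \<in> X \<Longrightarrow> norm (\<phi> p) \<le> B"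
    using compact_imp_bounded[OF compact_continuous_image[OF \<phi> compact_X]] unfolding bounded_iff by blast
  have x_meas: "(\<lambda>r. x (step_index \<epsilon> r)) \<in> borel \<rightarrow>\<^sub>M restrict_space borel X"
    using x by (intro measurable_step_sampling) (simp add: space_restrict_space)
  have "(\<integral>p. \<phi> p \<partial>window_measure x \<epsilon> s h) =
      (\<integral>r. F r \<partial>density lborel (\<lambda>r. ennreal (indicator {s..s + h} r / h)))"
    unfolding window_measure_def F_def using x_meas
    by (intro integral_distr borel_measurable_continuous_on_restrict \<phi>) simp
  also have "\<dots> = (\<integral>r. (indicator {s..s + h} r / h) *\<^sub>R F r \<partial>lborel)"
    using F_meas \<open>h > 0\<close> by (intro integral_density) auto
  finally have eq: "(\<integral>p. \<phi> p \<partial>window_measure x \<epsilon> s h) = (\<integral>r. (indicator {s..s + h} r / h) *\<^sub>R F r \<partial>lborel)" .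
  have "integrable lborel (\<lambda>r. (indicator {s..s + h} r / h) *\<^sub>R F r)"
  proof (rule Bochner_Integration.integrable_bound)
    show "integrable lborel (\<lambda>r. indicator {s..s + h} r * (B / h))"
      by (intro integrable_mult_left integrable_real_indicator) (auto simp: emeasure_lborel_Icc_eq)
    have "norm ((indicator {s..s + h} r / h) *\<^sub>R F r) \<le> norm (indicator {s..s + h} r * (B / h))" for r
      using B[OF x, of "step_index \<epsilon> r"] \<open>h > 0\<close>
      by (auto simp: F_def divide_simps split: split_indicator)
    then show "AE r in lborel. norm ((indicator {s..s + h} r / h) *\<^sub>R F r) \<le> norm (indicator {s..s + h} r * (B / h))"
      by simp
  qed (use F_meas in simp)
  then have "((\<lambda>r. (indicator {s..s + h} r / h) *\<^sub>R F r) has_integral (\<integral>p. \<phi> p \<partial>window_measure x \<epsilon> s h)) UNIV"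
    unfolding eq by (rule has_integral_integral_lborel)
  then have "((\<lambda>r. h *\<^sub>R ((indicator {s..s + h} r / h) *\<^sub>R F r)) has_integral
      h *\<^sub>R (\<integral>p. \<phi> p \<partial>window_measure x \<epsilon> s h)) UNIV"
    by (rule has_integral_cmul)
  moreover have "(\<lambda>r. h *\<^sub>R ((indicator {s..s + h} r / h) *\<^sub>R F r)) = (\<lambda>r. if r \<in> {s..s + h} then F r else 0)"
    using \<open>h > 0\<close> by (auto simp: fun_eq_iff split: split_indicator)
  ultimately show ?thesis
    unfolding F_def by (simp only: has_integral_restrict_UNIV)
qed

end

section \<open>Compactness of trajectories with vanishing drift\<close>

locale averaging = controlled_system f Y P
  for f :: "real ^ 'm \<Rightarrow> 'u::{metric_space, second_countable_topology} \<Rightarrow>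
              's::{metric_space, second_countable_topology} \<Rightarrow> real ^ 'm"
    and Y and P :: "'s measure" +
  fixes g :: "real ^ 'n \<Rightarrow> real ^ 'm \<Rightarrow> 'u \<Rightarrow> real ^ 'n" and Z :: "(real ^ 'n) set"
    and z0 :: "real ^ 'n" and C :: real
  assumes cont_g: "continuous_on (UNIV \<times> Y \<times> UNIV) (\<lambda>(z, y, u). g z y u)"
    and compact_Z: "compact Z" and C_pos: "C > 0"
    and lipschitz_g: "\<And>z1 z2 y u. z1 \<in> Z \<Longrightarrow> z2 \<in> Z \<Longrightarrow> y \<in> Y \<Longrightarrow>
           norm (g z1 y u - g z2 y u) \<le> C * norm (z1 - z2)"
begin

definition vel :: "real ^ 'n \<Rightarrow> (real ^ 'm) \<times> 'u \<Rightarrow> real ^ 'n" where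
  "vel z = (\<lambda>(y, u). g z y u)"

abbreviation V where "V \<equiv> averaged_velocities (stationary_measures f Y P) g"

lemma vel_lipschitz: "z1 \<in> Z \<Longrightarrow> z2 \<in> Z \<Longrightarrow> p \<in> X \<Longrightarrow> norm (vel z1 p - vel z2 p) \<le> C * norm (z1 - z2)"
  using lipschitz_g by (auto simp: vel_def)

lemma continuous_on_vel: "continuous_on X (vel z)"
proof -
  have "continuous_on X (\<lambda>p. (\<lambda>(z, y, u). g z y u) (z, fst p, snd p))"
    by (rule continuous_on_compose2[OF cont_g]) (auto intro!: continuous_intros)
  then show ?thesis
    by (simp add: vel_def split_beta)
qed

text \<open>Some bound of the velocity over the compact set of admissible arguments. It serves as a
  common Lipschitz constant for all trajectories and their limits.\<close>

definition speed :: real where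
  "speed = (SOME B. 0 \<le> B \<and> (\<forall>z\<in>Z. \<forall>p\<in>X. norm (vel z p) \<le> B))"

lemma speed: "0 \<le> speed" "\<And>z p. z \<in> Z \<Longrightarrow> p \<in> X \<Longrightarrow> norm (vel z p) \<le> speed"
proof -
  have "compact (Z \<times> Y \<times> (UNIV :: 'u set))"
    by (intro compact_Times compact_Z compact_Y compact_U)
  then have "bounded ((\<lambda>(z, y, u). g z y u) ` (Z \<times> Y \<times> UNIV))"
    by (intro compact_imp_bounded compact_continuous_image continuous_on_subset[OF cont_g]) auto
  then obtain B where "\<forall>v\<in>(\<lambda>(z, y, u). g z y u) ` (Z \<times> Y \<times> UNIV). norm v \<le> B"
    unfolding bounded_iff by blast
  then have "0 \<le> \<bar>B\<bar> \<and> (\<forall>z\<in>Z. \<forall>p\<in>X. norm (vel z p) \<le> \<bar>B\<bar>)"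
    by (fastforce simp: vel_def intro: order_trans[OF _ abs_ge_self])
  then have "0 \<le> speed \<and> (\<forall>z\<in>Z. \<forall>p\<in>X. norm (vel z p) \<le> speed)"
    unfolding speed_def by (rule someI)
  then show "0 \<le> speed" "\<And>z p. z \<in> Z \<Longrightarrow> p \<in> X \<Longrightarrow> norm (vel z p) \<le> speed"
    by auto
qed

text \<open>The integral form tolerates the corners at sampling times. Neither noise nor plan is
  mentioned, so one compactness argument serves all plans and all realizations.\<close>

definition trajectory :: "real \<Rightarrow> (nat \<Rightarrow> (real ^ 'm) \<times> 'u) \<Rightarrow> (real \<Rightarrow> real ^ 'n) \<Rightarrow> bool" where
  "trajectory \<epsilon> x \<zeta> \<longleftrightarrow> (\<forall>t. x t \<in> X) \<and> \<zeta> 0 = z0 \<and> \<zeta> ` {0..1} \<subseteq> Z \<and>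
     (\<forall>a b. 0 \<le> a \<longrightarrow> a \<le> b \<longrightarrow> b \<le> 1 \<longrightarrow>
       ((\<lambda>r. vel (\<zeta> r) (x (step_index \<epsilon> r))) has_integral \<zeta> b - \<zeta> a) {a..b})"

text \<open>The Lipschitz constant and the values in \<open>Z\<close> are recorded because they make
  this set of solutions totally bounded in the uniform norm; the values in \<open>Z\<close> also
  bound the error on the exceptional event.\<close>

definition averaged_solution :: "(real \<Rightarrow> real ^ 'n) \<Rightarrow> bool" where
  "averaged_solution z \<longleftrightarrow> inclusion_solution V z0 z \<and> speed-lipschitz_on {0..1} z \<and> z ` {0..1} \<subseteq> Z"

text \<open>It is anchored at 0 so that a bound uniform in \<open>b\<close> controls every window as
  a difference of two values.\<close>

definition cumulative_drift :: "real \<Rightarrow> (nat \<Rightarrow> (real ^ 'm) \<times> 'u) \<Rightarrow> ('m \<Rightarrow> nat) \<Rightarrow> real \<Rightarrow> real" where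
  "cumulative_drift \<epsilon> x \<alpha> b = integral {0..b} (\<lambda>r. drift f P (monomial \<alpha>) (x (step_index \<epsilon> r)))"

lemma trajectory_in_X: "trajectory \<epsilon> x \<zeta> \<Longrightarrow> x t \<in> X"
  by (simp add: trajectory_def)

lemma trajectory_in_Z: "trajectory \<epsilon> x \<zeta> \<Longrightarrow> s \<in> {0..1} \<Longrightarrow> \<zeta> s \<in> Z"
  by (auto simp: trajectory_def)

lemma trajectory_has_integral:
  assumes "trajectory \<epsilon> x \<zeta>" "0 \<le> a" "a \<le> b" "b \<le> 1"
  shows "((\<lambda>r. vel (\<zeta> r) (x (step_index \<epsilon> r))) has_integral \<zeta> b - \<zeta> a) {a..b}"
  using assms by (simp add: trajectory_def)

lemma trajectory_lipschitz:
  assumes "trajectory \<epsilon> x \<zeta>"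
  shows "speed-lipschitz_on {0..1} \<zeta>"
proof -
  have *: "norm (\<zeta> b - \<zeta> a) \<le> speed * (b - a)" if "0 \<le> a" "a \<le> b" "b \<le> 1" for a b
  proof -
    have "norm (\<zeta> b - \<zeta> a) \<le> speed * measure lborel (cbox a b)"
    proof (rule has_integral_bound[OF speed(1)])
      show "((\<lambda>r. vel (\<zeta> r) (x (step_index \<epsilon> r))) has_integral \<zeta> b - \<zeta> a) (cbox a b)"
        using trajectory_has_integral[OF assms that] by (simp add: cbox_interval)
      show "norm (vel (\<zeta> r) (x (step_index \<epsilon> r))) \<le> speed" if "r \<in> cbox a b" for r
        using \<open>0 \<le> a\<close> \<open>b \<le> 1\<close> that
        by (intro speed(2) trajectory_in_X[OF assms] trajectory_in_Z[OF assms]) auto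
    qed
    with that show ?thesis by simp
  qed
  have "dist (\<zeta> s) (\<zeta> t) \<le> speed * dist s t" if "s \<in> {0..1}" "t \<in> {0..1}" for s t
    using *[of s t] *[of t s] that
    by (cases "s \<le> t") (auto simp: dist_norm norm_minus_commute)
  then show ?thesis
    using speed(1) by (rule lipschitz_onI)
qed

lemma drift_integrable_on:
  assumes "\<And>t. x t \<in> X" "0 \<le> b"
  shows "(\<lambda>r. drift f P (monomial \<alpha>) (x (step_index \<epsilon> r))) integrable_on {0..b}"
proof (cases "b = 0")
  case False
  with assms window_has_integral[of x b "drift f P (monomial \<alpha>)" \<epsilon> 0] show ?thesis
    by (auto simp: continuous_on_drift continuous_on_monomial dest: has_integral_integrable)
qed (use integrable_on_refl[of _ "0 :: real"] in simp)

lemma window_drift: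
  assumes "\<And>t. x t \<in> X" "0 \<le> s" "h > 0"
  shows "h * (\<integral>p. drift f P (monomial \<alpha>) p \<partial>window_measure x \<epsilon> s h) =
    cumulative_drift \<epsilon> x \<alpha> (s + h) - cumulative_drift \<epsilon> x \<alpha> s"
proof -
  have "h * (\<integral>p. drift f P (monomial \<alpha>) p \<partial>window_measure x \<epsilon> s h) =
      integral {s..s + h} (\<lambda>r. drift f P (monomial \<alpha>) (x (step_index \<epsilon> r)))"
    using window_has_integral[of x h "drift f P (monomial \<alpha>)" \<epsilon> s] assms
    by (simp add: continuous_on_drift continuous_on_monomial integral_unique)
  also have "\<dots> = cumulative_drift \<epsilon> x \<alpha> (s + h) - cumulative_drift \<epsilon> x \<alpha> s"
    using Henstock_Kurzweil_Integration.integral_combine[of 0 s "s + h", OF _ _ drift_integrable_on[of x "s + h" \<alpha> \<epsilon>]] assms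
    by (simp add: cumulative_drift_def)
  finally show ?thesis .
qed

text \<open>Freezing the slow variable at \<open>z\<close> changes the velocity by at most
  \<open>C * e\<close>; both slow arguments lie in \<open>Z\<close>, where the Lipschitz condition
  holds.\<close>

lemma window_velocity:
  assumes tr: "trajectory \<epsilon> x \<zeta>" and s: "0 \<le> s" "h > 0" "s + h \<le> 1" and "z \<in> Z"
    and close: "\<And>r. r \<in> {s..s + h} \<Longrightarrow> norm (\<zeta> r - z) \<le> e"
  shows "norm (\<zeta> (s + h) - \<zeta> s - h *\<^sub>R (\<integral>p. vel z p \<partial>window_measure x \<epsilon> s h)) \<le> C * e * h"
proof -
  have xX: "x t \<in> X" for t
    using tr by (rule trajectory_in_X)
  have "0 \<le> e"
    using order_trans[OF norm_ge_zero close[of s]] s by simp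
  have "norm (\<zeta> (s + h) - \<zeta> s - h *\<^sub>R (\<integral>p. vel z p \<partial>window_measure x \<epsilon> s h)) \<le> C * e * measure lborel (cbox s (s + h))"
  proof (rule has_integral_bound)
    show "((\<lambda>r. vel (\<zeta> r) (x (step_index \<epsilon> r)) - vel z (x (step_index \<epsilon> r))) has_integral
        (\<zeta> (s + h) - \<zeta> s - h *\<^sub>R (\<integral>p. vel z p \<partial>window_measure x \<epsilon> s h))) (cbox s (s + h))"
      unfolding cbox_interval
    proof (rule has_integral_diff)
      show "((\<lambda>r. vel (\<zeta> r) (x (step_index \<epsilon> r))) has_integral \<zeta> (s + h) - \<zeta> s) {s..s + h}"
        using s by (intro trajectory_has_integral[OF tr]) auto
      show "((\<lambda>r. vel z (x (step_index \<epsilon> r))) has_integral h *\<^sub>R (\<integral>p. vel z p \<partial>window_measure x \<epsilon> s h)) {s..s + h}"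
        by (rule window_has_integral[where x=x and \<phi>="vel z", OF xX s(2) continuous_on_vel])
    qed
    show "norm (vel (\<zeta> r) (x (step_index \<epsilon> r)) - vel z (x (step_index \<epsilon> r))) \<le> C * e" if r: "r \<in> cbox s (s + h)" for r
    proof -
      have "\<zeta> r \<in> Z"
        using r s by (intro trajectory_in_Z[OF tr]) auto
      then have "norm (vel (\<zeta> r) (x (step_index \<epsilon> r)) - vel z (x (step_index \<epsilon> r))) \<le> C * norm (\<zeta> r - z)"
        using \<open>z \<in> Z\<close> xX by (intro vel_lipschitz)
      also have "\<dots> \<le> C * e"
        using close r C_pos by (intro mult_left_mono) (auto simp: cbox_interval)
      finally show ?thesis .
    qed
  qed (use C_pos \<open>0 \<le> e\<close> in simp)
  with s show ?thesis by simp
qed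

text \<open>For each window length \<open>h m\<close> a trajectory is chosen whose distance to
  \<open>z\<close> and whose first drifts stay below the square of \<open>h m\<close>. Division by
  \<open>h m\<close> leaves errors that tend to 0, so the occupation measures of the windows are
  asymptotically stationary while their averages of \<open>vel (z s)\<close> tend to the
  derivative.\<close>

lemma limit_velocity:
  fixes \<epsilon> :: "nat \<Rightarrow> real" and \<zeta> :: "nat \<Rightarrow> real \<Rightarrow> real ^ 'n"
  assumes tr: "\<And>k. trajectory (\<epsilon> k) (x k) (\<zeta> k)"
    and unif: "\<And>e. e > 0 \<Longrightarrow> \<forall>\<^sub>F k in sequentially. \<forall>s\<in>{0..1}. norm (\<zeta> k s - z s) < e"
    and drift: "\<And>\<alpha> e. e > 0 \<Longrightarrow> \<forall>\<^sub>F k in sequentially. \<forall>b\<in>{0..1}. \<bar>cumulative_drift (\<epsilon> k) (x k) \<alpha> b\<bar> < e"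
    and zZ: "z ` {0..1} \<subseteq> Z"
    and s: "0 \<le> s" "s < 1" and der: "(z has_vector_derivative v) (at s within {0..1})"
  shows "v \<in> V (z s)"
proof -
  have xX: "x k t \<in> X" for k t
    using tr by (rule trajectory_in_X)
  \<comment> \<open>The windows extend to the right of \<open>s\<close> and must stay inside
    \<open>{0..1}\<close>; \<open>s < 1\<close> provides the room.\<close>
  define h where "h m = (1 - s) / real (Suc m)" for m
  have h: "h m > 0" "s + h m \<le> 1" for m
  proof -
    show "h m > 0"
      using s by (simp add: h_def)
    have "h m \<le> (1 - s) / 1"
      unfolding h_def using s by (intro divide_left_mono) auto
    then show "s + h m \<le> 1" by simp
  qed
  have h_lim: "h \<longlonglongrightarrow> 0"
    using tendsto_mult[OF tendsto_const[of "1 - s"] LIMSEQ_inverse_real_of_nat]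
    unfolding h_def divide_inverse by simp
  have "\<exists>k. (\<forall>j\<in>{..m}. \<forall>b\<in>{0..1}. \<bar>cumulative_drift (\<epsilon> k) (x k) (from_nat j) b\<bar> < (h m)\<^sup>2) \<and>
      (\<forall>r\<in>{0..1}. norm (\<zeta> k r - z r) < (h m)\<^sup>2)" for m
  proof -
    have "\<forall>\<^sub>F k in sequentially. \<forall>j\<in>{..m}. \<forall>b\<in>{0..1}. \<bar>cumulative_drift (\<epsilon> k) (x k) (from_nat j) b\<bar> < (h m)\<^sup>2"
      using h(1)[of m] by (intro eventually_ball_finite ballI drift) auto
    moreover have "\<forall>\<^sub>F k in sequentially. \<forall>r\<in>{0..1}. norm (\<zeta> k r - z r) < (h m)\<^sup>2"
      using h(1)[of m] by (intro unif) simp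
    ultimately have "\<forall>\<^sub>F k in sequentially.
        (\<forall>j\<in>{..m}. \<forall>b\<in>{0..1}. \<bar>cumulative_drift (\<epsilon> k) (x k) (from_nat j) b\<bar> < (h m)\<^sup>2) \<and>
        (\<forall>r\<in>{0..1}. norm (\<zeta> k r - z r) < (h m)\<^sup>2)"
      by (rule eventually_conj)
    then show ?thesis
      by (rule eventually_happens'[OF sequentially_bot])
  qed
  then obtain k where k: "\<And>m j b. j \<le> m \<Longrightarrow> b \<in> {0..1} \<Longrightarrow> \<bar>cumulative_drift (\<epsilon> (k m)) (x (k m)) (from_nat j) b\<bar> < (h m)\<^sup>2"
    and close: "\<And>m r. r \<in> {0..1} \<Longrightarrow> norm (\<zeta> (k m) r - z r) < (h m)\<^sup>2"
    by (metis atMost_iff)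
  define \<mu> where "\<mu> m = window_measure (x (k m)) (\<epsilon> (k m)) s (h m)" for m
  have "\<exists>\<gamma>\<in>stationary_measures f Y P. v = (\<integral>p. vel (z s) p \<partial>\<gamma>)"
  proof (rule stationary_limit)
    show "prob_space (\<mu> m)" "sets (\<mu> m) = sets (restrict_space borel X)" for m
      unfolding \<mu>_def using xX h by (auto intro!: prob_space_window simp: sets_window)
    show "continuous_on X (vel (z s))"
      by (rule continuous_on_vel)
    show "(\<lambda>m. \<integral>p. drift f P (monomial \<alpha>) p \<partial>\<mu> m) \<longlonglongrightarrow> 0" for \<alpha>
    proof (rule Lim_null_comparison)
      show "(\<lambda>m. 2 * h m) \<longlonglongrightarrow> 0"
        using tendsto_mult[OF tendsto_const h_lim, of 2] by simp
      \<comment> \<open>The diagonal choice \<open>k m\<close> takes \<open>\<alpha>\<close> into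
        account once \<open>m\<close> reaches its index. The factor 2 comes from the two ends of the
        window.\<close>
      have "norm (\<integral>p. drift f P (monomial \<alpha>) p \<partial>\<mu> m) \<le> 2 * h m" if "to_nat \<alpha> \<le> m" for m
      proof -
        have "\<bar>cumulative_drift (\<epsilon> (k m)) (x (k m)) \<alpha> b\<bar> < (h m)\<^sup>2" if "b \<in> {0..1}" for b
          using k[OF \<open>to_nat \<alpha> \<le> m\<close> that] by simp
        from this[of s] this[of "s + h m"]
        have "\<bar>h m * (\<integral>p. drift f P (monomial \<alpha>) p \<partial>\<mu> m)\<bar> \<le> h m * (2 * h m)"
          unfolding \<mu>_def window_drift[OF xX s(1) h(1)]
          using s h(2)[of m] less_imp_le[OF h(1)[of m]] by (auto simp: power2_eq_square)
        then show ?thesis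
          using h(1)[of m] by (simp add: abs_mult)
      qed
      then show "\<forall>\<^sub>F m in sequentially. norm (\<integral>p. drift f P (monomial \<alpha>) p \<partial>\<mu> m) \<le> 2 * h m"
        by (rule eventually_sequentiallyI)
    qed
    have quot: "(\<lambda>m. (z (s + h m) - z s) /\<^sub>R h m) \<longlonglongrightarrow> v"
    proof -
      have "((\<lambda>y. norm ((z y - z s) - (y - s) *\<^sub>R v) / norm (y - s)) \<longlongrightarrow> 0) (at s within {0..1})"
        using der by (simp add: has_vector_derivative_def has_derivative_iff_norm)
      moreover have "filterlim (\<lambda>m. s + h m) (at s within {0..1}) sequentially"
        unfolding filterlim_at
      proof
        show "\<forall>\<^sub>F m in sequentially. s + h m \<in> {0..1} \<and> s + h m \<noteq> s"
          using h s less_imp_le[OF h(1)] by (intro always_eventually) (auto intro: add_nonneg_nonneg simp: less_imp_neq[symmetric])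
        show "(\<lambda>m. s + h m) \<longlonglongrightarrow> s"
          using tendsto_add[OF tendsto_const h_lim, of s] by simp
      qed
      ultimately have "(\<lambda>m. norm ((z (s + h m) - z s) - (s + h m - s) *\<^sub>R v) / norm (s + h m - s)) \<longlonglongrightarrow> 0"
        by (rule filterlim_compose)
      moreover have "norm ((z (s + h m) - z s) - (s + h m - s) *\<^sub>R v) / norm (s + h m - s) =
          norm ((z (s + h m) - z s) /\<^sub>R h m - v)" for m
      proof -
        have "(z (s + h m) - z s) /\<^sub>R h m - v = ((z (s + h m) - z s) - h m *\<^sub>R v) /\<^sub>R h m"
          using h(1)[of m] by (simp add: scaleR_diff_right)
        then show ?thesis
          using h(1)[of m] by (simp add: divide_inverse mult.commute)
      qed
      ultimately show ?thesis
        by (simp add: tendsto_norm_zero_iff LIM_zero_iff)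
    qed
    have "(\<lambda>m. (\<integral>p. vel (z s) p \<partial>\<mu> m) - (z (s + h m) - z s) /\<^sub>R h m) \<longlonglongrightarrow> 0"
    proof (rule Lim_null_comparison)
      have "(\<lambda>m. 2 * h m + C * (speed * h m + h m * h m)) \<longlonglongrightarrow> 2 * 0 + C * (speed * 0 + 0 * 0)"
        by (intro tendsto_intros h_lim)
      then show "(\<lambda>m. 2 * h m + C * (speed * h m + h m * h m)) \<longlonglongrightarrow> 0"
        by simp
      have "norm ((\<integral>p. vel (z s) p \<partial>\<mu> m) - (z (s + h m) - z s) /\<^sub>R h m) \<le> 2 * h m + C * (speed * h m + h m * h m)" for m
      proof -
        let ?I = "\<integral>p. vel (z s) p \<partial>\<mu> m" and ?\<zeta> = "\<zeta> (k m)" and ?h = "h m"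
        have hm: "0 < ?h" "s + ?h \<le> 1"
          using h by auto
        have lip: "norm (?\<zeta> r - z s) \<le> speed * ?h + ?h * ?h" if r: "r \<in> {s..s + ?h}" for r
        proof -
          have "norm (?\<zeta> r - ?\<zeta> s) \<le> speed * \<bar>r - s\<bar>"
            using lipschitz_onD[OF trajectory_lipschitz[OF tr], of r s] r s hm by (simp add: dist_norm)
          also have "\<dots> \<le> speed * ?h"
            using r speed(1) by (intro mult_left_mono) auto
          finally have "norm (?\<zeta> r - ?\<zeta> s) \<le> speed * ?h" .
          moreover have "norm (?\<zeta> s - z s) \<le> ?h * ?h"
            using close[of s m] s by (simp add: power2_eq_square)
          ultimately show ?thesis
            using norm_triangle_ineq[of "?\<zeta> r - ?\<zeta> s" "?\<zeta> s - z s"] by simp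
        qed
        have "norm (?\<zeta> (s + ?h) - ?\<zeta> s - ?h *\<^sub>R ?I) \<le> C * (speed * ?h + ?h * ?h) * ?h"
          unfolding \<mu>_def using zZ s lip hm by (intro window_velocity[OF tr]) auto
        \<comment> \<open>Exchanging the trajectory for its limit at both window ends costs twice
          \<open>?h * ?h\<close>, still small after division by \<open>?h\<close>.\<close>
        moreover have "norm (?\<zeta> s - z s) \<le> ?h * ?h" "norm (?\<zeta> (s + ?h) - z (s + ?h)) \<le> ?h * ?h"
          using close[of s m] close[of "s + ?h" m] s hm by (simp_all add: power2_eq_square)
        moreover have "?h *\<^sub>R ?I - (z (s + ?h) - z s) =
            (?\<zeta> (s + ?h) - z (s + ?h)) - (?\<zeta> s - z s) - (?\<zeta> (s + ?h) - ?\<zeta> s - ?h *\<^sub>R ?I)"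
          by simp
        ultimately have "norm (?h *\<^sub>R ?I - (z (s + ?h) - z s)) \<le> ?h * ?h + ?h * ?h + C * (speed * ?h + ?h * ?h) * ?h"
          by (smt (verit) norm_triangle_ineq4)
        also have "\<dots> = ?h * (2 * ?h + C * (speed * ?h + ?h * ?h))"
          by (simp add: algebra_simps)
        finally have "norm (?h *\<^sub>R ?I - (z (s + ?h) - z s)) \<le> ?h * (2 * ?h + C * (speed * ?h + ?h * ?h))" .
        moreover have "?h *\<^sub>R ?I - (z (s + ?h) - z s) = ?h *\<^sub>R (?I - (z (s + ?h) - z s) /\<^sub>R ?h)"
          using hm by (simp add: scaleR_diff_right)
        ultimately show ?thesis
          using hm by simp
      qed
      then show "\<forall>\<^sub>F m in sequentially. norm ((\<integral>p. vel (z s) p \<partial>\<mu> m) - (z (s + h m) - z s) /\<^sub>R h m)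
          \<le> 2 * h m + C * (speed * h m + h m * h m)"
        by simp
    qed
    from tendsto_add[OF this quot] show "(\<lambda>m. \<integral>p. vel (z s) p \<partial>\<mu> m) \<longlonglongrightarrow> v"
      by simp
  qed
  then show ?thesis
    by (auto simp: averaged_velocities_def vel_def)
qed

lemma trajectories_limit_solution:
  fixes \<epsilon> :: "nat \<Rightarrow> real" and \<zeta> :: "nat \<Rightarrow> real \<Rightarrow> real ^ 'n"
  assumes tr: "\<And>k. trajectory (\<epsilon> k) (x k) (\<zeta> k)"
    and drift: "\<And>\<alpha> e. e > 0 \<Longrightarrow> \<forall>\<^sub>F k in sequentially. \<forall>b\<in>{0..1}. \<bar>cumulative_drift (\<epsilon> k) (x k) \<alpha> b\<bar> < e"
    and "d > 0"
  shows "\<exists>z k. averaged_solution z \<and> (\<forall>s\<in>{0..1}. norm (\<zeta> k s - z s) < d)"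
proof -
  obtain B where B: "\<And>z. z \<in> Z \<Longrightarrow> norm z \<le> B"
    using compact_imp_bounded[OF compact_Z] unfolding bounded_iff by blast
  have lip: "norm (\<zeta> k s - \<zeta> k t) \<le> speed * \<bar>s - t\<bar>" if "s \<in> {0..1}" "t \<in> {0..1}" for k s t
    using lipschitz_onD[OF trajectory_lipschitz[OF tr] that] by (simp add: dist_norm)
  obtain z r where z: "continuous_on {0..1} z" "strict_mono (r :: nat \<Rightarrow> nat)"
    and unif: "\<And>e. 0 < e \<Longrightarrow> \<exists>N. \<forall>k s. k \<ge> N \<and> s \<in> {0..1} \<longrightarrow> norm (\<zeta> (r k) s - z s) < e"
  proof (rule Arzela_Ascoli[of "{0..1}" \<zeta> B])
    show "norm (\<zeta> k s) \<le> B" if "s \<in> {0..1}" for k s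
      using trajectory_in_Z[OF tr that] by (rule B)
    show "\<exists>d>0. \<forall>k y. y \<in> {0..1} \<and> norm (s - y) < d \<longrightarrow> norm (\<zeta> k s - \<zeta> k y) < e"
      if "s \<in> {0..1}" "0 < e" for s e
    \<comment> \<open>Adding 1 avoids a division by zero when \<open>speed\<close> is 0.\<close>
    proof (intro exI[of _ "e / (speed + 1)"] conjI allI impI)
      show "e / (speed + 1) > 0"
        using \<open>0 < e\<close> speed(1) by simp
      fix k y assume y: "y \<in> {0..1} \<and> norm (s - y) < e / (speed + 1)"
      have "norm (\<zeta> k s - \<zeta> k y) \<le> speed * \<bar>s - y\<bar>"
        using lip y that by blast
      also have "\<dots> \<le> speed * (e / (speed + 1))"
        using y speed(1) by (intro mult_left_mono) auto
      also have "\<dots> < e"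
        using \<open>0 < e\<close> speed(1) by (simp add: field_simps)
      finally show "norm (\<zeta> k s - \<zeta> k y) < e" .
    qed
  qed auto
  have lim: "(\<lambda>k. \<zeta> (r k) s) \<longlonglongrightarrow> z s" if "s \<in> {0..1}" for s
    using unif that by (auto simp: LIMSEQ_iff) metis
  have zZ: "z ` {0..1} \<subseteq> Z"
  proof
    fix w assume "w \<in> z ` {0..1}"
    then obtain s where s: "s \<in> {0..1}" "w = z s" by blast
    have "\<zeta> (r k) s \<in> Z" for k
      using tr s by (intro trajectory_in_Z)
    then show "w \<in> Z"
      using closed_sequentially[OF compact_imp_closed[OF compact_Z] _ lim[OF s(1)]] s(2) by simp
  qed
  have z_lip: "speed-lipschitz_on {0..1} z"
  proof (rule lipschitz_onI[OF _ speed(1)])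
    fix s t :: real assume st: "s \<in> {0..1}" "t \<in> {0..1}"
    have "(\<lambda>k. norm (\<zeta> (r k) s - \<zeta> (r k) t)) \<longlonglongrightarrow> norm (z s - z t)"
      by (intro tendsto_intros lim st)
    then show "dist (z s) (z t) \<le> speed * dist s t"
      unfolding dist_norm real_norm_def using lip[OF st] by (intro LIMSEQ_le_const2) auto
  qed
  have V: "v \<in> V (z s)" if "s \<in> {0..1}" "s < 1" "(z has_vector_derivative v) (at s within {0..1})" for s v
  proof (rule limit_velocity[where \<epsilon>="\<epsilon> \<circ> r" and x="x \<circ> r" and \<zeta>="\<zeta> \<circ> r" and z=z and s=s])
    show "\<forall>\<^sub>F k in sequentially. \<forall>s\<in>{0..1}. norm ((\<zeta> \<circ> r) k s - z s) < e" if "e > 0" for e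
    proof -
      obtain N where "\<forall>k s. k \<ge> N \<and> s \<in> {0..1} \<longrightarrow> norm (\<zeta> (r k) s - z s) < e"
        using unif[OF \<open>e > 0\<close>] by blast
      then show ?thesis
        by (intro eventually_sequentiallyI[of N]) simp
    qed
    show "\<forall>\<^sub>F k in sequentially. \<forall>b\<in>{0..1}. \<bar>cumulative_drift ((\<epsilon> \<circ> r) k) ((x \<circ> r) k) \<alpha> b\<bar> < e" if "e > 0" for \<alpha> e
      using eventually_subseq[OF z(2) drift[OF that]] by simp
  qed (use tr zZ that in auto)
  have "averaged_solution z"
    unfolding averaged_solution_def inclusion_solution_def
  proof (intro conjI zZ z_lip)
    show "abs_continuous_on {0..1} z"
      using z_lip by (rule lipschitz_abs_continuous_on)
    have "\<zeta> (r k) 0 = z0" for k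
      using tr by (simp add: trajectory_def)
    then show "z 0 = z0"
      using lim[of 0] by (simp add: LIMSEQ_const_iff)
    have "AE s in lebesgue_on {0..1}. s \<in> {0..1}"
      by (rule AE_I2) (simp add: space_restrict_space)
    moreover have "AE s in lebesgue_on {0..1}. s < 1 \<and> (\<exists>v. (z has_vector_derivative v) (at s within {0..1}))"
      using z_lip by (rule lipschitz_on_interval_AE_differentiable) simp
    ultimately show "AE s in lebesgue_on {0..1}. \<exists>v\<in>V (z s). (z has_vector_derivative v) (at s within {0..1})"
      by eventually_elim (use V in blast)
  qed
  moreover obtain k where "\<forall>s\<in>{0..1}. norm (\<zeta> (r k) s - z s) < d"
    using unif[OF \<open>d > 0\<close>] by blast
  ultimately show ?thesis by blast
qed

text \<open>The same \<open>k\<close> counts the monomials and fixes the tolerance, so failure for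
  every \<open>k\<close> yields a sequence of trajectories whose drifts vanish for each monomial.
  The resulting \<open>k\<close> depends on \<open>d\<close> alone; the step size, the samples and
  the curve are quantified after it.\<close>

lemma trajectory_near_solution:
  assumes "d > 0"
  shows "\<exists>k. \<forall>\<epsilon> x \<zeta>. trajectory \<epsilon> x \<zeta> \<longrightarrow>
    (\<forall>j<k. \<forall>b\<in>{0..1}. \<bar>cumulative_drift \<epsilon> x (from_nat j) b\<bar> \<le> 1 / real k) \<longrightarrow>
    (\<exists>z. averaged_solution z \<and> (\<forall>s\<in>{0..1}. norm (\<zeta> s - z s) < d))"
proof (rule ccontr)
  assume "\<not> ?thesis"
  then obtain \<epsilon> x \<zeta> where tr: "\<And>k. trajectory (\<epsilon> k) (x k) (\<zeta> k)"
    and dr: "\<And>k j b. j < k \<Longrightarrow> b \<in> {0..1} \<Longrightarrow> \<bar>cumulative_drift (\<epsilon> k) (x k) (from_nat j) b\<bar> \<le> 1 / real k"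
    and no: "\<And>k. \<not> (\<exists>z. averaged_solution z \<and> (\<forall>s\<in>{0..1}. norm (\<zeta> k s - z s) < d))"
    unfolding not_ex not_all not_imp by metis
  have "\<forall>\<^sub>F k in sequentially. \<forall>b\<in>{0..1}. \<bar>cumulative_drift (\<epsilon> k) (x k) \<alpha> b\<bar> < e" if "e > 0" for \<alpha> e
  proof -
    obtain N where N: "1 / real (Suc N) < e"
      using nat_approx_posE[OF \<open>e > 0\<close>] by blast
    show ?thesis
    proof (rule eventually_sequentiallyI[of "max (Suc N) (Suc (to_nat \<alpha>))"], intro ballI)
      fix k :: nat and b :: real assume k: "max (Suc N) (Suc (to_nat \<alpha>)) \<le> k" and b: "b \<in> {0..1}"
      have "\<bar>cumulative_drift (\<epsilon> k) (x k) \<alpha> b\<bar> \<le> 1 / real k"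
        using dr[of "to_nat \<alpha>" k b] k b by simp
      also have "\<dots> \<le> 1 / real (Suc N)"
        using k by (intro divide_left_mono) auto
      finally show "\<bar>cumulative_drift (\<epsilon> k) (x k) \<alpha> b\<bar> < e"
        using N by simp
    qed
  qed
  from trajectories_limit_solution[OF tr this \<open>d > 0\<close>] no show False
    by blast
qed

end

section \<open>The martingale of innovations\<close>

lemma state_in_invariant_set:
  assumes "\<And>y u \<sigma>. y \<in> Y \<Longrightarrow> f y u \<sigma> \<in> Y" "y0 \<in> Y"
  shows "state f \<pi> y0 \<xi> t \<in> Y"
  by (induction t) (use assms in auto)

text \<open>Nonanticipation: the control at time \<open>t\<close> reads only the noise before
  \<open>t\<close>, hence \<open>t = n\<close> is allowed. This permits path functionals to be
  treated as functions of a finite noise prefix.\<close>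

lemma control_restrict: "t \<le> n \<Longrightarrow> control \<pi> (restrict \<xi> {..<n}) t = control \<pi> \<xi> t"
proof -
  assume "t \<le> n"
  then have "{..<n} \<inter> {..<t} = {..<t}"
    by auto
  then show ?thesis
    by (simp add: control_def restrict_restrict)
qed

lemma state_restrict: "t \<le> n \<Longrightarrow> state f \<pi> y0 (restrict \<xi> {..<n}) t = state f \<pi> y0 \<xi> t"
  by (induction t) (auto simp: control_restrict)

definition sample :: "('y \<Rightarrow> 'u \<Rightarrow> 's \<Rightarrow> 'y) \<Rightarrow> (nat \<Rightarrow> (nat \<Rightarrow> 's) \<Rightarrow> 'u) \<Rightarrow> 'y \<Rightarrow> (nat \<Rightarrow> 's) \<Rightarrow> nat \<Rightarrow> 'y \<times> 'u" where
  "sample f \<pi> y0 \<xi> t = (state f \<pi> y0 \<xi> t, control \<pi> \<xi> t)"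

lemma sample_restrict: "t \<le> n \<Longrightarrow> sample f \<pi> y0 (restrict \<xi> {..<n}) t = sample f \<pi> y0 \<xi> t"
  by (simp add: sample_def control_restrict state_restrict)

section \<open>Measurability of controlled paths\<close>

context controlled_system
begin

lemma closed_Y: "closed Y"
  by (rule compact_imp_closed[OF compact_Y])

text \<open>Continuity of \<open>f\<close> is available only over \<open>Y\<close>. Extension by 0
  off this closed set gives a Borel map on the whole type, and it agrees with \<open>f\<close> along
  paths because they never leave \<open>Y\<close>.\<close>

definition dynamics :: "(real ^ 'm) \<times> 'u \<times> 's \<Rightarrow> real ^ 'm" where
  "dynamics = (\<lambda>p. if p \<in> Y \<times> UNIV \<times> UNIV then (\<lambda>(y, u, \<sigma>). f y u \<sigma>) p else 0)"

lemma dynamics_eq: "y \<in> Y \<Longrightarrow> dynamics (y, u, \<sigma>) = f y u \<sigma>"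
  by (simp add: dynamics_def)

lemma measurable_dynamics [measurable]: "dynamics \<in> borel_measurable borel"
  unfolding dynamics_def
  by (intro borel_measurable_continuous_on_if cont_f continuous_on_const borel_closed closed_Times closed_Y closed_UNIV)

lemma measurable_control:
  assumes "\<pi> \<in> control_plans \<epsilon>" "t \<le> nat \<lfloor>1 / \<epsilon>\<rfloor>" "t \<le> n"
  shows "(\<lambda>\<xi>. control \<pi> \<xi> t) \<in> (\<Pi>\<^sub>M i\<in>{..<n}. borel) \<rightarrow>\<^sub>M borel"
  unfolding control_def
  by (rule measurable_compose[OF measurable_restrict_subset]) (use assms in \<open>auto simp: control_plans_def\<close>)

text \<open>The horizon is one step longer than that of the plan, since the state at time
  \<open>Suc t\<close> involves controls only up to time \<open>t\<close>.\<close>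

lemma measurable_state:
  assumes \<pi>: "\<pi> \<in> control_plans \<epsilon>" and "y0 \<in> Y" and "t \<le> Suc (nat \<lfloor>1 / \<epsilon>\<rfloor>)" "t \<le> n"
  shows "(\<lambda>\<xi>. state f \<pi> y0 \<xi> t) \<in> (\<Pi>\<^sub>M i\<in>{..<n}. borel) \<rightarrow>\<^sub>M borel"
  using assms(3,4)
proof (induction t)
  case (Suc t)
  have comp: "(\<lambda>\<xi>. \<xi> t) \<in> (\<Pi>\<^sub>M i\<in>{..<n}. borel) \<rightarrow>\<^sub>M (borel :: 's measure)"
    using Suc.prems by (intro measurable_component_singleton) auto
  have "(\<lambda>\<xi>. dynamics (state f \<pi> y0 \<xi> t, control \<pi> \<xi> t, \<xi> t)) \<in> (\<Pi>\<^sub>M i\<in>{..<n}. borel) \<rightarrow>\<^sub>M borel"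
    using Suc comp measurable_control[OF \<pi>]
    by (intro measurable_compose[OF _ measurable_dynamics] borel_measurable_Pair) auto
  moreover have "state f \<pi> y0 \<xi> t \<in> Y" for \<xi>
    using f_in_Y \<open>y0 \<in> Y\<close> by (rule state_in_invariant_set)
  ultimately show ?case
    by (simp add: dynamics_eq)
qed simp


lemma measurable_sample:
  assumes "\<pi> \<in> control_plans \<epsilon>" "y0 \<in> Y" "t \<le> nat \<lfloor>1 / \<epsilon>\<rfloor>" "t \<le> n"
  shows "(\<lambda>\<xi>. sample f \<pi> y0 \<xi> t) \<in> (\<Pi>\<^sub>M i\<in>{..<n}. borel) \<rightarrow>\<^sub>M borel"
  unfolding sample_def using assms
  by (intro borel_measurable_Pair measurable_state[of \<pi> \<epsilon>] measurable_control[of \<pi> \<epsilon>]) auto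

lemma state_in_Y: "y0 \<in> Y \<Longrightarrow> state f \<pi> y0 \<xi> t \<in> Y"
  using f_in_Y by (rule state_in_invariant_set)

lemma sample_in_X: "y0 \<in> Y \<Longrightarrow> sample f \<pi> y0 \<xi> t \<in> X"
  by (simp add: sample_def state_in_Y)

lemma measurable_drift_sample:
  assumes "\<pi> \<in> control_plans \<epsilon>" "y0 \<in> Y" "t \<le> nat \<lfloor>1 / \<epsilon>\<rfloor>" "t \<le> n" "continuous_on Y \<phi>"
  shows "(\<lambda>\<xi>. drift f P \<phi> (sample f \<pi> y0 \<xi> t)) \<in> borel_measurable (\<Pi>\<^sub>M i\<in>{..<n}. borel)"
proof -
  have "(\<lambda>p. if p \<in> X then drift f P \<phi> p else 0) \<in> borel_measurable borel"
    by (intro borel_measurable_continuous_on_if continuous_on_drift assms continuous_on_const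
        borel_closed compact_imp_closed[OF compact_X])
  from measurable_compose[OF measurable_sample[OF assms(1-4)] this] show ?thesis
    using sample_in_X[OF assms(2)] by simp
qed

end

section \<open>Orthogonality and second moments of innovations\<close>

locale noisy_system = controlled_system f Y P + M: prob_space M
  for f :: "real ^ 'm \<Rightarrow> 'u::{metric_space, second_countable_topology} \<Rightarrow>
              's::{metric_space, second_countable_topology} \<Rightarrow> real ^ 'm"
    and Y and P :: "'s measure" and M :: "'w measure" +
  fixes \<sigma> :: "nat \<Rightarrow> 'w \<Rightarrow> 's" and y0 :: "real ^ 'm"
  assumes indep_noise: "M.indep_vars (\<lambda>_. borel) \<sigma> UNIV"
    and distr_noise: "\<And>t. distr M borel (\<sigma> t) = P"
    and y0: "y0 \<in> Y"
begin

abbreviation noise :: "'w \<Rightarrow> nat \<Rightarrow> 's" where "noise \<omega> \<equiv> \<lambda>t. \<sigma> t \<omega>"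

lemma measurable_noise [measurable]: "\<sigma> t \<in> M \<rightarrow>\<^sub>M borel"
  using indep_noise by (simp add: M.indep_vars_def)

lemma measurable_noise_prefix: "(\<lambda>\<omega>. restrict (noise \<omega>) {..<n}) \<in> M \<rightarrow>\<^sub>M (\<Pi>\<^sub>M i\<in>{..<n}. borel)"
  by (intro measurable_restrict measurable_noise)

lemma measurable_sample_noise:
  assumes "\<pi> \<in> control_plans \<epsilon>" "t \<le> nat \<lfloor>1 / \<epsilon>\<rfloor>"
  shows "(\<lambda>\<omega>. sample f \<pi> y0 (noise \<omega>) t) \<in> M \<rightarrow>\<^sub>M borel"
  using measurable_compose[OF measurable_noise_prefix[of t] measurable_sample[OF assms(1) y0 assms(2) order.refl]]
  by (simp add: sample_restrict)

text \<open>The martingale difference of \<open>\<phi>\<close> along a path: its increment minus the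
  conditional mean of that increment given the earlier noise.\<close>

definition innovation :: "(real ^ 'm \<Rightarrow> real) \<Rightarrow> (nat \<Rightarrow> (nat \<Rightarrow> 's) \<Rightarrow> 'u) \<Rightarrow> (nat \<Rightarrow> 's) \<Rightarrow> nat \<Rightarrow> real" where
  "innovation \<phi> \<pi> \<xi> t = \<phi> (state f \<pi> y0 \<xi> (Suc t)) - \<phi> (state f \<pi> y0 \<xi> t) - drift f P \<phi> (sample f \<pi> y0 \<xi> t)"

lemma measurable_innovation:
  assumes "\<pi> \<in> control_plans \<epsilon>" "t \<le> nat \<lfloor>1 / \<epsilon>\<rfloor>" "t < n" "continuous_on UNIV \<phi>"
  shows "(\<lambda>\<xi>. innovation \<phi> \<pi> \<xi> t) \<in> borel_measurable (\<Pi>\<^sub>M i\<in>{..<n}. borel)"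
proof -
  have \<phi>: "\<phi> \<in> borel_measurable borel"
    using assms(4) by (rule borel_measurable_continuous_onI)
  show ?thesis
    unfolding innovation_def using assms y0
    by (intro borel_measurable_diff measurable_compose[OF _ \<phi>] measurable_state[of \<pi> \<epsilon>]
        measurable_drift_sample[of \<pi> \<epsilon>] continuous_on_subset[OF assms(4)]) auto
qed

lemma innovation_restrict: "t < n \<Longrightarrow> innovation \<phi> \<pi> (restrict \<xi> {..<n}) t = innovation \<phi> \<pi> \<xi> t"
  unfolding innovation_def by (simp only: state_restrict sample_restrict less_imp_le Suc_leI)

lemma innovation_bound:
  assumes "continuous_on UNIV \<phi>" "\<And>y. y \<in> Y \<Longrightarrow> \<bar>\<phi> y\<bar> \<le> B"
  shows "\<bar>innovation \<phi> \<pi> \<xi> t\<bar> \<le> 4 * B"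
proof -
  have "\<bar>\<phi> (state f \<pi> y0 \<xi> (Suc t))\<bar> \<le> B" "\<bar>\<phi> (state f \<pi> y0 \<xi> t)\<bar> \<le> B"
    by (rule assms(2)[OF state_in_Y[OF y0]])+
  moreover have "\<bar>drift f P \<phi> (sample f \<pi> y0 \<xi> t)\<bar> \<le> 2 * B"
    by (intro drift_bound assms(2) sample_in_X y0 continuous_on_subset[OF assms(1)]) auto
  ultimately show ?thesis
    unfolding innovation_def by linarith
qed

text \<open>The current noise is independent of the prefix. By Fubini it can be integrated out with
  the prefix held fixed, and its mean then cancels against the drift. \<open>A\<close> plays the
  part of an arbitrary bounded functional of the past.\<close>

lemma innovation_orthogonal:
  assumes \<pi>: "\<pi> \<in> control_plans \<epsilon>" and n: "n \<le> nat \<lfloor>1 / \<epsilon>\<rfloor>" and \<phi>: "continuous_on UNIV \<phi>"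
    and A: "A \<in> borel_measurable (\<Pi>\<^sub>M i\<in>{..<n}. borel)" and A_bound: "\<And>\<xi>. \<bar>A \<xi>\<bar> \<le> K"
  shows "M.expectation (\<lambda>\<omega>. A (restrict (noise \<omega>) {..<n}) * innovation \<phi> \<pi> (noise \<omega>) n) = 0"
proof -
  define N where "N = (\<Pi>\<^sub>M i\<in>{..<n}. borel :: 's measure)"
  define Q where "Q = distr M N (\<lambda>\<omega>. restrict (noise \<omega>) {..<n})"
  \<comment> \<open>Independence of restrictions is stated for product spaces, so even the single
    current noise element is carried as a function on \<open>{n}\<close>.\<close>
  define N' where "N' = (\<Pi>\<^sub>M i\<in>{n}. borel :: 's measure)"
  define Q' where "Q' = distr M N' (\<lambda>\<omega>. restrict (noise \<omega>) {n})"
  have current [measurable]: "(\<lambda>\<omega>. restrict (noise \<omega>) {n}) \<in> M \<rightarrow>\<^sub>M N'"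
    unfolding N'_def by (intro measurable_restrict measurable_noise)
  have proj [measurable]: "(\<lambda>\<eta>. \<eta> n) \<in> N' \<rightarrow>\<^sub>M borel"
    unfolding N'_def by (intro measurable_component_singleton) simp
  have prefix [measurable]: "(\<lambda>\<omega>. restrict (noise \<omega>) {..<n}) \<in> M \<rightarrow>\<^sub>M N"
    unfolding N_def by (rule measurable_noise_prefix)
  have "M.indep_var N (\<lambda>\<omega>. restrict (noise \<omega>) {..<n}) (\<Pi>\<^sub>M i\<in>{n}. borel) (\<lambda>\<omega>. restrict (noise \<omega>) {n})"
    unfolding N_def using M.indep_var_restrict[OF indep_noise, of "{..<n}" "{n}"] by simp
  then have joint: "Q \<Otimes>\<^sub>M Q' = distr M (N \<Otimes>\<^sub>M N') (\<lambda>\<omega>. (restrict (noise \<omega>) {..<n}, restrict (noise \<omega>) {n}))"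
    by (simp add: M.indep_var_distribution_eq Q_def Q'_def N'_def)
  interpret Q: prob_space Q
    unfolding Q_def by (rule M.prob_space_distr) simp
  interpret Q': prob_space Q'
    unfolding Q'_def by (rule M.prob_space_distr) simp
  interpret QQ: pair_prob_space Q Q' ..
  have \<phi>_meas: "\<phi> \<in> borel_measurable borel"
    using \<phi> by (rule borel_measurable_continuous_onI)
  have \<phi>_cont: "continuous_on Y \<phi>"
    using \<phi> continuous_on_subset by blast
  obtain B where B: "\<And>y. y \<in> Y \<Longrightarrow> \<bar>\<phi> y\<bar> \<le> B"
    using compact_imp_bounded[OF compact_continuous_image[OF \<phi>_cont compact_Y]] unfolding bounded_iff by auto
  \<comment> \<open>The past \<open>\<xi>\<close> and the current noise \<open>\<eta>\<close> become
    separate arguments; \<open>dynamics\<close> stands in for \<open>f\<close> to make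
    \<open>T\<close> measurable on the product.\<close>
  define T where "T = (\<lambda>(\<xi>, \<eta>). A \<xi> * (\<phi> (dynamics (state f \<pi> y0 \<xi> n, control \<pi> \<xi> n, \<eta> n))
      - (\<phi> (state f \<pi> y0 \<xi> n) + drift f P \<phi> (sample f \<pi> y0 \<xi> n))))"
  have sY: "state f \<pi> y0 \<xi> n \<in> Y" for \<xi>
    by (rule state_in_Y[OF y0])
  have st [measurable]: "(\<lambda>\<xi>. state f \<pi> y0 \<xi> n) \<in> N \<rightarrow>\<^sub>M borel"
    unfolding N_def by (rule measurable_state[OF \<pi> y0]) (use n in auto)
  have ct [measurable]: "(\<lambda>\<xi>. control \<pi> \<xi> n) \<in> N \<rightarrow>\<^sub>M borel"
    unfolding N_def by (rule measurable_control[OF \<pi> n order.refl])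
  have dr [measurable]: "(\<lambda>\<xi>. drift f P \<phi> (sample f \<pi> y0 \<xi> n)) \<in> borel_measurable N"
    unfolding N_def by (rule measurable_drift_sample[OF \<pi> y0 n order.refl \<phi>_cont])
  have A' [measurable]: "A \<in> borel_measurable N"
    using A by (simp add: N_def)
  have dyn: "(\<lambda>p. dynamics (state f \<pi> y0 (fst p) n, control \<pi> (fst p) n, snd p n)) \<in> N \<Otimes>\<^sub>M N' \<rightarrow>\<^sub>M borel"
    by (intro measurable_compose[OF _ measurable_dynamics] borel_measurable_Pair
        measurable_compose[OF measurable_fst st] measurable_compose[OF measurable_fst ct]
        measurable_compose[OF measurable_snd proj])
  have T_meas: "T \<in> borel_measurable (N \<Otimes>\<^sub>M N')"
    unfolding T_def split_beta
    by (intro borel_measurable_times borel_measurable_diff borel_measurable_add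
        measurable_compose[OF dyn \<phi>_meas] measurable_compose[OF measurable_fst A']
        measurable_compose[OF measurable_compose[OF measurable_fst st] \<phi>_meas] measurable_compose[OF measurable_fst dr])
  have sets_QQ: "sets (Q \<Otimes>\<^sub>M Q') = sets (N \<Otimes>\<^sub>M N')"
    by (intro sets_pair_measure_cong) (simp_all add: Q_def Q'_def)
  have "\<bar>T p\<bar> \<le> K * (4 * B)" for p
  proof (cases p)
    case (Pair \<xi> \<eta>)
    have "\<bar>\<phi> (f (state f \<pi> y0 \<xi> n) (control \<pi> \<xi> n) (\<eta> n))\<bar> \<le> B" "\<bar>\<phi> (state f \<pi> y0 \<xi> n)\<bar> \<le> B"
      by (rule B, intro f_in_Y sY)+
    moreover have "\<bar>drift f P \<phi> (sample f \<pi> y0 \<xi> n)\<bar> \<le> 2 * B"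
      by (intro drift_bound B sample_in_X y0 \<phi>_cont)
    ultimately have "\<bar>\<phi> (f (state f \<pi> y0 \<xi> n) (control \<pi> \<xi> n) (\<eta> n)) -
        (\<phi> (state f \<pi> y0 \<xi> n) + drift f P \<phi> (sample f \<pi> y0 \<xi> n))\<bar> \<le> 4 * B"
      by linarith
    moreover have "0 \<le> K"
      using A_bound[of \<xi>] by linarith
    ultimately show ?thesis
      using A_bound[of \<xi>] unfolding T_def Pair
      by (simp add: dynamics_eq[OF sY] abs_mult mult_mono)
  qed
  then have int: "integrable (Q \<Otimes>\<^sub>M Q') T"
    using T_meas by (intro QQ.integrable_const_bound[of _ "K * (4 * B)"]) (auto simp: measurable_cong_sets[OF sets_QQ refl])
  have inner: "(\<integral>\<eta>. T (\<xi>, \<eta>) \<partial>Q') = 0" for \<xi>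
  proof -
    define c where "c = \<phi> (state f \<pi> y0 \<xi> n) + drift f P \<phi> (sample f \<pi> y0 \<xi> n)"
    define H where "H s = A \<xi> * (\<phi> (f (state f \<pi> y0 \<xi> n) (control \<pi> \<xi> n) s) - c)" for s
    have intH: "integrable P H"
      unfolding H_def using noise_integrable[OF \<phi>_cont sY]
      by (intro integrable_mult_right Bochner_Integration.integrable_diff) auto
    then have H_meas: "H \<in> borel_measurable borel"
      using measurable_cong_sets[OF sets_P refl] borel_measurable_integrable by blast
    have "(\<integral>\<eta>. T (\<xi>, \<eta>) \<partial>Q') = (\<integral>\<eta>. H (\<eta> n) \<partial>Q')"
      by (simp add: T_def H_def c_def dynamics_eq[OF sY])
    also have "\<dots> = M.expectation (\<lambda>\<omega>. H (\<sigma> n \<omega>))"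
      unfolding Q'_def using measurable_compose[OF proj H_meas] by (subst integral_distr) auto
    also have "\<dots> = (\<integral>s. H s \<partial>P)"
      unfolding distr_noise[of n, symmetric] by (rule integral_distr[OF measurable_noise H_meas, symmetric])
    also have "\<dots> = A \<xi> * ((\<integral>s. \<phi> (f (state f \<pi> y0 \<xi> n) (control \<pi> \<xi> n) s) \<partial>P) - c)"
      unfolding H_def using noise_integrable[OF \<phi>_cont sY] by (simp add: P.prob_space)
    also have "\<dots> = 0"
      by (simp add: c_def drift_def sample_def)
    finally show ?thesis .
  qed
  have "M.expectation (\<lambda>\<omega>. A (restrict (noise \<omega>) {..<n}) * innovation \<phi> \<pi> (noise \<omega>) n) =
      M.expectation (\<lambda>\<omega>. T (restrict (noise \<omega>) {..<n}, restrict (noise \<omega>) {n}))"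
    unfolding T_def innovation_def
    by (simp add: dynamics_eq[OF sY] state_restrict control_restrict sample_restrict algebra_simps)
  also have "\<dots> = (\<integral>p. T p \<partial>(Q \<Otimes>\<^sub>M Q'))"
    unfolding joint by (intro integral_distr[symmetric] T_meas measurable_Pair prefix current)
  also have "\<dots> = (\<integral>\<xi>. (\<integral>\<eta>. T (\<xi>, \<eta>) \<partial>Q') \<partial>Q)"
    using QQ.integral_fst'[OF int] by simp
  also have "\<dots> = 0"
    by (simp add: inner)
  finally show ?thesis .
qed

definition martingale :: "(real ^ 'm \<Rightarrow> real) \<Rightarrow> (nat \<Rightarrow> (nat \<Rightarrow> 's) \<Rightarrow> 'u) \<Rightarrow> (nat \<Rightarrow> 's) \<Rightarrow> nat \<Rightarrow> real" where
  "martingale \<phi> \<pi> \<xi> n = (\<Sum>t<n. innovation \<phi> \<pi> \<xi> t)"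

lemma measurable_martingale:
  assumes "\<pi> \<in> control_plans \<epsilon>" "n \<le> nat \<lfloor>1 / \<epsilon>\<rfloor>" "continuous_on UNIV \<phi>"
  shows "(\<lambda>\<xi>. martingale \<phi> \<pi> \<xi> n) \<in> borel_measurable (\<Pi>\<^sub>M i\<in>{..<n}. borel)"
  unfolding martingale_def using assms
  by (intro borel_measurable_sum measurable_innovation) auto

lemma martingale_restrict: "martingale \<phi> \<pi> (restrict \<xi> {..<n}) n = martingale \<phi> \<pi> \<xi> n"
  unfolding martingale_def by (intro sum.cong refl innovation_restrict) simp

lemma martingale_bound:
  assumes "continuous_on UNIV \<phi>" "\<And>y. y \<in> Y \<Longrightarrow> \<bar>\<phi> y\<bar> \<le> B"
  shows "\<bar>martingale \<phi> \<pi> \<xi> n\<bar> \<le> real n * (4 * B)"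
proof -
  have "\<bar>martingale \<phi> \<pi> \<xi> n\<bar> \<le> (\<Sum>t<n. \<bar>innovation \<phi> \<pi> \<xi> t\<bar>)"
    unfolding martingale_def by (rule sum_abs)
  also have "\<dots> \<le> (\<Sum>t<n. 4 * B)"
    by (intro sum_mono innovation_bound assms)
  finally show ?thesis by simp
qed

lemma measurable_martingale_noise:
  assumes "\<pi> \<in> control_plans \<epsilon>" "n \<le> nat \<lfloor>1 / \<epsilon>\<rfloor>" "continuous_on UNIV \<phi>"
  shows "(\<lambda>\<omega>. martingale \<phi> \<pi> (noise \<omega>) n) \<in> borel_measurable M"
  using measurable_compose[OF measurable_noise_prefix[of n] measurable_martingale[OF assms]]
  by (simp add: martingale_restrict)

text \<open>Orthogonality removes the cross term in each step, so the second moment grows only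
  linearly in \<open>n\<close>, whereas the pointwise bound on the square is quadratic.\<close>

lemma martingale_second_moment:
  assumes \<pi>: "\<pi> \<in> control_plans \<epsilon>" and \<phi>: "continuous_on UNIV \<phi>"
    and B: "\<And>y. y \<in> Y \<Longrightarrow> \<bar>\<phi> y\<bar> \<le> B" and n: "n \<le> nat \<lfloor>1 / \<epsilon>\<rfloor>"
  shows "integrable M (\<lambda>\<omega>. (martingale \<phi> \<pi> (noise \<omega>) n)\<^sup>2)"
    "M.expectation (\<lambda>\<omega>. (martingale \<phi> \<pi> (noise \<omega>) n)\<^sup>2) \<le> real n * (4 * B)\<^sup>2"
proof -
  have B0: "0 \<le> B"
    using B[OF y0] by linarith
  have int: "integrable M (\<lambda>\<omega>. (martingale \<phi> \<pi> (noise \<omega>) n)\<^sup>2)" if "n \<le> nat \<lfloor>1 / \<epsilon>\<rfloor>" for n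
  proof (rule M.integrable_const_bound[of _ "(real n * (4 * B))\<^sup>2"])
    show "AE \<omega> in M. norm ((martingale \<phi> \<pi> (noise \<omega>) n)\<^sup>2) \<le> (real n * (4 * B))\<^sup>2"
      using power_mono[OF martingale_bound[OF \<phi> B] abs_ge_zero, where n=2] by (intro AE_I2) simp
  qed (use measurable_martingale_noise[OF \<pi> that \<phi>] in simp)
  show "integrable M (\<lambda>\<omega>. (martingale \<phi> \<pi> (noise \<omega>) n)\<^sup>2)"
    by (rule int[OF n])
  show "M.expectation (\<lambda>\<omega>. (martingale \<phi> \<pi> (noise \<omega>) n)\<^sup>2) \<le> real n * (4 * B)\<^sup>2"
    using n
  proof (induction n)
    case 0
    show ?case by (simp add: martingale_def)
  next
    case (Suc n)
    let ?S = "\<lambda>\<omega>. martingale \<phi> \<pi> (noise \<omega>) n" and ?d = "\<lambda>\<omega>. innovation \<phi> \<pi> (noise \<omega>) n"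
    have n: "n \<le> nat \<lfloor>1 / \<epsilon>\<rfloor>"
      using Suc.prems by simp
    have S_meas: "?S \<in> borel_measurable M"
      by (rule measurable_martingale_noise[OF \<pi> n \<phi>])
    have d_meas: "?d \<in> borel_measurable M"
      using measurable_compose[OF measurable_noise_prefix[of "Suc n"] measurable_innovation[OF \<pi> n _ \<phi>, of "Suc n"]]
      by (simp add: innovation_restrict)
    have S_bound: "\<bar>?S \<omega>\<bar> \<le> real n * (4 * B)" for \<omega>
      by (rule martingale_bound[OF \<phi> B])
    have d_bound: "\<bar>?d \<omega>\<bar> \<le> 4 * B" for \<omega>
      by (rule innovation_bound[OF \<phi> B])
    have d2: "(?d \<omega>)\<^sup>2 \<le> (4 * B)\<^sup>2" for \<omega>
      using power_mono[OF d_bound[of \<omega>] abs_ge_zero, where n=2] by simp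
    have int_d2: "integrable M (\<lambda>\<omega>. (?d \<omega>)\<^sup>2)"
      using d_meas d2 by (intro M.integrable_const_bound[of _ "(4 * B)\<^sup>2"]) auto
    have int_Sd: "integrable M (\<lambda>\<omega>. ?S \<omega> * ?d \<omega>)"
    proof (rule M.integrable_const_bound[of _ "real n * (4 * B) * (4 * B)"])
      show "AE \<omega> in M. norm (?S \<omega> * ?d \<omega>) \<le> real n * (4 * B) * (4 * B)"
        using mult_mono[OF S_bound d_bound] B0 by (intro AE_I2) (simp add: abs_mult)
    qed (use S_meas d_meas in simp)
    define A where "A \<xi> = martingale \<phi> \<pi> \<xi> n" for \<xi>
    have "M.expectation (\<lambda>\<omega>. A (restrict (noise \<omega>) {..<n}) * ?d \<omega>) = 0"
      unfolding A_def
      by (rule innovation_orthogonal[OF \<pi> n \<phi> measurable_martingale[OF \<pi> n \<phi>] martingale_bound[OF \<phi> B]])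
    then have orth: "M.expectation (\<lambda>\<omega>. ?S \<omega> * ?d \<omega>) = 0"
      by (simp add: A_def martingale_restrict)
    have "(martingale \<phi> \<pi> (noise \<omega>) (Suc n))\<^sup>2 = (?S \<omega>)\<^sup>2 + (2 * (?S \<omega> * ?d \<omega>) + (?d \<omega>)\<^sup>2)" for \<omega>
      by (simp add: martingale_def power2_sum algebra_simps)
    then have "M.expectation (\<lambda>\<omega>. (martingale \<phi> \<pi> (noise \<omega>) (Suc n))\<^sup>2) =
        M.expectation (\<lambda>\<omega>. (?S \<omega>)\<^sup>2) + (2 * M.expectation (\<lambda>\<omega>. ?S \<omega> * ?d \<omega>) + M.expectation (\<lambda>\<omega>. (?d \<omega>)\<^sup>2))"
      using int[OF n] int_d2 int_Sd by simp
    also have "\<dots> \<le> real n * (4 * B)\<^sup>2 + (2 * 0 + (4 * B)\<^sup>2)"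
    proof -
      have "M.expectation (\<lambda>\<omega>. (?d \<omega>)\<^sup>2) \<le> M.expectation (\<lambda>\<omega>. (4 * B)\<^sup>2)"
        using int_d2 d2 by (intro integral_mono) auto
      then show ?thesis
        using Suc.IH[OF n] orth by (simp add: M.prob_space)
    qed
    finally show ?case
      by (simp add: algebra_simps)
  qed
qed

end

section \<open>Probability bounds for the cumulative drift\<close>

lemma step_index_eq:
  assumes "\<epsilon> > 0" "\<epsilon> * real t \<le> r" "r < \<epsilon> * (real t + 1)"
  shows "step_index \<epsilon> r = t"
proof -
  have "\<lfloor>r / \<epsilon>\<rfloor> = int t"
    using assms by (intro floor_unique) (auto simp: field_simps)
  then show ?thesis
    by (simp add: step_index_def)
qed

lemma step_index_bounds:
  assumes "\<epsilon> > 0" "0 \<le> r"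
  shows "\<epsilon> * real (step_index \<epsilon> r) \<le> r" "r < \<epsilon> * (real (step_index \<epsilon> r) + 1)"
proof -
  have "real (step_index \<epsilon> r) \<le> r / \<epsilon>" "r / \<epsilon> < real (step_index \<epsilon> r) + 1"
    unfolding step_index_def using assms by (auto intro: of_nat_floor)
  then show "\<epsilon> * real (step_index \<epsilon> r) \<le> r" "r < \<epsilon> * (real (step_index \<epsilon> r) + 1)"
    using \<open>\<epsilon> > 0\<close> by (simp_all add: pos_le_divide_eq pos_divide_less_eq mult.commute)
qed

lemma step_function_has_integral:
  fixes F :: "nat \<Rightarrow> real"
  assumes "\<epsilon> > 0"
  shows "((\<lambda>r. F (step_index \<epsilon> r)) has_integral \<epsilon> * (\<Sum>t<n. F t)) {0..\<epsilon> * real n}"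
proof (induction n)
  case 0
  then show ?case
    using has_integral_refl(2)[of _ "0::real"] by simp
next
  case (Suc n)
  have "((\<lambda>r. F n) has_integral \<epsilon> * F n) {\<epsilon> * real n..\<epsilon> * real (Suc n)}"
    using has_integral_const_real[of "F n" "\<epsilon> * real n" "\<epsilon> * real (Suc n)"] assms
    by (simp add: algebra_simps)
  \<comment> \<open>The right end point already belongs to the next sampling interval; a single
    point does not affect the integral.\<close>
  moreover have "F (step_index \<epsilon> r) = F n"
    if "r \<in> {\<epsilon> * real n..\<epsilon> * real (Suc n)} - {\<epsilon> * real (Suc n)}" for r
  proof -
    have "step_index \<epsilon> r = n"
      using that by (intro step_index_eq[OF assms]) (auto simp: algebra_simps)
    then show ?thesis
      by simp
  qed
  ultimately have "((\<lambda>r. F (step_index \<epsilon> r)) has_integral \<epsilon> * F n) {\<epsilon> * real n..\<epsilon> * real (Suc n)}"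
    by (intro has_integral_spike_finite[of "{\<epsilon> * real (Suc n)}" _ "\<lambda>r. F (step_index \<epsilon> r)" "\<lambda>r. F n"]) auto
  from Henstock_Kurzweil_Integration.has_integral_combine[OF _ _ Suc.IH this] assms show ?case
    by (simp add: algebra_simps)
qed

locale noisy_averaging = averaging f Y P g Z z0 C + noisy_system f Y P M \<sigma> y0
  for f :: "real ^ 'm \<Rightarrow> 'u::{metric_space, second_countable_topology} \<Rightarrow>
              's::{metric_space, second_countable_topology} \<Rightarrow> real ^ 'm"
    and Y and P :: "'s measure"
    and g :: "real ^ 'n \<Rightarrow> real ^ 'm \<Rightarrow> 'u \<Rightarrow> real ^ 'n" and Z z0 C
    and M :: "'w measure" and \<sigma> and y0
begin

text \<open>The Doob decomposition of \<open>\<phi>\<close> along the path, solved for its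
  compensator; the increments of \<open>\<phi>\<close> telescope.\<close>

lemma sum_drift_sample:
  "(\<Sum>t<n. drift f P \<phi> (sample f \<pi> y0 \<xi> t)) = \<phi> (state f \<pi> y0 \<xi> n) - \<phi> y0 - martingale \<phi> \<pi> \<xi> n"
  by (induction n) (auto simp: martingale_def innovation_def)

lemma cumulative_drift_step:
  assumes "\<epsilon> > 0"
  shows "cumulative_drift \<epsilon> (sample f \<pi> y0 \<xi>) \<alpha> (\<epsilon> * real n) =
    \<epsilon> * (monomial \<alpha> (state f \<pi> y0 \<xi> n) - monomial \<alpha> y0 - martingale (monomial \<alpha>) \<pi> \<xi> n)"
  unfolding cumulative_drift_def sum_drift_sample[symmetric]
  by (rule integral_unique[OF step_function_has_integral[OF assms]])

lemma cumulative_drift_lipschitz: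
  assumes "\<And>t. x t \<in> X" "\<And>y. y \<in> Y \<Longrightarrow> \<bar>monomial \<alpha> y\<bar> \<le> B" "0 \<le> a" "a \<le> b"
  shows "\<bar>cumulative_drift \<epsilon> x \<alpha> b - cumulative_drift \<epsilon> x \<alpha> a\<bar> \<le> 2 * B * (b - a)"
proof -
  let ?F = "\<lambda>r. drift f P (monomial \<alpha>) (x (step_index \<epsilon> r))"
  have int: "?F integrable_on {0..b}"
    using assms by (intro drift_integrable_on) auto
  have bound: "\<bar>?F r\<bar> \<le> 2 * B" for r
    by (intro drift_bound continuous_on_monomial assms)
  have "integral {0..a} ?F + integral {a..b} ?F = integral {0..b} ?F"
    by (rule Henstock_Kurzweil_Integration.integral_combine[OF assms(3,4) int])
  moreover have "norm (integral {a..b} ?F) \<le> 2 * B * measure lborel (cbox a b)"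
  proof (rule has_integral_bound)
    have "?F integrable_on {a..b}"
      using int assms by (rule_tac integrable_on_subinterval) auto
    then show "(?F has_integral integral {a..b} ?F) (cbox a b)"
      by (simp add: integrable_integral)
    show "0 \<le> 2 * B"
      using bound[of 0] by linarith
  qed (use bound in simp)
  ultimately show ?thesis
    using assms by (simp add: cumulative_drift_def)
qed

text \<open>The end point \<open>b\<close> is rounded down to a multiple of
  \<open>1 / real q\<close> and then to a sampling time, at cost
  \<open>2 * B * (1 / real q + \<epsilon>)\<close>. At a sampling time only the martingale and a
  telescoped term of size \<open>2 * B * \<epsilon>\<close> remain. Hence \<open>q + 1\<close> times
  control every \<open>b\<close>.\<close>

lemma cumulative_drift_small:
  assumes "\<epsilon> > 0" "q > 0" and B: "\<And>y. y \<in> Y \<Longrightarrow> \<bar>monomial \<alpha> y\<bar> \<le> B"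
    and c: "\<And>i. i \<le> q \<Longrightarrow> \<bar>\<epsilon> * martingale (monomial \<alpha>) \<pi> \<xi> (step_index \<epsilon> (real i / real q))\<bar> \<le> c"
    and b: "b \<in> {0..1}"
  shows "\<bar>cumulative_drift \<epsilon> (sample f \<pi> y0 \<xi>) \<alpha> b\<bar> \<le> c + 2 * B * \<epsilon> + 2 * B * (1 / real q + \<epsilon>)"
proof -
  define i where "i = nat \<lfloor>b * real q\<rfloor>"
  have i: "real i \<le> b * real q" "b * real q < real i + 1"
    using b by (auto simp: i_def)
  have "real i \<le> real q"
    using i(1) b mult_left_le_one_le[of "real q" b] by simp
  then have "i \<le> q" by simp
  define n where "n = step_index \<epsilon> (real i / real q)"
  have n: "\<epsilon> * real n \<le> real i / real q" "real i / real q < \<epsilon> * real n + \<epsilon>"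
    using step_index_bounds[OF \<open>\<epsilon> > 0\<close>, of "real i / real q"] by (simp_all add: n_def distrib_left)
  have iq: "real i / real q \<le> b" "b < real i / real q + 1 / real q"
    using i \<open>q > 0\<close> by (auto simp: field_simps)
  have "0 \<le> B"
    using B[OF y0] by linarith
  have "\<bar>cumulative_drift \<epsilon> (sample f \<pi> y0 \<xi>) \<alpha> b - cumulative_drift \<epsilon> (sample f \<pi> y0 \<xi>) \<alpha> (\<epsilon> * real n)\<bar>
      \<le> 2 * B * (b - \<epsilon> * real n)"
    using \<open>\<epsilon> > 0\<close> n iq by (intro cumulative_drift_lipschitz sample_in_X y0 B) auto
  also have "\<dots> \<le> 2 * B * (1 / real q + \<epsilon>)"
    using n iq \<open>0 \<le> B\<close> by (intro mult_left_mono) auto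
  finally have 1: "\<bar>cumulative_drift \<epsilon> (sample f \<pi> y0 \<xi>) \<alpha> b - cumulative_drift \<epsilon> (sample f \<pi> y0 \<xi>) \<alpha> (\<epsilon> * real n)\<bar>
      \<le> 2 * B * (1 / real q + \<epsilon>)" .
  have "\<bar>monomial \<alpha> (state f \<pi> y0 \<xi> n) - monomial \<alpha> y0\<bar> \<le> 2 * B"
    using B[OF y0] B[OF state_in_Y[OF y0, of \<pi> \<xi> n]] by linarith
  then have "\<bar>\<epsilon> * (monomial \<alpha> (state f \<pi> y0 \<xi> n) - monomial \<alpha> y0)\<bar> \<le> \<epsilon> * (2 * B)"
    using \<open>\<epsilon> > 0\<close> by (simp add: abs_mult)
  moreover have "\<bar>\<epsilon> * martingale (monomial \<alpha>) \<pi> \<xi> n\<bar> \<le> c"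
    unfolding n_def by (rule c[OF \<open>i \<le> q\<close>])
  moreover have "cumulative_drift \<epsilon> (sample f \<pi> y0 \<xi>) \<alpha> (\<epsilon> * real n) =
      \<epsilon> * (monomial \<alpha> (state f \<pi> y0 \<xi> n) - monomial \<alpha> y0) - \<epsilon> * martingale (monomial \<alpha>) \<pi> \<xi> n"
    unfolding cumulative_drift_step[OF \<open>\<epsilon> > 0\<close>] by (simp add: algebra_simps)
  ultimately have "\<bar>cumulative_drift \<epsilon> (sample f \<pi> y0 \<xi>) \<alpha> (\<epsilon> * real n)\<bar> \<le> c + 2 * B * \<epsilon>"
    by (simp add: mult.commute mult.left_commute)
  with 1 show ?thesis by linarith
qed

text \<open>Chebyshev's inequality. At most \<open>1 / \<epsilon>\<close> innovations have occurred,
  so the second moment is of order \<open>1 / \<epsilon>\<close>, while the squared threshold is of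
  order \<open>1 / \<epsilon>^2\<close>.\<close>

lemma martingale_tail:
  assumes \<pi>: "\<pi> \<in> control_plans \<epsilon>" and "\<epsilon> > 0" "c > 0"
    and \<phi>: "continuous_on UNIV \<phi>" and B: "\<And>y. y \<in> Y \<Longrightarrow> \<bar>\<phi> y\<bar> \<le> B" and s: "s \<le> 1" "0 \<le> s"
  shows "M.prob {\<omega> \<in> space M. c / \<epsilon> \<le> \<bar>martingale \<phi> \<pi> (noise \<omega>) (step_index \<epsilon> s)\<bar>} \<le> \<epsilon> * (4 * B)\<^sup>2 / c\<^sup>2"
    "{\<omega> \<in> space M. c / \<epsilon> \<le> \<bar>martingale \<phi> \<pi> (noise \<omega>) (step_index \<epsilon> s)\<bar>} \<in> sets M"
proof -
  define n where "n = step_index \<epsilon> s"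
  have n: "n \<le> nat \<lfloor>1 / \<epsilon>\<rfloor>"
    unfolding n_def step_index_def using s \<open>\<epsilon> > 0\<close> by (intro nat_mono floor_mono divide_right_mono) auto
  have n\<epsilon>: "\<epsilon> * real n \<le> 1"
    using step_index_bounds(1)[OF \<open>\<epsilon> > 0\<close> s(2)] s(1) by (simp add: n_def)
  have meas: "(\<lambda>\<omega>. martingale \<phi> \<pi> (noise \<omega>) n) \<in> borel_measurable M"
    by (rule measurable_martingale_noise[OF \<pi> n \<phi>])
  then show "{\<omega> \<in> space M. c / \<epsilon> \<le> \<bar>martingale \<phi> \<pi> (noise \<omega>) (step_index \<epsilon> s)\<bar>} \<in> sets M"
    unfolding n_def by measurable
  have "M.prob {\<omega> \<in> space M. c / \<epsilon> \<le> \<bar>martingale \<phi> \<pi> (noise \<omega>) n\<bar>} \<le>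
      M.expectation (\<lambda>\<omega>. (martingale \<phi> \<pi> (noise \<omega>) n)\<^sup>2) / (c / \<epsilon>)\<^sup>2"
    using martingale_second_moment(1)[OF \<pi> \<phi> B n] meas \<open>\<epsilon> > 0\<close> \<open>c > 0\<close>
    by (intro M.second_moment_method) auto
  also have "\<dots> \<le> real n * (4 * B)\<^sup>2 / (c / \<epsilon>)\<^sup>2"
    using martingale_second_moment(2)[OF \<pi> \<phi> B n] by (intro divide_right_mono) auto
  also have "\<dots> = (\<epsilon> * real n) * (\<epsilon> * (4 * B)\<^sup>2 / c\<^sup>2)"
    using \<open>\<epsilon> > 0\<close> by (simp add: power2_eq_square)
  also have "\<dots> \<le> 1 * (\<epsilon> * (4 * B)\<^sup>2 / c\<^sup>2)"
    using n\<epsilon> \<open>\<epsilon> > 0\<close> by (intro mult_right_mono) auto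
  finally show "M.prob {\<omega> \<in> space M. c / \<epsilon> \<le> \<bar>martingale \<phi> \<pi> (noise \<omega>) (step_index \<epsilon> s)\<bar>} \<le> \<epsilon> * (4 * B)\<^sup>2 / c\<^sup>2"
    by (simp add: n_def)
qed

text \<open>The number of grid times is fixed before \<open>\<epsilon>\<close>, so a union bound
  over the grid replaces a maximal inequality. The tail bounds involve the plan nowhere, and one
  threshold for \<open>\<epsilon>\<close> serves all plans.\<close>

lemma small_drift_with_high_probability:
  assumes "\<eta> > 0"
  shows "\<forall>\<^sub>F \<epsilon> in at_right 0. \<forall>\<pi>\<in>control_plans \<epsilon>. \<exists>G\<in>sets M. 1 - \<eta> \<le> M.prob G \<and>
    (\<forall>\<omega>\<in>G. \<forall>j<k. \<forall>b\<in>{0..1}. \<bar>cumulative_drift \<epsilon> (sample f \<pi> y0 (noise \<omega>)) (from_nat j) b\<bar> \<le> 1 / real k)"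
proof (cases "k = 0")
  case True
  with assms show ?thesis
    by (intro always_eventually allI ballI bexI[of _ "space M"]) (auto simp: M.prob_space)
next
  case False
  have "\<exists>B. \<forall>y\<in>Y. \<bar>monomial \<alpha> y\<bar> \<le> B" for \<alpha> :: "'m \<Rightarrow> nat"
    using compact_imp_bounded[OF compact_continuous_image[OF continuous_on_monomial compact_Y]]
    unfolding bounded_iff by auto
  then obtain B' where B': "\<And>\<alpha> y. y \<in> Y \<Longrightarrow> \<bar>monomial (\<alpha> :: 'm \<Rightarrow> nat) y\<bar> \<le> B' \<alpha>"
    by metis
  have B'0: "0 \<le> B' \<alpha>" for \<alpha>
    using B'[OF y0, of \<alpha>] by linarith
  \<comment> \<open>The summand 1 keeps \<open>B\<close> positive for the divisions below.\<close>
  define B where "B = 1 + (\<Sum>j<k. B' (from_nat j))"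
  have "B \<ge> 1"
    unfolding B_def using B'0 by (simp add: sum_nonneg)
  have B: "\<bar>monomial (from_nat j) y\<bar> \<le> B" if "j < k" "y \<in> Y" for j y
  proof -
    have "B' (from_nat j) \<le> (\<Sum>j<k. B' (from_nat j))"
      using that B'0 by (intro member_le_sum) auto
    then show ?thesis
      using B'[OF that(2), of "from_nat j"] by (simp add: B_def)
  qed
  \<comment> \<open>Chosen so that the rounding error \<open>2 * B * (1 / real q)\<close> is at most
    a quarter of the tolerance \<open>1 / real k\<close>.\<close>
  define q where "q = nat \<lceil>8 * B * real k\<rceil>"
  have q: "8 * B * real k \<le> real q"
    unfolding q_def by linarith
  have "0 < 8 * B * real k"
    using \<open>B \<ge> 1\<close> False by simp
  then have "q > 0"
    using q by (metis less_le_trans of_nat_0_less_iff)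
  \<comment> \<open>A quarter of the tolerance; the martingale, the terms of order
    \<open>\<epsilon>\<close> and the rounding to the grid each use at most one such share.\<close>
  define c where "c = 1 / (4 * real k)"
  have "c > 0"
    using False by (simp add: c_def)
  have Bq: "2 * B * (1 / real q) \<le> c"
    using q \<open>q > 0\<close> False by (simp add: c_def field_simps)
  \<comment> \<open>The union bound over \<open>k\<close> monomials and \<open>Suc q\<close> grid
    times is \<open>\<epsilon> * K\<close>.\<close>
  define K where "K = real k * (real (Suc q) * ((4 * B)\<^sup>2 / c\<^sup>2))"
  have "K > 0"
    using False \<open>B \<ge> 1\<close> \<open>c > 0\<close> by (simp add: K_def)
  \<comment> \<open>The first entry brings \<open>4 * B * \<epsilon>\<close> below \<open>c\<close>,
    the second brings the exceptional probability below \<open>\<eta>\<close>.\<close>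
  define \<epsilon>0 where "\<epsilon>0 = min (c / (4 * B)) (\<eta> / K)"
  have "\<epsilon>0 > 0"
    using \<open>c > 0\<close> \<open>B \<ge> 1\<close> \<open>\<eta> > 0\<close> \<open>K > 0\<close> by (simp add: \<epsilon>0_def)
  have "\<exists>G\<in>sets M. 1 - \<eta> \<le> M.prob G \<and>
    (\<forall>\<omega>\<in>G. \<forall>j<k. \<forall>b\<in>{0..1}. \<bar>cumulative_drift \<epsilon> (sample f \<pi> y0 (noise \<omega>)) (from_nat j) b\<bar> \<le> 1 / real k)"
    if \<epsilon>: "0 < \<epsilon>" "\<epsilon> < \<epsilon>0" and \<pi>: "\<pi> \<in> control_plans \<epsilon>" for \<epsilon> \<pi>
  proof -
    define E where "E j i = {\<omega> \<in> space M. c / \<epsilon> \<le> \<bar>martingale (monomial (from_nat j)) \<pi> (noise \<omega>)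
        (step_index \<epsilon> (real i / real q))\<bar>}" for j i
    have E: "M.prob (E j i) \<le> \<epsilon> * (4 * B)\<^sup>2 / c\<^sup>2" "E j i \<in> sets M" if "j < k" "i \<le> q" for j i
    proof -
      have i: "real i / real q \<le> 1" "0 \<le> real i / real q"
        using that by (auto simp: divide_le_eq)
      show "M.prob (E j i) \<le> \<epsilon> * (4 * B)\<^sup>2 / c\<^sup>2" "E j i \<in> sets M"
        unfolding E_def
        using martingale_tail[OF \<pi> \<epsilon>(1) \<open>c > 0\<close> continuous_on_monomial B[OF \<open>j < k\<close>] i] by auto
    qed
    define G where "G = space M - (\<Union>(j, i)\<in>{..<k} \<times> {..q}. E j i)"
    have U: "(\<Union>(j, i)\<in>{..<k} \<times> {..q}. E j i) \<in> sets M"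
      using E(2) by (intro sets.finite_UN) auto
    have "M.prob (\<Union>(j, i)\<in>{..<k} \<times> {..q}. E j i) \<le> (\<Sum>p\<in>{..<k} \<times> {..q}. M.prob (case p of (j, i) \<Rightarrow> E j i))"
      using E(2) by (intro M.finite_measure_subadditive_finite) auto
    also have "\<dots> \<le> (\<Sum>p\<in>{..<k} \<times> {..q}. \<epsilon> * (4 * B)\<^sup>2 / c\<^sup>2)"
      using E(1) by (intro sum_mono) auto
    also have "\<dots> = \<epsilon> * K"
      by (simp add: K_def algebra_simps)
    also have "\<dots> \<le> \<eta>"
      using \<epsilon>(2) \<open>K > 0\<close> by (simp add: \<epsilon>0_def field_simps)
    finally have "1 - \<eta> \<le> M.prob G"
      unfolding G_def M.prob_compl[OF U] by simp
    moreover have "G \<in> sets M"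
      unfolding G_def using U by auto
    moreover have "\<bar>cumulative_drift \<epsilon> (sample f \<pi> y0 (noise \<omega>)) (from_nat j) b\<bar> \<le> 1 / real k"
      if \<omega>: "\<omega> \<in> G" and j: "j < k" and b: "b \<in> {0..1}" for \<omega> j b
    proof -
      have "\<bar>\<epsilon> * martingale (monomial (from_nat j)) \<pi> (noise \<omega>) (step_index \<epsilon> (real i / real q))\<bar> \<le> c"
        if "i \<le> q" for i
      proof -
        have "\<omega> \<notin> E j i" "\<omega> \<in> space M"
          using \<omega> j that by (auto simp: G_def)
        then have "\<bar>martingale (monomial (from_nat j)) \<pi> (noise \<omega>) (step_index \<epsilon> (real i / real q))\<bar> < c / \<epsilon>"
          by (simp add: E_def)
        then show ?thesis
          using \<epsilon>(1) by (simp add: abs_mult field_simps)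
      qed
      then have "\<bar>cumulative_drift \<epsilon> (sample f \<pi> y0 (noise \<omega>)) (from_nat j) b\<bar> \<le>
          c + 2 * B * \<epsilon> + 2 * B * (1 / real q + \<epsilon>)"
        using B[OF j] b by (intro cumulative_drift_small[OF \<epsilon>(1) \<open>q > 0\<close>]) auto
      also have "\<dots> = c + 4 * B * \<epsilon> + 2 * B * (1 / real q)"
        by (simp add: algebra_simps)
      also have "\<dots> \<le> c + c + c"
        using Bq \<epsilon>(2) \<open>B \<ge> 1\<close> by (intro add_mono) (auto simp: \<epsilon>0_def field_simps)
      also have "\<dots> \<le> 1 / real k"
        using False by (simp add: c_def field_simps)
      finally show ?thesis .
    qed
    ultimately show ?thesis by blast
  qed
  then show ?thesis
    unfolding eventually_at_right_field using \<open>\<epsilon>0 > 0\<close> by (intro exI[of _ \<epsilon>0]) auto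
qed

end

section \<open>Measurability of trajectories\<close>

text \<open>\<open>Z\<close> need not be convex, so a nearest point need not be unique. The first
  member of a countable dense subset within twice the distance to \<open>Z\<close> is a measurable
  choice. The triangle inequality adds the distance to \<open>z\<close> once more, which gives the
  constant 3.\<close>

lemma measurable_near_retraction:
  fixes Z :: "'a::euclidean_space set"
  assumes "closed Z" "Z \<noteq> {}"
  obtains \<rho> where "\<rho> \<in> borel \<rightarrow>\<^sub>M borel" "\<And>p. \<rho> p \<in> Z" "\<And>p z. z \<in> Z \<Longrightarrow> dist (\<rho> p) z \<le> 3 * dist p z"
proof -
  obtain D where D: "countable D" "D \<subseteq> Z" "Z \<subseteq> closure D"
    using separable[of Z] by metis
  have "D \<noteq> {}"
    using D assms by auto
  define d where "d = from_nat_into D"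
  have dZ: "d i \<in> Z" for i
    using from_nat_into[OF \<open>D \<noteq> {}\<close>] D by (auto simp: d_def)
  define \<rho> where "\<rho> p = (if p \<in> Z then p else d (LEAST i. dist p (d i) < 2 * infdist p Z))" for p
  have near: "dist p (\<rho> p) \<le> 2 * infdist p Z" for p
  proof (cases "p \<in> Z")
    case False
    then have pos: "0 < infdist p Z"
      using infdist_pos_not_in_closed[OF assms] by simp
    obtain z where z: "z \<in> Z" "infdist p Z = dist p z"
      using infdist_attains_inf[OF assms] by blast
    obtain e where e: "e \<in> D" "dist e z < infdist p Z"
      using D(3) z pos closure_approachable by blast
    then obtain i where "d i = e"
      using from_nat_into_surj[OF D(1)] by (auto simp: d_def)
    then have "dist p (d i) < 2 * infdist p Z"
      using e z dist_triangle[of p e z] by (simp add: dist_commute)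
    then show ?thesis
      using False LeastI[of "\<lambda>i. dist p (d i) < 2 * infdist p Z"] by (simp add: \<rho>_def less_imp_le)
  qed (simp add: \<rho>_def)
  show thesis
  proof
    have idx: "(\<lambda>p. LEAST i. dist p (d i) < 2 * infdist p Z) \<in> borel \<rightarrow>\<^sub>M count_space UNIV"
      by (intro measurable_Least borel_measurable_pred_less borel_measurable_continuous_onI continuous_intros)
    have "(\<lambda>p. d (LEAST i. dist p (d i) < 2 * infdist p Z)) \<in> borel \<rightarrow>\<^sub>M borel"
      by (rule measurable_compose[OF idx]) simp
    then show "\<rho> \<in> borel \<rightarrow>\<^sub>M borel"
      unfolding \<rho>_def using assms by (intro measurable_If_set) auto
    show "\<rho> p \<in> Z" for p
      using dZ by (simp add: \<rho>_def)
    show "dist (\<rho> p) z \<le> 3 * dist p z" if "z \<in> Z" for p z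
      using near[of p] infdist_le[OF that, of p] dist_triangle[of "\<rho> p" z p] by (simp add: dist_commute)
  qed
qed

context averaging
begin

text \<open>The trajectory is the limit of Picard iterates whose argument is first sent into \<open>Z\<close>. That map
  need not be continuous: since the trajectory itself stays in \<open>Z\<close>, the error still contracts.\<close>

lemma measurable_trajectory:
  fixes N :: "'w measure" and x :: "'w \<Rightarrow> nat \<Rightarrow> (real ^ 'm) \<times> 'u" and \<zeta> :: "'w \<Rightarrow> real \<Rightarrow> real ^ 'n"
  assumes "\<epsilon> > 0" and x: "\<And>t. t \<le> nat \<lfloor>1 / \<epsilon>\<rfloor> \<Longrightarrow> (\<lambda>\<omega>. x \<omega> t) \<in> N \<rightarrow>\<^sub>M borel"
    and tr: "\<And>\<omega>. \<omega> \<in> space N \<Longrightarrow> trajectory \<epsilon> (x \<omega>) (\<zeta> \<omega>)"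
    and s: "s \<in> {0..1}"
  shows "(\<lambda>\<omega>. \<zeta> \<omega> s) \<in> borel_measurable N"
\<comment> \<open>One trajectory is enough to show that \<open>Z\<close> is nonempty, as the near
  retraction requires.\<close>
proof (cases "space N = {}")
  case True
  then show ?thesis
    by (simp add: measurable_def)
next
  case False
  then have "Z \<noteq> {}"
    using trajectory_in_Z[OF tr s] by blast
  then obtain \<rho> where \<rho>_meas: "\<rho> \<in> borel \<rightarrow>\<^sub>M borel" and \<rho>Z: "\<And>p. \<rho> p \<in> Z"
    and \<rho>: "\<And>p z. z \<in> Z \<Longrightarrow> dist (\<rho> p) z \<le> 3 * dist p z"
    using measurable_near_retraction[OF compact_imp_closed[OF compact_Z]] by blast
  define T where "T = nat \<lfloor>1 / \<epsilon>\<rfloor>"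
  define v where "v = (\<lambda>q. if q \<in> UNIV \<times> X then (\<lambda>(z, y, u). g z y u) q else 0)"
  have v_meas: "v \<in> borel_measurable borel"
    unfolding v_def
    by (intro borel_measurable_continuous_on_if cont_g continuous_on_const borel_closed
        closed_Times closed_UNIV closed_Y)
  have v_eq: "v (z, p) = vel z p" if "p \<in> X" for z p
    using that by (auto simp: v_def vel_def)
  \<comment> \<open>Samples are known to be measurable only up to time \<open>T\<close>. Capping the
    index gives joint measurability for all \<open>r\<close> and changes nothing for
    \<open>r \<le> 1\<close>.\<close>
  define y where "y \<omega> r = x \<omega> (min (step_index \<epsilon> r) T)" for \<omega> r
  have y_meas: "(\<lambda>q. y (fst q) (snd q)) \<in> N \<Otimes>\<^sub>M borel \<rightarrow>\<^sub>M borel"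
    unfolding y_def
  proof (rule measurable_compose_countable[where f="\<lambda>i q. x (fst q) (min i T)"])
    show "(\<lambda>q. x (fst q) (min i T)) \<in> N \<Otimes>\<^sub>M borel \<rightarrow>\<^sub>M borel" for i
      using measurable_compose[OF measurable_fst x[of "min i T"]] by (simp add: T_def)
    show "(\<lambda>q. step_index \<epsilon> (snd q)) \<in> N \<Otimes>\<^sub>M borel \<rightarrow>\<^sub>M count_space UNIV"
      by (rule measurable_compose[OF measurable_snd measurable_step_index])
  qed
  have y_eq: "y \<omega> r = x \<omega> (step_index \<epsilon> r)" if "r \<le> 1" for \<omega> r
  proof -
    have "step_index \<epsilon> r \<le> T"
      unfolding step_index_def T_def using that \<open>\<epsilon> > 0\<close> by (intro nat_mono floor_mono divide_right_mono) auto
    then show ?thesis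
      by (simp add: y_def min_def)
  qed
  define p where "p = rec_nat (\<lambda>\<omega> s. z0) (\<lambda>_ p \<omega> s. z0 + (\<integral>r. (if 0 \<le> r \<and> r \<le> s then v (\<rho> (p \<omega> r), y \<omega> r) else 0) \<partial>lborel))"
  have p_0: "p 0 \<omega> s = z0" for \<omega> s
    by (simp add: p_def)
  have p_Suc: "p (Suc n) \<omega> s = z0 + (\<integral>r. (if 0 \<le> r \<and> r \<le> s then v (\<rho> (p n \<omega> r), y \<omega> r) else 0) \<partial>lborel)" for n \<omega> s
    unfolding p_def by simp
  \<comment> \<open>Joint measurability in the realization and time is carried along because the
    next iterate integrates over time with the realization as a parameter.\<close>
  have p_meas: "(\<lambda>q. p n (fst q) (snd q)) \<in> N \<Otimes>\<^sub>M borel \<rightarrow>\<^sub>M borel" for n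
  proof (induction n)
    case 0
    then show ?case by (simp add: p_0)
  next
    case (Suc n)
    have sel: "(\<lambda>q. (fst (fst q), snd q)) \<in> (N \<Otimes>\<^sub>M (borel :: real measure)) \<Otimes>\<^sub>M (lborel :: real measure) \<rightarrow>\<^sub>M N \<Otimes>\<^sub>M borel"
      by (intro measurable_Pair measurable_compose[OF measurable_fst measurable_fst]) simp_all
    have 1: "(\<lambda>q. \<rho> (p n (fst (fst q)) (snd q))) \<in> borel_measurable ((N \<Otimes>\<^sub>M (borel :: real measure)) \<Otimes>\<^sub>M lborel)"
      using measurable_compose[OF measurable_compose[OF sel Suc.IH] \<rho>_meas] by simp
    have 2: "(\<lambda>q. y (fst (fst q)) (snd q)) \<in> borel_measurable ((N \<Otimes>\<^sub>M (borel :: real measure)) \<Otimes>\<^sub>M lborel)"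
      using measurable_compose[OF sel y_meas] by simp
    have 3: "(\<lambda>q. v (\<rho> (p n (fst (fst q)) (snd q)), y (fst (fst q)) (snd q))) \<in> borel_measurable ((N \<Otimes>\<^sub>M (borel :: real measure)) \<Otimes>\<^sub>M lborel)"
      using measurable_compose[OF borel_measurable_Pair[OF 1 2] v_meas] by simp
    have 4: "Measurable.pred ((N \<Otimes>\<^sub>M (borel :: real measure)) \<Otimes>\<^sub>M lborel) (\<lambda>q. 0 \<le> snd q \<and> snd q \<le> snd (fst q))"
      by measurable
    have "case_prod (\<lambda>q r. if 0 \<le> r \<and> r \<le> snd q then v (\<rho> (p n (fst q) r), y (fst q) r) else 0)
        \<in> borel_measurable ((N \<Otimes>\<^sub>M (borel :: real measure)) \<Otimes>\<^sub>M lborel)"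
      unfolding split_beta by (rule measurable_If[OF 3 _ 4[unfolded pred_def]]) simp
    then have "(\<lambda>q. \<integral>r. (if 0 \<le> r \<and> r \<le> snd q then v (\<rho> (p n (fst q) r), y (fst q) r) else 0) \<partial>lborel)
        \<in> borel_measurable (N \<Otimes>\<^sub>M borel)"
      by (rule lborel.borel_measurable_lebesgue_integral)
    then show ?case
      unfolding p_Suc by (intro borel_measurable_add) auto
  qed
  have conv: "(\<lambda>n. p n \<omega> s) \<longlonglongrightarrow> \<zeta> \<omega> s" if \<omega>: "\<omega> \<in> space N" for \<omega>
  proof -
    note tr\<omega> = tr[OF \<omega>]
    have yX: "y \<omega> r \<in> X" for r
      unfolding y_def by (rule trajectory_in_X[OF tr\<omega>])
    \<comment> \<open>In the norm weighted by \<open>exp (a * s)\<close> one iteration multiplies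
      the error by \<open>3 * C / a\<close>, that is by one half; the 3 is the price of the near
      retraction.\<close>
    define a where "a = 6 * C"
    have "a > 0"
      using C_pos by (simp add: a_def)
    have integral_p: "((\<lambda>r. vel (\<rho> (p n \<omega> r)) (y \<omega> r)) has_integral p (Suc n) \<omega> s - z0) {0..s}" for n s
    proof -
      let ?f = "\<lambda>r. if r \<in> {0..s} then vel (\<rho> (p n \<omega> r)) (y \<omega> r) else 0"
      have "(\<lambda>r. p n \<omega> r) \<in> borel_measurable borel" "(\<lambda>r. y \<omega> r) \<in> borel \<rightarrow>\<^sub>M borel"
        using measurable_compose[OF measurable_Pair1'[OF \<omega>] p_meas] measurable_compose[OF measurable_Pair1'[OF \<omega>] y_meas]
        by simp_all
      then have "(\<lambda>r. v (\<rho> (p n \<omega> r), y \<omega> r)) \<in> borel_measurable borel"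
        by (intro measurable_compose[OF borel_measurable_Pair v_meas] measurable_compose[OF _ \<rho>_meas])
      then have meas: "?f \<in> borel_measurable lborel"
        using yX by (simp add: v_eq)
      have "integrable lborel ?f"
      proof (rule Bochner_Integration.integrable_bound)
        show "integrable lborel (\<lambda>r. indicator {0..s} r * speed)"
          by (intro integrable_mult_left integrable_real_indicator) (auto simp: emeasure_lborel_Icc_eq)
        show "AE r in lborel. norm (?f r) \<le> norm (indicator {0..s} r * speed)"
          using speed \<rho>Z yX by (intro AE_I2) (auto split: split_indicator)
      qed (rule meas)
      from has_integral_integral_lborel[OF this]
      have "((\<lambda>r. vel (\<rho> (p n \<omega> r)) (y \<omega> r)) has_integral (\<integral>r. ?f r \<partial>lborel)) {0..s}"
        by (simp only: has_integral_restrict_UNIV)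
      moreover have "(\<integral>r. ?f r \<partial>lborel) = p (Suc n) \<omega> s - z0"
        unfolding p_Suc v_eq[OF yX] by simp
      ultimately show ?thesis by simp
    qed
    have err: "norm (p n \<omega> s - \<zeta> \<omega> s) \<le> speed * exp (a * s) / 2 ^ n" if "s \<in> {0..1}" for n s
      using that
    proof (induction n arbitrary: s)
      case 0
      have "norm (z0 - \<zeta> \<omega> s) \<le> speed * \<bar>0 - s\<bar>"
        using lipschitz_onD[OF trajectory_lipschitz[OF tr\<omega>], of 0 s] 0 tr\<omega>
        by (simp add: dist_norm trajectory_def)
      also have "\<dots> \<le> speed * exp (a * s)"
        using 0 speed(1) exp_ge_add_one_self[of "a * s"] \<open>a > 0\<close>
        by (intro mult_left_mono) (auto intro: order_trans[OF _ one_le_exp_iff[THEN iffD2]])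
      finally show ?case
        by (simp add: p_0)
    next
      case (Suc n)
      let ?h = "\<lambda>r. vel (\<rho> (p n \<omega> r)) (y \<omega> r) - vel (\<zeta> \<omega> r) (y \<omega> r)"
      let ?b = "\<lambda>r. 3 * C * (speed * exp (a * r) / 2 ^ n)"
      have "((\<lambda>r. vel (\<zeta> \<omega> r) (y \<omega> r)) has_integral \<zeta> \<omega> s - \<zeta> \<omega> 0) {0..s}"
        using trajectory_has_integral[OF tr\<omega>, of 0 s] Suc.prems
        by (rule_tac has_integral_eq[rotated]) (auto simp: y_eq)
      from has_integral_diff[OF integral_p[of n s] this]
      have h: "(?h has_integral p (Suc n) \<omega> s - \<zeta> \<omega> s) {0..s}"
        using tr\<omega> by (simp add: trajectory_def)
      have b: "(?b has_integral speed * exp (a * s) / 2 ^ Suc n - speed * exp (a * 0) / 2 ^ Suc n) {0..s}"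
      proof (rule fundamental_theorem_of_calculus)
        fix r
        have "((\<lambda>r. speed * exp (a * r) / 2 ^ Suc n) has_real_derivative speed * (exp (a * r) * a) / 2 ^ Suc n) (at r within {0..s})"
          by (auto intro!: derivative_eq_intros)
        moreover have "speed * (exp (a * r) * a) / 2 ^ Suc n = ?b r"
          by (simp add: a_def)
        ultimately show "((\<lambda>r. speed * exp (a * r) / 2 ^ Suc n) has_vector_derivative ?b r) (at r within {0..s})"
          by (simp add: has_real_derivative_iff_has_vector_derivative)
      qed (use Suc.prems in simp)
      have "norm (?h r) \<le> ?b r" if "r \<in> {0..s}" for r
      proof -
        have r: "r \<in> {0..1}"
          using that Suc.prems by auto
        have \<zeta>Z: "\<zeta> \<omega> r \<in> Z"
          by (rule trajectory_in_Z[OF tr\<omega> r])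
        have "norm (?h r) \<le> C * norm (\<rho> (p n \<omega> r) - \<zeta> \<omega> r)"
          by (intro vel_lipschitz \<rho>Z \<zeta>Z yX)
        also have "\<dots> \<le> C * (3 * norm (p n \<omega> r - \<zeta> \<omega> r))"
          using \<rho>[OF \<zeta>Z, of "p n \<omega> r"] C_pos by (intro mult_left_mono) (auto simp: dist_norm)
        also have "\<dots> \<le> C * (3 * (speed * exp (a * r) / 2 ^ n))"
          using Suc.IH[OF r] C_pos by (intro mult_left_mono) auto
        finally show ?thesis by (simp add: ac_simps)
      qed
      then have "norm (integral {0..s} ?h) \<le> integral {0..s} ?b"
        using h b by (intro integral_norm_bound_integral) auto
      then have "norm (p (Suc n) \<omega> s - \<zeta> \<omega> s) \<le> speed * exp (a * s) / 2 ^ Suc n - speed * exp (a * 0) / 2 ^ Suc n"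
        using integral_unique[OF h] integral_unique[OF b] by simp
      also have "\<dots> \<le> speed * exp (a * s) / 2 ^ Suc n"
        using speed(1) by simp
      finally show ?case .
    qed
    have "(\<lambda>n. speed * exp (a * s) / 2 ^ n) \<longlonglongrightarrow> 0"
      by (intro LIMSEQ_divide_realpow_zero) simp
    then have "(\<lambda>n. p n \<omega> s - \<zeta> \<omega> s) \<longlonglongrightarrow> 0"
      by (rule Lim_null_comparison[rotated]) (intro always_eventually allI err s)
    then show ?thesis
      by (simp add: LIM_zero_iff)
  qed
  have "(\<lambda>\<omega>. p n \<omega> s) \<in> borel_measurable N" for n
  proof -
    have "(\<lambda>\<omega>. (\<omega>, s)) \<in> N \<rightarrow>\<^sub>M N \<Otimes>\<^sub>M borel"
      by (intro measurable_Pair) auto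
    from measurable_compose[OF this p_meas] show ?thesis by simp
  qed
  then show ?thesis
    using conv by (rule borel_measurable_LIMSEQ_metric)
qed

end

section \<open>Approximation by averaged solutions\<close>

lemma lipschitz_close_on_grid:
  fixes w w' :: "real \<Rightarrow> 'a::real_normed_vector"
  assumes lip: "L-lipschitz_on {0..1} w" "L-lipschitz_on {0..1} w'" and "q > 0"
    and grid: "\<And>i. i \<le> q \<Longrightarrow> norm (w (real i / real q) - w' (real i / real q)) \<le> a"
    and s: "s \<in> {0..1}"
  shows "norm (w s - w' s) \<le> a + 2 * (L / real q)"
proof -
  have "L \<ge> 0"
    using lip lipschitz_on_nonneg by blast
  define i where "i = nat \<lfloor>s * real q\<rfloor>"
  have i: "real i \<le> s * real q" "s * real q < real i + 1"
    using s by (auto simp: i_def)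
  have "real i \<le> real q"
    using i(1) s mult_left_le_one_le[of "real q" s] by simp
  then have "i \<le> q" by simp
  define t where "t = real i / real q"
  have "t \<le> s" "s < t + 1 / real q"
    using i \<open>q > 0\<close> by (simp_all add: t_def pos_divide_le_eq pos_less_divide_eq flip: add_divide_distrib)
  then have t: "t \<in> {0..1}" "\<bar>s - t\<bar> \<le> 1 / real q"
    using s by (auto simp: t_def)
  have "L * \<bar>s - t\<bar> \<le> L / real q"
    using mult_left_mono[OF t(2) \<open>L \<ge> 0\<close>] by simp
  then have "norm (w s - w t) \<le> L / real q" "norm (w' s - w' t) \<le> L / real q"
    using lipschitz_onD[OF lip(1) s t(1)] lipschitz_onD[OF lip(2) s t(1)] by (auto simp: dist_norm)
  moreover have "norm (w t - w' t) \<le> a"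
    unfolding t_def by (rule grid[OF \<open>i \<le> q\<close>])
  moreover have "w s - w' s = (w s - w t) + (w t - w' t) - (w' s - w' t)"
    by simp
  ultimately show ?thesis
    using norm_triangle_ineq4[of "(w s - w t) + (w t - w' t)" "w' s - w' t"]
      norm_triangle_ineq[of "w s - w t" "w t - w' t"] by simp
qed

text \<open>A curve is labelled by net points near its values at the grid times, and there are
  finitely many labels. Curves with equal labels are within \<open>d / 2\<close> on the grid and, by
  the Lipschitz bound, within \<open>d\<close> everywhere. Representatives come from
  \<open>K\<close> itself, so the net consists of curves with the properties of
  \<open>K\<close>.\<close>

lemma lipschitz_finite_net:
  fixes K :: "(real \<Rightarrow> 'a::real_normed_vector) set"
  assumes lip: "\<And>w. w \<in> K \<Longrightarrow> L-lipschitz_on {0..1} w" and Z: "\<And>w. w \<in> K \<Longrightarrow> w ` {0..1} \<subseteq> Z"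
    and "compact Z" "d > 0"
  obtains F where "finite F" "F \<subseteq> K" "\<And>w. w \<in> K \<Longrightarrow> \<exists>w'\<in>F. \<forall>s\<in>{0..1}. norm (w s - w' s) \<le> d"
proof -
  obtain A where A: "finite A" "A \<subseteq> Z" "Z \<subseteq> (\<Union>a\<in>A. ball a (d / 4))"
    by (rule compactE_image[OF \<open>compact Z\<close>, of Z "\<lambda>a. ball a (d / 4)"]) (use \<open>d > 0\<close> in auto)
  have "\<exists>a\<in>A. norm (a - v) < d / 4" if "v \<in> Z" for v
    using subsetD[OF A(3) that] unfolding UN_iff mem_ball dist_norm .
  then obtain c where c: "\<And>v. v \<in> Z \<Longrightarrow> c v \<in> A" "\<And>v. v \<in> Z \<Longrightarrow> norm (c v - v) < d / 4"
    by metis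
  \<comment> \<open>The absolute value covers an empty \<open>K\<close>, where nothing forces
    \<open>L\<close> to be nonnegative.\<close>
  obtain q :: nat where q: "4 * \<bar>L\<bar> / d < real q"
    using reals_Archimedean2 by blast
  have "0 \<le> 4 * \<bar>L\<bar> / d"
    using \<open>d > 0\<close> by simp
  then have "q > 0"
    using q by (metis le_less_trans of_nat_0_less_iff)
  have Lq: "2 * (L / real q) \<le> d / 2"
  proof -
    have "4 * L \<le> d * real q"
      using q \<open>d > 0\<close> by (simp add: pos_divide_less_eq mult.commute)
    then show ?thesis
      using \<open>q > 0\<close> by (simp add: field_simps)
  qed
  define label where "label w = restrict (\<lambda>i. c (w (real i / real q))) {..q}" for w
  have grid: "real i / real q \<in> {0..1}" if "i \<le> q" for i
    using that by (auto simp: divide_le_eq)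
  have "label ` K \<subseteq> {..q} \<rightarrow>\<^sub>E A"
  proof
    fix l assume "l \<in> label ` K"
    then obtain w where w: "w \<in> K" "l = label w"
      by blast
    have "c (w (real i / real q)) \<in> A" if "i \<le> q" for i
      using Z[OF w(1)] grid[OF that] by (intro c(1)) blast
    then show "l \<in> {..q} \<rightarrow>\<^sub>E A"
      by (simp add: w(2) label_def)
  qed
  then have fin: "finite (label ` K)"
    by (rule finite_subset) (intro finite_PiE finite_atMost A(1))
  define rep where "rep l = (SOME w. w \<in> K \<and> label w = l)" for l
  have "rep (label w) \<in> K \<and> label (rep (label w)) = label w" if "w \<in> K" for w
    unfolding rep_def by (rule someI[of _ w]) (use that in simp)
  then have rep: "rep (label w) \<in> K" "label (rep (label w)) = label w" if "w \<in> K" for w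
    using that by blast+
  show thesis
  proof (rule that[of "rep ` label ` K"])
    show "\<exists>w'\<in>rep ` label ` K. \<forall>s\<in>{0..1}. norm (w s - w' s) \<le> d" if "w \<in> K" for w
    proof (intro bexI[of _ "rep (label w)"] ballI)
      fix s :: real assume s: "s \<in> {0..1}"
      let ?w' = "rep (label w)"
      have "norm (w (real i / real q) - ?w' (real i / real q)) \<le> d / 2" if "i \<le> q" for i
      proof -
        have "c (w (real i / real q)) = c (?w' (real i / real q))"
          using fun_cong[OF rep(2)[OF \<open>w \<in> K\<close>], of i] that by (simp add: label_def)
        moreover have "w (real i / real q) \<in> Z" "?w' (real i / real q) \<in> Z"
          using Z[OF \<open>w \<in> K\<close>] Z[OF rep(1)[OF \<open>w \<in> K\<close>]] grid[OF that] by auto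
        ultimately have "norm (c (?w' (real i / real q)) - w (real i / real q)) < d / 4"
          "norm (c (?w' (real i / real q)) - ?w' (real i / real q)) < d / 4"
          using c(2)[of "w (real i / real q)"] c(2)[of "?w' (real i / real q)"] by simp_all
        then show ?thesis
          using norm_triangle_ineq4[of "c (?w' (real i / real q)) - ?w' (real i / real q)"
              "c (?w' (real i / real q)) - w (real i / real q)"] by simp
      qed
      from lipschitz_close_on_grid[OF lip[OF \<open>w \<in> K\<close>] lip[OF rep(1)[OF \<open>w \<in> K\<close>]] \<open>q > 0\<close> this s] Lq
      show "norm (w s - ?w' s) \<le> d" by simp
    qed (use that in auto)
  qed (use fin rep in auto)
qed

text \<open>The infimum of the admissible accuracies need not be admissible, but every number
  strictly above it is, by monotonicity. Adding \<open>\<epsilon>\<close> moves strictly above it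
  and does not disturb the limit.\<close>

lemma vanishing_bound:
  fixes Q :: "real \<Rightarrow> real \<Rightarrow> bool"
  assumes ev: "\<And>\<delta>. \<delta> > 0 \<Longrightarrow> \<forall>\<^sub>F \<epsilon> in at_right 0. Q \<delta> \<epsilon>"
    and mono: "\<And>\<delta> \<delta>' \<epsilon>. Q \<delta> \<epsilon> \<Longrightarrow> \<delta> \<le> \<delta>' \<Longrightarrow> Q \<delta>' \<epsilon>"
  shows "\<exists>\<psi>. (\<psi> \<longlongrightarrow> 0) (at_right 0) \<and> (\<forall>\<^sub>F \<epsilon> in at_right 0. Q (\<psi> \<epsilon>) \<epsilon>)"
proof -
  define \<psi> where "\<psi> \<epsilon> = Inf {\<delta>. 0 < \<delta> \<and> Q \<delta> \<epsilon>} + \<epsilon>" for \<epsilon>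
  have bdd: "bdd_below {\<delta>. 0 < \<delta> \<and> Q \<delta> \<epsilon>}" for \<epsilon>
    by (rule bdd_belowI[of _ 0]) auto
  have pos: "\<forall>\<^sub>F \<epsilon> in at_right (0::real). 0 < \<epsilon>"
    by (rule eventually_at_right_less)
  have "(\<psi> \<longlongrightarrow> 0) (at_right 0)"
  proof (rule tendstoI)
    fix e :: real assume "e > 0"
    have "\<forall>\<^sub>F \<epsilon> in at_right 0. Q (e / 2) \<epsilon>"
      using \<open>e > 0\<close> by (intro ev) simp
    moreover have "\<forall>\<^sub>F \<epsilon> in at_right (0::real). \<epsilon> < e / 2"
      using \<open>e > 0\<close> by (intro eventually_at_right_field[THEN iffD2] exI[of _ "e / 2"]) auto
    ultimately show "\<forall>\<^sub>F \<epsilon> in at_right 0. dist (\<psi> \<epsilon>) 0 < e"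
      using pos
    proof eventually_elim
      case (elim \<epsilon>)
      have "Inf {\<delta>. 0 < \<delta> \<and> Q \<delta> \<epsilon>} \<le> e / 2"
        using elim \<open>e > 0\<close> by (intro cInf_lower bdd) auto
      moreover have "0 \<le> Inf {\<delta>. 0 < \<delta> \<and> Q \<delta> \<epsilon>}"
        using elim \<open>e > 0\<close> by (intro cInf_greatest) (auto intro!: exI[of _ "e / 2"])
      ultimately show ?case
        using elim by (simp add: \<psi>_def dist_real_def)
    qed
  qed
  moreover have "\<forall>\<^sub>F \<epsilon> in at_right 0. Q (\<psi> \<epsilon>) \<epsilon>"
    using ev[OF zero_less_one] pos
  proof eventually_elim
    case (elim \<epsilon>)
    have "{\<delta>. 0 < \<delta> \<and> Q \<delta> \<epsilon>} \<noteq> {}"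
      using elim(1) zero_less_one by blast
    then have "\<exists>\<delta>\<in>{\<delta>. 0 < \<delta> \<and> Q \<delta> \<epsilon>}. \<delta> < \<psi> \<epsilon>"
      using elim(2) by (intro cInf_lessD) (simp_all add: \<psi>_def)
    then obtain \<delta> where "\<delta> \<in> {\<delta>. 0 < \<delta> \<and> Q \<delta> \<epsilon>}" "\<delta> < \<psi> \<epsilon>"
      by blast
    then show ?case
      using mono[of \<delta> \<epsilon> "\<psi> \<epsilon>"] by simp
  qed
  ultimately show ?thesis by blast
qed

section \<open>Comparison of hybrid and averaged solutions\<close>

context noisy_averaging
begin

text \<open>In the interior of a sampling interval the derivative is two-sided. The finitely many
  sampling times in \<open>{0..1}\<close> are exceptional points that the fundamental theorem of
  calculus permits for a continuous curve.\<close>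

lemma hybrid_solution_trajectory:
  assumes "\<epsilon> > 0" and hyb: "hybrid_solution f g y0 z0 \<epsilon> \<pi> \<xi> z" and Z: "z ` {0..1} \<subseteq> Z"
  shows "trajectory \<epsilon> (sample f \<pi> y0 \<xi>) z"
  unfolding trajectory_def
proof (intro conjI allI impI Z)
  show "sample f \<pi> y0 \<xi> t \<in> X" for t
    by (rule sample_in_X[OF y0])
  show "z 0 = z0"
    using hyb by (simp add: hybrid_solution_def)
  fix a b :: real assume ab: "0 \<le> a" "a \<le> b" "b \<le> 1"
  define S where "S = (\<lambda>t. \<epsilon> * real t) ` {..step_index \<epsilon> 1}"
  show "((\<lambda>r. vel (z r) (sample f \<pi> y0 \<xi> (step_index \<epsilon> r))) has_integral z b - z a) {a..b}"
  proof (rule fundamental_theorem_of_calculus_interior_strong[of S])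
    show "continuous_on {a..b} z"
      using hyb ab by (auto simp: hybrid_solution_def intro: continuous_on_subset)
    fix r assume r: "r \<in> {a<..<b} - S"
    define t where "t = step_index \<epsilon> r"
    have r01: "0 < r" "r < 1"
      using r ab by auto
    have t: "\<epsilon> * real t \<le> r" "r < \<epsilon> * (real t + 1)"
      using step_index_bounds[OF \<open>\<epsilon> > 0\<close>, of r] r01 by (auto simp: t_def)
    have "t \<le> step_index \<epsilon> 1"
      unfolding t_def step_index_def using r01 \<open>\<epsilon> > 0\<close> by (intro nat_mono floor_mono divide_right_mono) auto
    then have "\<epsilon> * real t \<noteq> r"
      using r by (auto simp: S_def)
    define I where "I = {\<epsilon> * real t..<\<epsilon> * (real t + 1)} \<inter> {0..1}"
    have "(z has_vector_derivative g (z r) (state f \<pi> y0 \<xi> t) (control \<pi> \<xi> t)) (at r within I)"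
      using hyb t r01 by (auto simp: hybrid_solution_def Let_def I_def)
    moreover have interior: "r \<in> interior I"
    proof (rule interiorI)
      show "open ({\<epsilon> * real t<..<\<epsilon> * (real t + 1)} \<inter> {0<..<1})"
        by (intro open_Int open_greaterThanLessThan)
      show "r \<in> {\<epsilon> * real t<..<\<epsilon> * (real t + 1)} \<inter> {0<..<1}"
        using t r01 \<open>\<epsilon> * real t \<noteq> r\<close> by auto
    qed (auto simp: I_def)
    ultimately show "(z has_vector_derivative vel (z r) (sample f \<pi> y0 \<xi> (step_index \<epsilon> r))) (at r)"
      unfolding at_within_interior[OF interior] vel_def sample_def t_def by simp
  qed (use ab in \<open>auto simp: S_def\<close>)
qed

lemma averaged_approximation:
  assumes "\<delta> > 0"
  shows "\<forall>\<^sub>F \<epsilon> in at_right 0. \<forall>\<pi>\<in>control_plans \<epsilon>. \<forall>zh.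
    (\<forall>\<omega>\<in>space M. trajectory \<epsilon> (sample f \<pi> y0 (noise \<omega>)) (zh \<omega>)) \<longrightarrow>
    (\<exists>z. (\<forall>\<omega>\<in>space M. inclusion_solution V z0 (z \<omega>)) \<and>
      (\<forall>s\<in>{0..1}. (\<lambda>\<omega>. z \<omega> s) \<in> borel_measurable M \<and>
        integrable M (\<lambda>\<omega>. norm (zh \<omega> s - z \<omega> s)) \<and>
        M.expectation (\<lambda>\<omega>. norm (zh \<omega> s - z \<omega> s)) \<le> \<delta>))"
proof -
  obtain R where R: "R > 0" "\<And>v. v \<in> Z \<Longrightarrow> norm v \<le> R"
    using compact_imp_bounded[OF compact_Z] unfolding bounded_pos by blast
  \<comment> \<open>Half of \<open>\<delta>\<close> is spent on the good event in three equal
    shares: the distance to a solution, the distance to the net, and the passage from grid times to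
    all times.\<close>
  define d where "d = \<delta> / 6"
  have "d > 0"
    using \<open>\<delta> > 0\<close> by (simp add: d_def)
  \<comment> \<open>The bad event costs at most \<open>2 * R * \<eta>\<close>, the other half of
    \<open>\<delta>\<close>. The cap \<open>1 / 2\<close> makes the good event nonempty, which
    guarantees a member of the net to select.\<close>
  define \<eta> where "\<eta> = min (1 / 2) (\<delta> / (4 * R))"
  have \<eta>: "\<eta> > 0" "\<eta> < 1" "2 * R * \<eta> \<le> \<delta> / 2"
    using \<open>\<delta> > 0\<close> R(1) by (auto simp: \<eta>_def min_def field_simps)
  obtain k where k: "\<And>\<epsilon> x \<zeta>. trajectory \<epsilon> x \<zeta> \<Longrightarrow>
      (\<forall>j<k. \<forall>b\<in>{0..1}. \<bar>cumulative_drift \<epsilon> x (from_nat j) b\<bar> \<le> 1 / real k) \<Longrightarrow>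
      \<exists>z. averaged_solution z \<and> (\<forall>s\<in>{0..1}. norm (\<zeta> s - z s) < d)"
    using trajectory_near_solution[OF \<open>d > 0\<close>] by blast
  obtain F where F: "finite F" "F \<subseteq> Collect averaged_solution"
    and net: "\<And>w. averaged_solution w \<Longrightarrow> \<exists>w'\<in>F. \<forall>s\<in>{0..1}. norm (w s - w' s) \<le> d"
  proof (rule lipschitz_finite_net[of "Collect averaged_solution" speed Z d])
    show "w ` {0..1} \<subseteq> Z" "speed-lipschitz_on {0..1} w" if "w \<in> Collect averaged_solution" for w
      using that unfolding averaged_solution_def by blast+
  qed (use compact_Z \<open>d > 0\<close> in auto)
  \<comment> \<open>Two curves with Lipschitz constant \<open>speed\<close> then drift apart by at
    most \<open>d\<close> between neighbouring grid times.\<close>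
  obtain q :: nat where q: "2 * speed / d < real q"
    using reals_Archimedean2 by blast
  have "0 \<le> 2 * speed / d"
    using \<open>d > 0\<close> speed(1) by simp
  then have "q > 0"
    using q by (metis le_less_trans of_nat_0_less_iff)
  have speed_q: "2 * (speed / real q) \<le> d"
    using q \<open>d > 0\<close> \<open>q > 0\<close> by (simp add: pos_divide_less_eq mult.commute divide_le_eq)
  have grid: "real i / real q \<in> {0..1}" if "i \<le> q" for i
    using that by (auto simp: divide_le_eq)
  show ?thesis
    using small_drift_with_high_probability[OF \<eta>(1), of k] eventually_at_right_less[of "0::real"]
  proof eventually_elim
    case (elim \<epsilon>)
    show ?case
    proof (intro ballI allI impI)
      fix \<pi> and zh :: "'w \<Rightarrow> real \<Rightarrow> real ^ 'n"
      assume \<pi>: "\<pi> \<in> control_plans \<epsilon>"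
        and tr: "\<forall>\<omega>\<in>space M. trajectory \<epsilon> (sample f \<pi> y0 (noise \<omega>)) (zh \<omega>)"
      obtain G where G: "G \<in> sets M" "1 - \<eta> \<le> M.prob G"
        and small: "\<And>\<omega>. \<omega> \<in> G \<Longrightarrow> \<forall>j<k. \<forall>b\<in>{0..1}.
          \<bar>cumulative_drift \<epsilon> (sample f \<pi> y0 (noise \<omega>)) (from_nat j) b\<bar> \<le> 1 / real k"
        using bspec[OF elim(1) \<pi>] by blast
      have G_space: "G \<subseteq> space M"
        using G(1) by (rule sets.sets_into_space)
      have zh_meas: "(\<lambda>\<omega>. zh \<omega> s) \<in> borel_measurable M" if "s \<in> {0..1}" for s
      proof (rule measurable_trajectory[OF elim(2) _ _ that])
        show "(\<lambda>\<omega>. sample f \<pi> y0 (noise \<omega>) t) \<in> M \<rightarrow>\<^sub>M borel" if "t \<le> nat \<lfloor>1 / \<epsilon>\<rfloor>" for t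
          by (rule measurable_sample_noise[OF \<pi> that])
      qed (use tr in blast)
      have near: "\<exists>w\<in>F. \<forall>s\<in>{0..1}. norm (zh \<omega> s - w s) \<le> 2 * d" if \<omega>: "\<omega> \<in> G" for \<omega>
      proof -
        have "trajectory \<epsilon> (sample f \<pi> y0 (noise \<omega>)) (zh \<omega>)"
          using tr \<omega> G_space by blast
        from k[OF this small[OF \<omega>]] obtain w where w: "averaged_solution w" "\<And>s. s \<in> {0..1} \<Longrightarrow> norm (zh \<omega> s - w s) < d"
          by blast
        obtain w' where w': "w' \<in> F" "\<And>s. s \<in> {0..1} \<Longrightarrow> norm (w s - w' s) \<le> d"
          using net[OF w(1)] by blast
        have "norm (zh \<omega> s - w' s) \<le> 2 * d" if "s \<in> {0..1}" for s
          using norm_triangle_ineq[of "zh \<omega> s - w s" "w s - w' s"] w(2)[OF that] w'(2)[OF that] by simp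
        with w'(1) show ?thesis by blast
      qed
      have "G \<noteq> {}"
        using G(2) \<eta>(2) by auto
      then have "F \<noteq> {}"
        using near by blast
      define w where "w = from_nat_into F"
      have wF: "w i \<in> F" for i
        unfolding w_def using \<open>F \<noteq> {}\<close> by (rule from_nat_into)
      then have w_sol: "averaged_solution (w i)" for i
        using F(2) by blast
      \<comment> \<open>Finitely many grid times keep the test measurable. If no index qualifies,
        the value still indexes a solution with values in \<open>Z\<close>, which is all that the
        bad event needs.\<close>
      define idx where "idx \<omega> = (LEAST i. \<forall>j\<in>{..q}. norm (zh \<omega> (real j / real q) - w i (real j / real q)) \<le> 2 * d)" for \<omega>
      define z where "z \<omega> = w (idx \<omega>)" for \<omega>
      have idx_meas: "idx \<in> M \<rightarrow>\<^sub>M count_space UNIV"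
        unfolding idx_def
      proof (intro measurable_Least pred_intros_finite)
        fix i j assume "j \<in> {..q}"
        then have "(\<lambda>\<omega>. zh \<omega> (real j / real q)) \<in> borel_measurable M"
          by (intro zh_meas grid) simp
        then show "Measurable.pred M (\<lambda>\<omega>. norm (zh \<omega> (real j / real q) - w i (real j / real q)) \<le> 2 * d)"
          by measurable
      qed simp
      have zh_lip: "speed-lipschitz_on {0..1} (zh \<omega>)" if "\<omega> \<in> space M" for \<omega>
        using tr that trajectory_lipschitz by blast
      have zh_Z: "zh \<omega> s \<in> Z" if "\<omega> \<in> space M" "s \<in> {0..1}" for \<omega> s
        using tr that trajectory_in_Z by blast
      have z_Z: "z \<omega> s \<in> Z" if "s \<in> {0..1}" for \<omega> s
        using w_sol[of "idx \<omega>"] that by (auto simp: averaged_solution_def z_def)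
      have close: "norm (zh \<omega> s - z \<omega> s) \<le> 3 * d" if \<omega>: "\<omega> \<in> G" and s: "s \<in> {0..1}" for \<omega> s
      proof -
        obtain w' where w': "w' \<in> F" "\<And>s. s \<in> {0..1} \<Longrightarrow> norm (zh \<omega> s - w' s) \<le> 2 * d"
          using near[OF \<omega>] by blast
        obtain i where "w i = w'"
          using from_nat_into_surj[OF countable_finite[OF F(1)] w'(1)] by (auto simp: w_def)
        then have "\<forall>j\<in>{..q}. norm (zh \<omega> (real j / real q) - w i (real j / real q)) \<le> 2 * d"
          using w'(2) grid by auto
        then have "\<forall>j\<in>{..q}. norm (zh \<omega> (real j / real q) - z \<omega> (real j / real q)) \<le> 2 * d"
          unfolding z_def idx_def by (rule LeastI)
        then have "norm (zh \<omega> s - z \<omega> s) \<le> 2 * d + 2 * (speed / real q)"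
          using zh_lip \<omega> G_space w_sol[of "idx \<omega>"] \<open>q > 0\<close> s
          by (intro lipschitz_close_on_grid) (auto simp: averaged_solution_def z_def)
        with speed_q show ?thesis by simp
      qed
      show "\<exists>z. (\<forall>\<omega>\<in>space M. inclusion_solution V z0 (z \<omega>)) \<and>
        (\<forall>s\<in>{0..1}. (\<lambda>\<omega>. z \<omega> s) \<in> borel_measurable M \<and>
          integrable M (\<lambda>\<omega>. norm (zh \<omega> s - z \<omega> s)) \<and>
          M.expectation (\<lambda>\<omega>. norm (zh \<omega> s - z \<omega> s)) \<le> \<delta>)"
      proof (intro exI[of _ z] conjI ballI)
        show "inclusion_solution V z0 (z \<omega>)" for \<omega>
          using w_sol by (simp add: z_def averaged_solution_def)
        fix s :: real assume s: "s \<in> {0..1}"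
        show z_meas: "(\<lambda>\<omega>. z \<omega> s) \<in> borel_measurable M"
          unfolding z_def by (rule measurable_compose[OF idx_meas]) simp
        have far: "norm (zh \<omega> s - z \<omega> s) \<le> 2 * R" if "\<omega> \<in> space M" for \<omega>
          using norm_triangle_ineq4[of "zh \<omega> s" "z \<omega> s"] R(2)[OF zh_Z[OF that s]] R(2)[OF z_Z[OF s, of \<omega>]] by simp
        show int: "integrable M (\<lambda>\<omega>. norm (zh \<omega> s - z \<omega> s))"
          using far zh_meas[OF s] z_meas by (intro M.integrable_const_bound[of _ "2 * R"]) auto
        have "norm (zh \<omega> s - z \<omega> s) \<le> 3 * d + 2 * R * indicator (space M - G) \<omega>" if "\<omega> \<in> space M" for \<omega>
          using close[OF _ s, of \<omega>] far[OF that] that \<open>d > 0\<close> by (auto split: split_indicator)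
        then have "M.expectation (\<lambda>\<omega>. norm (zh \<omega> s - z \<omega> s)) \<le>
            M.expectation (\<lambda>\<omega>. 3 * d + 2 * R * indicator (space M - G) \<omega>)"
          using int G(1) by (intro integral_mono) (auto intro!: M.integrable_const_bound[of _ "3 * \<bar>d\<bar> + 2 * \<bar>R\<bar>"] split: split_indicator)
        also have "\<dots> = 3 * d + 2 * R * M.prob (space M - G)"
        proof -
          have bad: "space M - G \<in> sets M"
            using G(1) by auto
          then have "integrable M (indicat_real (space M - G))"
            by (intro integrable_real_indicator) (auto simp: less_top[symmetric])
          then show ?thesis
            using bad by (subst Bochner_Integration.integral_add) (auto simp: M.prob_space)
        qed
        also have "\<dots> \<le> 3 * d + 2 * R * \<eta>"
          using G R(1) by (intro add_mono mult_left_mono) (auto simp: M.prob_compl)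
        also have "\<dots> \<le> \<delta>"
          using \<eta>(3) by (simp add: d_def)
        finally show "M.expectation (\<lambda>\<omega>. norm (zh \<omega> s - z \<omega> s)) \<le> \<delta>" .
      qed
    qed
  qed
qed

end

section \<open>The averaging theorem\<close>

text \<open>The comparison solution is chosen per realization because the controls, and with them
  the averaged motion, may depend on the noise. It must depend measurably on the realization for the
  expectation to make sense. \<open>\<psi>\<close> is chosen before the plan, so the rate is uniform
  over plans.\<close>

theorem theorem6p1:
  fixes f :: "real ^ 'm \<Rightarrow> 'u::{metric_space, second_countable_topology} \<Rightarrow>
              's::{metric_space, second_countable_topology} \<Rightarrow> real ^ 'm"
    and g :: "real ^ 'n \<Rightarrow> real ^ 'm \<Rightarrow> 'u \<Rightarrow> real ^ 'n"
    and Y :: "(real ^ 'm) set" and Z :: "(real ^ 'n) set"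
    and y0 :: "real ^ 'm" and z0 :: "real ^ 'n" and C :: real
    and M :: "'w measure" and \<sigma> :: "nat \<Rightarrow> 'w \<Rightarrow> 's" and P :: "'s measure"
  assumes "compact Y" and "compact (UNIV :: 'u set)" and "compact (UNIV :: 's set)"
    and "continuous_on (Y \<times> UNIV \<times> UNIV) (\<lambda>(y, u, \<sigma>). f y u \<sigma>)"
    and "\<And>y u \<sigma>. y \<in> Y \<Longrightarrow> f y u \<sigma> \<in> Y"
    and "prob_space M"
    and "prob_space.indep_vars M (\<lambda>_. borel) \<sigma> UNIV"
    and "\<And>t. distr M borel (\<sigma> t) = P"
    and "y0 \<in> Y"
    and "continuous_on (UNIV \<times> Y \<times> UNIV) (\<lambda>(z, y, u). g z y u)"
    and "compact Z"
    and "\<forall>\<^sub>F \<epsilon> in at_right 0. \<forall>\<pi>\<in>control_plans \<epsilon>. \<forall>\<omega>\<in>space M. \<forall>z.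
           hybrid_solution f g y0 z0 \<epsilon> \<pi> (\<lambda>t. \<sigma> t \<omega>) z \<longrightarrow> z ` {0..1} \<subseteq> interior Z"
    and "C > 0"
    and "\<And>z1 z2 y u. z1 \<in> Z \<Longrightarrow> z2 \<in> Z \<Longrightarrow> y \<in> Y \<Longrightarrow>
           norm (g z1 y u - g z2 y u) \<le> C * norm (z1 - z2)"
  shows "\<exists>\<psi> :: real \<Rightarrow> real. (\<psi> \<longlongrightarrow> 0) (at_right 0) \<and>
    (\<forall>\<^sub>F \<epsilon> in at_right 0. \<forall>\<pi>\<in>control_plans \<epsilon>. \<forall>zh :: 'w \<Rightarrow> real \<Rightarrow> real ^ 'n.
      (\<forall>\<omega>\<in>space M. hybrid_solution f g y0 z0 \<epsilon> \<pi> (\<lambda>t. \<sigma> t \<omega>) (zh \<omega>)) \<longrightarrow>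
      (\<exists>z :: 'w \<Rightarrow> real \<Rightarrow> real ^ 'n.
        (\<forall>\<omega>\<in>space M. inclusion_solution
            (averaged_velocities (stationary_measures f Y P) g) z0 (z \<omega>)) \<and>
        (\<forall>s\<in>{0..1}. (\<lambda>\<omega>. z \<omega> s) \<in> borel_measurable M \<and>
          integrable M (\<lambda>\<omega>. norm (zh \<omega> s - z \<omega> s)) \<and>
          prob_space.expectation M (\<lambda>\<omega>. norm (zh \<omega> s - z \<omega> s)) \<le> \<psi> \<epsilon>)))"
proof -
  interpret M: prob_space M
    by fact
  have indep: "M.indep_vars (\<lambda>_. borel) \<sigma> UNIV"
    by fact
  then have "\<sigma> 0 \<in> M \<rightarrow>\<^sub>M borel"
    by (simp add: M.indep_vars_def)
  then have "prob_space P"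
    using M.prob_space_distr[of "\<sigma> 0" borel] assms(8) by simp
  moreover have "sets P = sets borel"
    using assms(8)[of 0] sets_distr[of M borel "\<sigma> 0"] by simp
  ultimately have system: "controlled_system f Y P"
    using assms(1,2,4,5) by (simp add: controlled_system_def)
  interpret noisy_averaging f Y P g Z z0 C M \<sigma> y0
  proof (rule noisy_averaging.intro)
    show "averaging f Y P g Z C"
      by (rule averaging.intro[OF system averaging_axioms.intro[OF assms(10,11,13,14)]])
    show "noisy_system f Y P M \<sigma> y0"
      by (rule noisy_system.intro[OF system assms(6) noisy_system_axioms.intro[OF assms(7-9)]])
  qed
  \<comment> \<open>With the accuracy as a parameter the assertion is monotone in it, and a single
    \<open>\<psi>\<close> can be extracted for all plans at once.\<close>
  define Q where "Q \<delta> \<epsilon> \<longleftrightarrow> (\<forall>\<pi>\<in>control_plans \<epsilon>. \<forall>zh :: 'w \<Rightarrow> real \<Rightarrow> real ^ 'n.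
      (\<forall>\<omega>\<in>space M. hybrid_solution f g y0 z0 \<epsilon> \<pi> (\<lambda>t. \<sigma> t \<omega>) (zh \<omega>)) \<longrightarrow>
      (\<exists>z :: 'w \<Rightarrow> real \<Rightarrow> real ^ 'n. (\<forall>\<omega>\<in>space M. inclusion_solution V z0 (z \<omega>)) \<and>
        (\<forall>s\<in>{0..1}. (\<lambda>\<omega>. z \<omega> s) \<in> borel_measurable M \<and>
          integrable M (\<lambda>\<omega>. norm (zh \<omega> s - z \<omega> s)) \<and>
          M.expectation (\<lambda>\<omega>. norm (zh \<omega> s - z \<omega> s)) \<le> \<delta>)))" for \<delta> \<epsilon>
  have "\<exists>\<psi>. (\<psi> \<longlongrightarrow> 0) (at_right 0) \<and> (\<forall>\<^sub>F \<epsilon> in at_right 0. Q (\<psi> \<epsilon>) \<epsilon>)"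
  proof (rule vanishing_bound)
    fix \<delta> :: real assume "\<delta> > 0"
    from averaged_approximation[OF this] assms(12) eventually_at_right_less[of "0::real"]
    show "\<forall>\<^sub>F \<epsilon> in at_right 0. Q \<delta> \<epsilon>"
    proof eventually_elim
      case (elim \<epsilon>)
      show ?case
        unfolding Q_def
      proof (intro ballI allI impI)
        fix \<pi> and zh :: "'w \<Rightarrow> real \<Rightarrow> real ^ 'n"
        assume \<pi>: "\<pi> \<in> control_plans \<epsilon>"
          and hyb: "\<forall>\<omega>\<in>space M. hybrid_solution f g y0 z0 \<epsilon> \<pi> (\<lambda>t. \<sigma> t \<omega>) (zh \<omega>)"
        have "trajectory \<epsilon> (sample f \<pi> y0 (noise \<omega>)) (zh \<omega>)" if \<omega>: "\<omega> \<in> space M" for \<omega>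
        proof (rule hybrid_solution_trajectory[OF elim(3)])
          show "hybrid_solution f g y0 z0 \<epsilon> \<pi> (noise \<omega>) (zh \<omega>)"
            using hyb \<omega> by blast
          then have "zh \<omega> ` {0..1} \<subseteq> interior Z"
            using bspec[OF bspec[OF elim(2) \<pi>] \<omega>] by blast
          then show "zh \<omega> ` {0..1} \<subseteq> Z"
            using interior_subset by blast
        qed
        then show "\<exists>z. (\<forall>\<omega>\<in>space M. inclusion_solution V z0 (z \<omega>)) \<and>
          (\<forall>s\<in>{0..1}. (\<lambda>\<omega>. z \<omega> s) \<in> borel_measurable M \<and>
            integrable M (\<lambda>\<omega>. norm (zh \<omega> s - z \<omega> s)) \<and>
            M.expectation (\<lambda>\<omega>. norm (zh \<omega> s - z \<omega> s)) \<le> \<delta>)"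
          using bspec[OF elim(1) \<pi>, THEN spec, of zh] by blast
      qed
    qed
  next
    fix \<delta> \<delta>' \<epsilon> :: real assume Q: "Q \<delta> \<epsilon>" and "\<delta> \<le> \<delta>'"
    show "Q \<delta>' \<epsilon>"
      unfolding Q_def
    proof (intro ballI allI impI)
      fix \<pi> and zh :: "'w \<Rightarrow> real \<Rightarrow> real ^ 'n"
      assume \<pi>: "\<pi> \<in> control_plans \<epsilon>"
        and hyb: "\<forall>\<omega>\<in>space M. hybrid_solution f g y0 z0 \<epsilon> \<pi> (\<lambda>t. \<sigma> t \<omega>) (zh \<omega>)"
      obtain z where z: "\<forall>\<omega>\<in>space M. inclusion_solution V z0 (z \<omega>)"
        and close: "\<forall>s\<in>{0..1}. (\<lambda>\<omega>. z \<omega> s) \<in> borel_measurable M \<and>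
          integrable M (\<lambda>\<omega>. norm (zh \<omega> s - z \<omega> s)) \<and>
          M.expectation (\<lambda>\<omega>. norm (zh \<omega> s - z \<omega> s)) \<le> \<delta>"
        using Q[unfolded Q_def, THEN bspec, OF \<pi>, THEN spec, THEN mp, OF hyb] by (elim exE conjE)
      show "\<exists>z. (\<forall>\<omega>\<in>space M. inclusion_solution V z0 (z \<omega>)) \<and>
          (\<forall>s\<in>{0..1}. (\<lambda>\<omega>. z \<omega> s) \<in> borel_measurable M \<and>
            integrable M (\<lambda>\<omega>. norm (zh \<omega> s - z \<omega> s)) \<and>
            M.expectation (\<lambda>\<omega>. norm (zh \<omega> s - z \<omega> s)) \<le> \<delta>')"
      proof (intro exI[of _ z] conjI ballI)
        fix s :: real assume "s \<in> {0..1}"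
        note s = bspec[OF close this]
        show "(\<lambda>\<omega>. z \<omega> s) \<in> borel_measurable M"
          by (rule conjunct1[OF s])
        show "integrable M (\<lambda>\<omega>. norm (zh \<omega> s - z \<omega> s))"
          by (rule conjunct1[OF conjunct2[OF s]])
        show "M.expectation (\<lambda>\<omega>. norm (zh \<omega> s - z \<omega> s)) \<le> \<delta>'"
          by (rule order_trans[OF conjunct2[OF conjunct2[OF s]] \<open>\<delta> \<le> \<delta>'\<close>])
      qed (rule bspec[OF z])
    qed
  qed
  then show ?thesis
    unfolding Q_def .
qed

end
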